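(* Assume the data generating conditions (i)-(iv) of the context, that every $\phi_k$ is Lipschitz continuous, that there are $s>0$ and a finite $C_s>0$ with $\sum_{k\ge1}k^{2s}\|\beta_k\|^2_{L^2(\mathcal U)}\le C_s$, and that $\Gamma_X$ is continuous. Let $C_2=\mathbb E\bigl[\|X\|^2_{L^2(\mathcal U\times\mathcal T)}\bigr]$ and $C_1=\bigl(\sup_{t\in\mathcal T}\|\mu(\cdot,t)\|^2_{L^2(\mathcal U)}+\|\Gamma_X\|_\infty+\|\tau\|_\infty^2\nu(\mathcal U)\bigr)/g_{\min}$. Then the optimal truncations (that is, the values of $K$ minimizing the upper bound on $\mathcal R(\widehat\mu;K)$ recalled in the context) for the OBS weights $\omega_{ij}=1/M$ and the SUBJ weights $\omega_{ij}=1/(nm_i)$ are $$K_1^*=\Bigl\{\frac{2sC_s(n\bar m_A+1)}{C_1}\Bigr\}^{\frac1{2s+1}}\quad\text{and}\quad K_2^*=\Bigl\{\frac{2sC_s(n\bar m_H+1)}{C_1}\Bigr\}^{\frac1{2s+1}},$$ respectively. If moreover $1\le m_i\le m_{\max}$ for all $1\le i\le n$, with a constant $m_{\max}$ independent of $n$, then the risk bounds associated with $K_1^*$ and $K_2^*$ are $$\mathcal R^*(\widehat\mu)\le C(n)\Bigl[\tfrac{2s+1}{2s}\bigl(2sC_sC_1^{2s}\bigr)^{\frac1{2s+1}}\Bigr]\{n\bar{\mathfrak m}\}^{-\frac{2s}{2s+1}}+\frac{C_2m_{\max}}{M}-\frac{\|\mu\|^2_{L^2(\mathcal U\times\mathcal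 T)}}{n\bar{\mathfrak m}},$$ with $C(n)=(1+\{n\bar{\mathfrak m}\}^{-1})^{1/(2s+1)}\downarrow1$, and $\bar{\mathfrak m}=\bar m_A$ (OBS, $K_1^*$) and $\bar{\mathfrak m}=\bar m_H$ (SUBJ, $K_2^*$), respectively. In particular, with bounded $m_i$ and OBS or SUBJ weights, $$\mathcal R^*(\widehat\mu)\lesssim(n\bar m_H)^{-\frac{2s}{2s+1}}\asymp(n\bar m_A)^{-\frac{2s}{2s+1}}\asymp n^{-\frac{2s}{2s+1}}\asymp M^{-\frac{2s}{2s+1}}.$$
   Context: $\mathcal T\subset\mathbb R$ is a compact interval with Lebesgue measure; $(\mathcal U,d_{\mathcal U})$ is a separable metric space with its Borel $\sigma$-field and a finite Borel measure $\nu$. For subjects $i=1,\dots,n$ and visits $j=1,\dots,m_i$, one observes $(T_{ij},Y_{ij}(\cdot))$ with $$Y_{ij}(u)=\mu(u,T_{ij})+X_i(u,T_{ij})+\varepsilon_{ij}(u),\quad u\in\mathcal U,$$ where $\mu\in L^2(\mathcal U\times\mathcal T)$ is the deterministic mean function. $M=m_1+\dots+m_n$; $\bar m_A=n^{-1}\sum_im_i$ and $\bar m_H=\bigl(n^{-1}\sum_im_i^{-1}\bigr)^{-1}$ are the arithmetic and harmonic means of the visit counts $m_i$. Data generating conditions: (i) the $X_i$ are independent copies of a random field $X$ on $\mathcal U\times\mathcal T$ with $\mathbb E\|X\|^2_{L^2(\mathcal U\times\mathcal T)}<\infty$ and $\mathbb E[X(u,t)]=0$ for all $(u,t)$; (ii)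 the $T_{ij}$ are i.i.d. copies of $T$ with Lipschitz continuous density $g$, positive on $\mathcal T$; $g_{\min}=\inf_{\mathcal T}g$; (iii) $\varepsilon_{ij}(u)=\tau(T_{ij})\eta_{ij}(u)$ with $\tau:\mathcal T\to\mathbb R_+$ bounded deterministic and $\eta_{ij}$ i.i.d. random fields on $\mathcal U$ with $\mathbb E[\eta_{ij}(u)]=0$, $\mathrm{Var}(\eta_{ij}(u))=1$ for all $u$; (iv) the collections $\{T_{ij}\}$, $\{X_i\}$, $\{\eta_{ij}\}$ are mutually independent. $\Gamma_X(t,t')=\mathbb E\langle X(\cdot,t),X(\cdot,t')\rangle_{L^2(\mathcal U)}$; $\|\cdot\|_\infty$ is the sup norm; $[x]_+=\max(x,0)$. $\{\phi_k\}_{k\ge1}$ is an orthonormal basis of $L^2(\mathcal T)$, $\beta_k(u)=\int_{\mathcal T}\mu(u,t)\phi_k(t)\,dt$. Estimator (with $g$ known): $\widehat\beta_k(u)=\sum_{i,j}\omega_{ij}Y_{ij}(u)\phi_k(T_{ij})/g(T_{ij})$, $\widehat\mu(u,t)=\widehat\mu_K(u,t)=\sum_{k=1}^K\widehat\beta_k(u)\phi_k(t)$ for an integer truncation level $K\ge1$, and $\mathcal R(\widehat\mu;K)=\mathbb E\|\widehat\mu_K-\mu\|^2_{L^2(\mathcal U\times\mathcal T)}$. $\mathcal R^*(\widehat\mu)$ denotes the risk associated with the optimal truncation. Upper bound on the risk to which "optimal" refers (valid, under the assumptions of the claim, for deterministic weights summing to one with $\sum_{i,j}\omega_{ij}^2\le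 1+C_0M^{-1}$ for some $C_0\ge0$, in particular for OBS and SUBJ weights, and each $K\ge1$): $$\mathcal R(\widehat\mu;K)\le\Bigl(\sum_{i,j}\omega_{ij}^2\Bigr)\Bigl(C_1K-\|\mu\|^2_{L^2(\mathcal U\times\mathcal T)}+C_sK^{-2s}\Bigr)+\Bigl[\sum_i\sum_{j\ne j'}\omega_{ij}\omega_{ij'}\Bigr]_+C_2+C_sK^{-2s}.$$ The values $K_1^*,K_2^*$ are the unrounded minimizers; in practice one takes $\lceil K^*\rceil$ or the nearest integer. $a\lesssim b$ means $a\le Cb$ for a positive constant $C$; $a\asymp b$ means $a\lesssim b$ and $b\lesssim a$.
   Formalization: For SUBJ weights C(n) need not decrease in n, since n times the harmonic mean can drop; "C(n) decreases to 1" is stated as strict decrease in that product with limit 1 (decrease in n for OBS with fixed visit counts). C_1 is taken finite and positive. *)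

theory Defs
  imports "HOL-Probability.Probability"
begin

definition L2 :: "'a measure \<Rightarrow> ('a \<Rightarrow> real) \<Rightarrow> bool" where
  "L2 N f \<longleftrightarrow> f \<in> borel_measurable N \<and> integrable N (\<lambda>x. (f x)\<^sup>2)"

definition normsq :: "'a measure \<Rightarrow> ('a \<Rightarrow> real) \<Rightarrow> real" where
  "normsq N f = (\<integral>x. (f x)\<^sup>2 \<partial>N)"

text \<open>The basis functions are \<open>\<phi> 1, \<phi> 2, \<dots>\<close>; the value \<open>\<phi> 0\<close> is never used.\<close>

definition orthonormal_basis :: "'a measure \<Rightarrow> (nat \<Rightarrow> 'a \<Rightarrow> real) \<Rightarrow> bool" where
  "orthonormal_basis N \<phi> \<longleftrightarrow>
     (\<forall>k\<ge>1. L2 N (\<phi> k)) \<and>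
     (\<forall>j\<ge>1. \<forall>k\<ge>1. (\<integral>t. \<phi> j t * \<phi> k t \<partial>N) = (if j = k then 1 else 0)) \<and>
     (\<forall>f. L2 N f \<longrightarrow>
        (\<lambda>K. normsq N (\<lambda>t. f t - (\<Sum>k=1..K. (\<integral>r. f r * \<phi> k r \<partial>N) * \<phi> k t)))
          \<longlonglongrightarrow> 0)"

text \<open>
  A random field is a random element of a measurable space of paths on which the evaluation map
  is jointly measurable; \<open>field_law\<close> and \<open>noise_law\<close> are the laws of the generic fields
  \<open>X\<close> (on \<open>\<U> \<times> \<T>\<close>) and \<open>\<eta>\<close> (on \<open>\<U>\<close>) on their path spaces.  A path space, and not only the
  finite-dimensional distributions, is needed for a field to be evaluated at an independent
  random time: the field with \<open>X(t) = 1\<close> if \<open>t = T\<close> and \<open>X(t) = 0\<close> otherwise has the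
  finite-dimensional distributions of the zero field but \<open>X(T) = 1\<close>.
  The space \<open>\<U>\<close> is the whole type \<open>'u\<close>, and \<open>\<T>\<close> is the interval from \<open>t_lo\<close> to \<open>t_hi\<close>.
\<close>

record 'u fda_model =
  nu :: "'u measure"
  t_lo :: real
  t_hi :: real
  mean_fn :: "'u \<Rightarrow> real \<Rightarrow> real"
  field_law :: "('u \<Rightarrow> real \<Rightarrow> real) measure"
  noise_law :: "('u \<Rightarrow> real) measure"
  time_dens :: "real \<Rightarrow> real"
  noise_scale :: "real \<Rightarrow> real"
  basis_fn :: "nat \<Rightarrow> real \<Rightarrow> real"

definition tdom :: "'u fda_model \<Rightarrow> real set" where
  "tdom P = {t_lo P..t_hi P}"

definition lebT :: "'u fda_model \<Rightarrow> real measure" where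
  "lebT P = restrict_space lborel (tdom P)"

definition UT :: "'u fda_model \<Rightarrow> ('u \<times> real) measure" where
  "UT P = nu P \<Otimes>\<^sub>M lebT P"

definition mean_normsq :: "'u fda_model \<Rightarrow> real" where
  "mean_normsq P = normsq (UT P) (\<lambda>(u, t). mean_fn P u t)"

definition mean_coef :: "'u fda_model \<Rightarrow> nat \<Rightarrow> 'u \<Rightarrow> real" where
  "mean_coef P k u = (\<integral>t. mean_fn P u t * basis_fn P k t \<partial>lebT P)"

definition Gamma_X :: "'u fda_model \<Rightarrow> real \<Rightarrow> real \<Rightarrow> real" where
  "Gamma_X P t t' = (\<integral>x. (\<integral>u. x u t * x u t' \<partial>nu P) \<partial>field_law P)"

definition C1 :: "'u fda_model \<Rightarrow> real" where
  "C1 P = ((SUP t\<in>tdom P. normsq (nu P) (\<lambda>u. mean_fn P u t))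
         + (SUP z\<in>tdom P \<times> tdom P. \<bar>Gamma_X P (fst z) (snd z)\<bar>)
         + (SUP t\<in>tdom P. \<bar>noise_scale P t\<bar>)\<^sup>2 * measure (nu P) (space (nu P)))
         / (INF t\<in>tdom P. time_dens P t)"

definition C2 :: "'u fda_model \<Rightarrow> real" where
  "C2 P = (\<integral>x. normsq (UT P) (\<lambda>(u, t). x u t) \<partial>field_law P)"

text \<open>
  Finiteness of the supremum of \<open>\<parallel>\<mu>(\<cdot>,t)\<parallel>\<close> makes \<open>C1\<close> a real number.
\<close>

definition mean_ok :: "('u::{metric_space,second_countable_topology}) fda_model \<Rightarrow> bool" where
  "mean_ok P \<longleftrightarrow>
     L2 (UT P) (\<lambda>(u, t). mean_fn P u t) \<and>
     (\<forall>t\<in>tdom P. L2 (nu P) (\<lambda>u. mean_fn P u t)) \<and>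
     bdd_above ((\<lambda>t. normsq (nu P) (\<lambda>u. mean_fn P u t)) ` tdom P)"

definition field_ok :: "('u::{metric_space,second_countable_topology}) fda_model \<Rightarrow> bool" where
  "field_ok P \<longleftrightarrow>
     prob_space (field_law P) \<and>
     (\<lambda>(x, u, t). x u t) \<in> borel_measurable (field_law P \<Otimes>\<^sub>M UT P) \<and>
     integrable (field_law P \<Otimes>\<^sub>M UT P) (\<lambda>(x, u, t). (x u t)\<^sup>2) \<and>
     (\<forall>u. \<forall>t\<in>tdom P. integrable (field_law P) (\<lambda>x. x u t) \<and> (\<integral>x. x u t \<partial>field_law P) = 0)"

definition time_ok :: "'u fda_model \<Rightarrow> bool" where
  "time_ok P \<longleftrightarrow>
     (\<exists>L. L-lipschitz_on (tdom P) (time_dens P)) \<and>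
     (\<forall>t\<in>tdom P. 0 < time_dens P t) \<and>
     (\<integral>\<^sup>+t. ennreal (time_dens P t) \<partial>lebT P) = 1"

definition noise_ok :: "('u::{metric_space,second_countable_topology}) fda_model \<Rightarrow> bool" where
  "noise_ok P \<longleftrightarrow>
     noise_scale P \<in> borel_measurable (lebT P) \<and>
     (\<forall>t\<in>tdom P. 0 \<le> noise_scale P t) \<and> bdd_above (noise_scale P ` tdom P) \<and>
     prob_space (noise_law P) \<and>
     (\<lambda>(e, u). e u) \<in> borel_measurable (noise_law P \<Otimes>\<^sub>M nu P) \<and>
     (\<forall>u. integrable (noise_law P) (\<lambda>e. e u) \<and> (\<integral>e. e u \<partial>noise_law P) = 0 \<and>
          integrable (noise_law P) (\<lambda>e. (e u)\<^sup>2) \<and>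
          prob_space.variance (noise_law P) (\<lambda>e. e u) = 1)"

definition model_ok :: "('u::{metric_space,second_countable_topology}) fda_model \<Rightarrow> bool" where
  "model_ok P \<longleftrightarrow>
     sets (nu P) = sets borel \<and> finite_measure (nu P) \<and> t_lo P < t_hi P \<and>
     orthonormal_basis (lebT P) (basis_fn P) \<and>
     mean_ok P \<and> field_ok P \<and> time_ok P \<and> noise_ok P"

definition basis_lipschitz :: "'u fda_model \<Rightarrow> bool" where
  "basis_lipschitz P \<longleftrightarrow> (\<forall>k\<ge>1. \<exists>L. L-lipschitz_on (tdom P) (basis_fn P k))"

definition mean_smooth :: "'u fda_model \<Rightarrow> real \<Rightarrow> real \<Rightarrow> bool" where
  "mean_smooth P s Cs \<longleftrightarrow>
     (\<lambda>k. real k powr (2 * s) * normsq (nu P) (mean_coef P k)) summable_on {1..} \<and>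
     (\<Sum>\<^sub>\<infinity>k\<in>{1..}. real k powr (2 * s) * normsq (nu P) (mean_coef P k)) \<le> Cs"

text \<open>
  The first conjunct says that \<open>X(\<cdot>,t)\<close> has a finite second moment in \<open>L\<^sup>2(\<U>)\<close> for every \<open>t\<close>,
  so that \<open>Gamma_X\<close> is defined by convergent integrals on all of \<open>\<T> \<times> \<T>\<close>.
\<close>

definition Gamma_continuous :: "'u fda_model \<Rightarrow> bool" where
  "Gamma_continuous P \<longleftrightarrow>
     (\<forall>t\<in>tdom P. integrable (field_law P \<Otimes>\<^sub>M nu P) (\<lambda>(x, u). (x u t)\<^sup>2)) \<and>
     continuous_on (tdom P \<times> tdom P) (\<lambda>(t, t'). Gamma_X P t t')"

text \<open>A design is a pair \<open>(n, m)\<close>; only \<open>m 1, \<dots>, m n\<close> matter.\<close>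

definition design :: "nat \<Rightarrow> (nat \<Rightarrow> nat) \<Rightarrow> bool" where
  "design n m \<longleftrightarrow> 1 \<le> n \<and> (\<forall>i\<in>{1..n}. 1 \<le> m i)"

definition bounded_designs :: "nat \<Rightarrow> (nat \<times> (nat \<Rightarrow> nat)) set" where
  "bounded_designs m_max = {(n, m). design n m \<and> (\<forall>i\<in>{1..n}. m i \<le> m_max)}"

definition total_visits :: "nat \<Rightarrow> (nat \<Rightarrow> nat) \<Rightarrow> nat" where
  "total_visits n m = (\<Sum>i=1..n. m i)"

definition arith_mean :: "nat \<Rightarrow> (nat \<Rightarrow> nat) \<Rightarrow> real" where
  "arith_mean n m = (\<Sum>i=1..n. real (m i)) / real n"

definition harm_mean :: "nat \<Rightarrow> (nat \<Rightarrow> nat) \<Rightarrow> real" where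
  "harm_mean n m = inverse ((\<Sum>i=1..n. inverse (real (m i))) / real n)"

definition w_obs :: "nat \<Rightarrow> (nat \<Rightarrow> nat) \<Rightarrow> nat \<Rightarrow> nat \<Rightarrow> real" where
  "w_obs n m i j = 1 / real (total_visits n m)"

definition w_subj :: "nat \<Rightarrow> (nat \<Rightarrow> nat) \<Rightarrow> nat \<Rightarrow> nat \<Rightarrow> real" where
  "w_subj n m i j = 1 / (real n * real (m i))"

record ('w, 'u) fda_sample =
  prob_sp :: "'w measure"
  obs_time :: "nat \<Rightarrow> nat \<Rightarrow> 'w \<Rightarrow> real"
  subj_field :: "nat \<Rightarrow> 'w \<Rightarrow> 'u \<Rightarrow> real \<Rightarrow> real"
  obs_noise :: "nat \<Rightarrow> nat \<Rightarrow> 'w \<Rightarrow> 'u \<Rightarrow> real"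

definition visits :: "nat \<Rightarrow> (nat \<Rightarrow> nat) \<Rightarrow> (nat \<times> nat) set" where
  "visits n m = (SIGMA i:{1..n}. {1..m i})"

definition events_of :: "'w measure \<Rightarrow> 'b measure \<Rightarrow> 'i set \<Rightarrow> ('i \<Rightarrow> 'w \<Rightarrow> 'b) \<Rightarrow> 'w set set" where
  "events_of \<Omega> N I Z =
     sigma_sets (space \<Omega>) (\<Union>i\<in>I. {Z i -` A \<inter> space \<Omega> | A. A \<in> sets N})"

definition sample_ok ::
    "'u fda_model \<Rightarrow> nat \<Rightarrow> (nat \<Rightarrow> nat) \<Rightarrow> ('w, 'u) fda_sample \<Rightarrow> bool" where
  "sample_ok P n m S \<longleftrightarrow>
     prob_space (prob_sp S) \<and>
     (\<forall>i\<in>{1..n}. distr (prob_sp S) (field_law P) (subj_field S i) = field_law P) \<and>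
     prob_space.indep_vars (prob_sp S) (\<lambda>_. field_law P) (subj_field S) {1..n} \<and>
     (\<forall>(i, j)\<in>visits n m.
        distributed (prob_sp S) (lebT P) (obs_time S i j) (\<lambda>t. ennreal (time_dens P t))) \<and>
     prob_space.indep_vars (prob_sp S) (\<lambda>_. lebT P) (\<lambda>(i, j). obs_time S i j) (visits n m) \<and>
     (\<forall>(i, j)\<in>visits n m. distr (prob_sp S) (noise_law P) (obs_noise S i j) = noise_law P) \<and>
     prob_space.indep_vars (prob_sp S) (\<lambda>_. noise_law P) (\<lambda>(i, j). obs_noise S i j) (visits n m) \<and>
     prob_space.indep_sets (prob_sp S)
       (\<lambda>c::nat. if c = 0 then events_of (prob_sp S) (lebT P) (visits n m) (\<lambda>(i, j). obs_time S i j)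
            else if c = 1 then events_of (prob_sp S) (field_law P) {1..n} (subj_field S)
            else events_of (prob_sp S) (noise_law P) (visits n m) (\<lambda>(i, j). obs_noise S i j))
       {0, 1, 2}"

definition obs_Y ::
    "'u fda_model \<Rightarrow> ('w, 'u) fda_sample \<Rightarrow> nat \<Rightarrow> nat \<Rightarrow> 'w \<Rightarrow> 'u \<Rightarrow> real" where
  "obs_Y P S i j \<omega> u =
     mean_fn P u (obs_time S i j \<omega>) + subj_field S i \<omega> u (obs_time S i j \<omega>)
     + noise_scale P (obs_time S i j \<omega>) * obs_noise S i j \<omega> u"

definition coef_hat ::
    "'u fda_model \<Rightarrow> nat \<Rightarrow> (nat \<Rightarrow> nat) \<Rightarrow> ('w, 'u) fda_sample \<Rightarrow> (nat \<Rightarrow> nat \<Rightarrow> real)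
     \<Rightarrow> nat \<Rightarrow> 'w \<Rightarrow> 'u \<Rightarrow> real" where
  "coef_hat P n m S w k \<omega> u =
     (\<Sum>i=1..n. \<Sum>j=1..m i.
        w i j * obs_Y P S i j \<omega> u * basis_fn P k (obs_time S i j \<omega>)
          / time_dens P (obs_time S i j \<omega>))"

text \<open>
  The truncation level is a real number, the sum running over the integers \<open>1 \<le> k \<le> K\<close>.  This
  agrees with the usual estimator for integer \<open>K\<close> and gives a meaning to the risk at the unrounded
  optimal levels.
\<close>

definition mu_hat ::
    "'u fda_model \<Rightarrow> nat \<Rightarrow> (nat \<Rightarrow> nat) \<Rightarrow> ('w, 'u) fda_sample \<Rightarrow> (nat \<Rightarrow> nat \<Rightarrow> real)
     \<Rightarrow> real \<Rightarrow> 'w \<Rightarrow> 'u \<Rightarrow> real \<Rightarrow> real" where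
  "mu_hat P n m S w K \<omega> u t =
     (\<Sum>k | 1 \<le> k \<and> real k \<le> K. coef_hat P n m S w k \<omega> u * basis_fn P k t)"

text \<open>Extended-real valued, so that an upper bound on the risk includes its finiteness.\<close>

definition risk ::
    "'u fda_model \<Rightarrow> nat \<Rightarrow> (nat \<Rightarrow> nat) \<Rightarrow> ('w, 'u) fda_sample \<Rightarrow> (nat \<Rightarrow> nat \<Rightarrow> real)
     \<Rightarrow> real \<Rightarrow> ereal" where
  "risk P n m S w K =
     enn2ereal (\<integral>\<^sup>+\<omega>. (\<integral>\<^sup>+z. ennreal ((mu_hat P n m S w K \<omega> (fst z) (snd z)
                                - mean_fn P (fst z) (snd z))\<^sup>2) \<partial>UT P) \<partial>prob_sp S)"

definition upper_bound ::
    "'u fda_model \<Rightarrow> real \<Rightarrow> real \<Rightarrow> nat \<Rightarrow> (nat \<Rightarrow> nat) \<Rightarrow> (nat \<Rightarrow> nat \<Rightarrow> real) \<Rightarrow> real \<Rightarrow> real" where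
  "upper_bound P s Cs n m w K =
     (\<Sum>i=1..n. \<Sum>j=1..m i. (w i j)\<^sup>2) * (C1 P * K - mean_normsq P + Cs * K powr (- 2 * s))
     + max (\<Sum>i=1..n. \<Sum>j=1..m i. \<Sum>j'\<in>{1..m i} - {j}. w i j * w i j') 0 * C2 P
     + Cs * K powr (- 2 * s)"

text \<open>In the following, \<open>N\<close> stands for \<open>n\<close> times a mean of the visit counts.\<close>

definition K_star :: "'u fda_model \<Rightarrow> real \<Rightarrow> real \<Rightarrow> real \<Rightarrow> real" where
  "K_star P s Cs N = (2 * s * Cs * (N + 1) / C1 P) powr (1 / (2 * s + 1))"

definition C_factor :: "real \<Rightarrow> real \<Rightarrow> real" where
  "C_factor s N = (1 + 1 / N) powr (1 / (2 * s + 1))"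

definition optimal_rhs ::
    "'u fda_model \<Rightarrow> real \<Rightarrow> real \<Rightarrow> nat \<Rightarrow> nat \<Rightarrow> (nat \<Rightarrow> nat) \<Rightarrow> real \<Rightarrow> real" where
  "optimal_rhs P s Cs m_max n m N =
     C_factor s N
       * ((2 * s + 1) / (2 * s) * (2 * s * Cs * C1 P powr (2 * s)) powr (1 / (2 * s + 1)))
       * N powr (- (2 * s) / (2 * s + 1))
     + C2 P * real m_max / real (total_visits n m)
     - mean_normsq P / N"

definition rate :: "real \<Rightarrow> real \<Rightarrow> real" where
  "rate s x = x powr (- (2 * s) / (2 * s + 1))"

definition lesssim_on :: "'a set \<Rightarrow> ('a \<Rightarrow> real) \<Rightarrow> ('a \<Rightarrow> real) \<Rightarrow> bool" where
  "lesssim_on A f g \<longleftrightarrow> (\<exists>C>0. \<forall>x\<in>A. f x \<le> C * g x)"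

definition asymp_equal_on :: "'a set \<Rightarrow> ('a \<Rightarrow> real) \<Rightarrow> ('a \<Rightarrow> real) \<Rightarrow> bool" where
  "asymp_equal_on A f g \<longleftrightarrow> lesssim_on A f g \<and> lesssim_on A g f"

end

theory Submission
  imports Defs
begin

text \<open>
  Fix a point \<open>u\<close>.  The estimated coefficient at \<open>u\<close> is a weighted sum of the terms
  \<open>Y u * \<phi> k T / g T\<close>, each of which is unbiased for \<open>mean_coef P k u\<close>.  Terms of different subjects are
  independent; terms of one subject share only the field \<open>X\<close>, so their covariance is the variance of the \<open>k\<close>-th
  Fourier coefficient of \<open>X u\<close>, and by Bessel's inequality these variances add up over \<open>k\<close> to at most
  the energy of \<open>X u\<close>, whose integral over \<open>u\<close> is \<open>C2\<close>.  The second moment of a single term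
  integrates to at most \<open>C1\<close>, and Parseval's identity turns the squared means that are subtracted into
  \<open>mean_normsq\<close> minus the truncation bias.  The bias involves only \<open>k > K\<close>, so it is at most
  \<open>Cs * K powr (- 2 * s)\<close> for every real \<open>K > 0\<close>, and no rounding of \<open>K\<close> is needed.

  The upper bound has the form \<open>a * K + b * K powr (- 2 * s)\<close> plus a constant, so its critical point is its
  only minimizer.  A ceiling or a nearest integer has the same estimator as some real level in
  \<open>[K*, K* + 1]\<close>, which costs at most \<open>C1 / N\<close> more.
\<close>

section \<open>The deterministic trade-off\<close>

text \<open>The main obstacle is measure-theoretic. The value of a path at a random time is
  accessible only through joint measurability, so moments are not computed on the sample space. The
  hypotheses are first turned into product laws of tuples made of fields, times and noises; each
  moment then is an iterated integral against a product measure. The sample provides independence in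
  two layers, between three groups of variables and inside each group; merging them into one
  independent family of generating events gives every product law by a choice of disjoint index
  sets.

  Identities at a fixed \<open>u\<close> need square integrability, of which the model mostly gives
  only a version integrated over \<open>\<U>\<close>. They are therefore proved for almost every
  \<open>u\<close>, and integrals are swapped while they are still extended nonnegative, before any
  integrability is known.

  For general weights the cross weights may have either sign. The coefficient variances lie between
  0 and a bound on their sum over \<open>k\<close>, and this is why the positive part
  appears.\<close>

lemma power_law_tradeoff_strict_min:
  fixes a b s x y :: real
  assumes s: "0 < s" and b: "0 < b" and x: "0 < x" and y: "0 < y" "y \<noteq> x"
    and crit: "a * x = 2 * s * b * x powr (- 2 * s)"
  shows "a * x + b * x powr (- 2 * s) < a * y + b * y powr (- 2 * s)"
proof -
  \<comment> \<open>With \<open>y = r * x\<close> and the critical equation the claim becomes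
    \<open>2 * s + 1 < 2 * s * r + r powr (- 2 * s)\<close>. It follows from
    \<open>exp z \<ge> 1 + z\<close> at \<open>z = - 2 * s * ln r\<close> and from
    \<open>ln r < r - 1\<close>, which is strict because \<open>r \<noteq> 1\<close>.\<close>
  define r where "r = y / x"
  have r: "0 < r" "r \<noteq> 1" and y_eq: "y = r * x" using x y by (auto simp: r_def)
  define c where "c = b * x powr (- 2 * s)"
  have c: "0 < c" using b x by (simp add: c_def)
  have "ln r < r - 1" using ln_le_minus_one[of r] ln_eq_minus_one[of r] r by linarith
  then have "2 * s * ln r < 2 * s * (r - 1)" using s by (intro mult_strict_left_mono) auto
  moreover have "1 + (- 2 * s) * ln r \<le> exp ((- 2 * s) * ln r)" by (rule exp_ge_add_one_self)
  moreover have "exp ((- 2 * s) * ln r) = r powr (- 2 * s)" using r by (simp add: powr_def)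
  ultimately have "2 * s + 1 < 2 * s * r + r powr (- 2 * s)" by (simp add: algebra_simps)
  then have "c * (2 * s + 1) < c * (2 * s * r + r powr (- 2 * s))" using c by simp
  moreover have "a * x = 2 * s * c" using crit by (simp add: c_def)
  moreover have "y powr (- 2 * s) = r powr (- 2 * s) * x powr (- 2 * s)"
    unfolding y_eq using r x by (simp add: powr_mult)
  ultimately have "a * x + c < a * x * r + c * r powr (- 2 * s)"
    by (simp add: algebra_simps)
  then show ?thesis
    unfolding \<open>y powr _ = _\<close> by (simp add: y_eq c_def mult.assoc mult.left_commute mult.commute)
qed

lemma K_star_pos: "0 < s \<Longrightarrow> 0 < Cs \<Longrightarrow> 0 < C1 P \<Longrightarrow> 0 < N \<Longrightarrow> 0 < K_star P s Cs N"
  by (simp add: K_star_def)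

text \<open>This is the vanishing derivative of \<open>a * K + b * K powr (- 2 * s)\<close>,
  multiplied by \<open>K\<close>, for \<open>a = C1 P / N\<close> and
  \<open>b = Cs * (1 / N + 1)\<close>. Since \<open>b / a\<close> equals
  \<open>Cs * (N + 1) / C1 P\<close>, the \<open>N + 1\<close> in \<open>K_star\<close> records that
  the bias enters the bound twice, once with weight 1 and once with weight
  \<open>1 / N\<close>.\<close>

lemma K_star_critical:
  assumes s: "0 < s" and Cs: "0 < Cs" and C1: "0 < C1 P" and N: "0 < N"
  shows "C1 P / N * K_star P s Cs N
    = 2 * s * (Cs * (1 / N + 1)) * K_star P s Cs N powr (- 2 * s)"
proof -
  let ?K = "K_star P s Cs N"
  have "?K powr (2 * s + 1) = 2 * s * Cs * (N + 1) / C1 P"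
    using assms unfolding K_star_def powr_powr by simp
  moreover have "?K powr (2 * s + 1) = ?K powr (2 * s) * ?K"
    using K_star_pos[OF assms] by (simp add: powr_add)
  moreover have "?K powr (- 2 * s) = inverse (?K powr (2 * s))" by (simp add: powr_minus)
  moreover have "0 < ?K powr (2 * s)" using K_star_pos[OF assms] by simp
  moreover have "C1 P / N * k = 2 * s * (Cs * (1 / N + 1)) * inverse q"
    if "q * k = 2 * s * Cs * (N + 1) / C1 P" "0 < q" for q k :: real
  proof -
    have k: "k = 2 * s * Cs * (N + 1) / C1 P / q"
    proof (rule eq_divide_imp)
      show "k * q = 2 * s * Cs * (N + 1) / C1 P" by (subst mult.commute) (rule that(1))
      show "q \<noteq> 0" using that(2) by simp
    qed
    have "C1 P / N * (2 * s * Cs * (N + 1) / C1 P / q) = 2 * s * Cs * ((N + 1) / N) * inverse q"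
      using C1 by (simp add: divide_inverse)
    moreover have "(N + 1) / N = 1 / N + 1" using N by (simp add: add_divide_distrib)
    ultimately show ?thesis unfolding k by (simp only: mult.assoc)
  qed
  ultimately show ?thesis by metis
qed

text \<open>At the critical point the power term is the linear term divided by \<open>2 * s\<close>,
  so only \<open>C1 P / N * K\<close> has to be evaluated. Writing \<open>N + 1\<close> as
  \<open>N * (1 + 1 / N)\<close> splits off \<open>C_factor\<close> and leaves a pure power of
  \<open>N\<close>.\<close>

lemma K_star_value:
  assumes s: "0 < s" and Cs: "0 < Cs" and C1: "0 < C1 P" and N: "0 < N"
  shows "C1 P / N * K_star P s Cs N + Cs * (1 / N + 1) * K_star P s Cs N powr (- 2 * s)
    = C_factor s N * ((2 * s + 1) / (2 * s) * (2 * s * Cs * C1 P powr (2 * s)) powr (1 / (2 * s + 1)))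
       * N powr (- (2 * s) / (2 * s + 1))"
proof -
  let ?K = "K_star P s Cs N" and ?p = "1 / (2 * s + 1)"
  have p: "(2 * s) * ?p = 1 - ?p" "- (2 * s) / (2 * s + 1) = ?p - 1"
    using s by (simp_all add: field_simps)
  have sum: "C1 P / N * ?K + Cs * (1 / N + 1) * ?K powr (- 2 * s) = (2 * s + 1) / (2 * s) * (C1 P / N * ?K)"
  proof -
    have "x + y = (2 * s + 1) / (2 * s) * x" if "x = 2 * s * y" for x y :: real
      unfolding that using s by (simp add: field_simps)
    from this[of "C1 P / N * ?K" "Cs * (1 / N + 1) * ?K powr (- 2 * s)"]
    show ?thesis using K_star_critical[OF assms] by (simp only: mult.assoc)
  qed
  have K: "C1 P / N * ?K
      = C_factor s N * (2 * s * Cs * C1 P powr (2 * s)) powr ?p * N powr (?p - 1)"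
  proof -
    have E1: "?K = (2 * s * Cs) powr ?p * N powr ?p * (1 + 1 / N) powr ?p / C1 P powr ?p"
    proof -
      have "2 * s * Cs * (N + 1) / C1 P = 2 * s * Cs * N * (1 + 1 / N) / C1 P"
      proof -
        have "N + 1 = N * (1 + 1 / N)" using N by (simp add: distrib_left)
        then show ?thesis by (simp only: mult.assoc)
      qed
      then show ?thesis using assms unfolding K_star_def
        by (simp only: powr_divide powr_mult)
    qed
    have E2: "(2 * s * Cs * C1 P powr (2 * s)) powr ?p = (2 * s * Cs) powr ?p * (C1 P / C1 P powr ?p)"
    proof -
      have "(2 * s * Cs * C1 P powr (2 * s)) powr ?p = (2 * s * Cs) powr ?p * C1 P powr (1 - ?p)"
        using assms p(1) by (simp add: powr_mult powr_powr)
      then show ?thesis using C1 by (simp add: powr_diff)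
    qed
    have E3: "N powr (?p - 1) = N powr ?p / N" using N by (simp add: powr_diff)
    show ?thesis unfolding C_factor_def E2 E3 by (subst E1) (simp only: divide_inverse ac_simps)
  qed
  show ?thesis unfolding sum unfolding K p(2) by (simp only: ac_simps)
qed

section \<open>Weight sums, means of the visit counts and the minimized bound\<close>

definition sq_weights :: "nat \<Rightarrow> (nat \<Rightarrow> nat) \<Rightarrow> (nat \<Rightarrow> nat \<Rightarrow> real) \<Rightarrow> real" where
  "sq_weights n m w = (\<Sum>i=1..n. \<Sum>j=1..m i. (w i j)\<^sup>2)"

definition cross_weights :: "nat \<Rightarrow> (nat \<Rightarrow> nat) \<Rightarrow> (nat \<Rightarrow> nat \<Rightarrow> real) \<Rightarrow> real" where
  "cross_weights n m w = (\<Sum>i=1..n. \<Sum>j=1..m i. \<Sum>j'\<in>{1..m i} - {j}. w i j * w i j')"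

lemma upper_bound_eq:
  "upper_bound P s Cs n m w K = sq_weights n m w * (C1 P * K - mean_normsq P + Cs * K powr (- 2 * s))
     + max (cross_weights n m w) 0 * C2 P + Cs * K powr (- 2 * s)"
  by (simp add: upper_bound_def sq_weights_def cross_weights_def)

lemma upper_bound_eq':
  assumes "sq_weights n m w = 1 / N"
  shows "upper_bound P s Cs n m w K = C1 P / N * K + Cs * (1 / N + 1) * K powr (- 2 * s)
    + (max (cross_weights n m w) 0 * C2 P - mean_normsq P / N)"
  unfolding upper_bound_eq assms by (simp add: algebra_simps)

text \<open>A singleton set of minimizers states existence and uniqueness at once. Keeping
  \<open>N\<close> abstract serves both schemes: the squared OBS and SUBJ weights sum to
  \<open>1 / N\<close>, where \<open>N\<close> is \<open>n\<close> times the arithmetic or the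
  harmonic mean.\<close>

lemma is_arg_min_upper_bound:
  assumes s: "0 < s" and Cs: "0 < Cs" and C1: "0 < C1 P" and N: "0 < N"
    and sq: "sq_weights n m w = 1 / N"
  shows "{K. is_arg_min (upper_bound P s Cs n m w) (\<lambda>K. 0 < K) K} = {K_star P s Cs N}"
proof -
  let ?K = "K_star P s Cs N" and ?f = "upper_bound P s Cs n m w"
  have K: "0 < ?K" by (rule K_star_pos[OF assms(1-4)])
  have less: "?f ?K < ?f y" if "0 < y" "y \<noteq> ?K" for y
    using power_law_tradeoff_strict_min[OF s _ K that, of "Cs * (1 / N + 1)" "C1 P / N"]
      K_star_critical[OF assms(1-4)] Cs N
    unfolding upper_bound_eq'[OF sq] by (simp add: add_pos_pos)
  show ?thesis using K less unfolding is_arg_min_def by (auto dest: order.asym)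
qed

lemma total_visits_arith: "design n m \<Longrightarrow> real n * arith_mean n m = real (total_visits n m)"
  by (simp add: arith_mean_def design_def total_visits_def)

lemma n_le_total_visits: "design n m \<Longrightarrow> n \<le> total_visits n m"
  unfolding design_def total_visits_def using sum_mono[of "{1..n}" "\<lambda>_. 1" m] by simp

lemma total_visits_le: "(n, m) \<in> bounded_designs m_max \<Longrightarrow> total_visits n m \<le> n * m_max"
  unfolding bounded_designs_def total_visits_def using sum_mono[of "{1..n}" m "\<lambda>_. m_max"] by simp

text \<open>The inverse visit counts lie between \<open>1 / m_max\<close> and 1, hence so does their
  average. The third identity is needed because the squared SUBJ weights of subject \<open>i\<close>
  sum to \<open>1 / (n^2 * m i)\<close>.\<close>

lemma harm_bounds:
  assumes "design n m"
  shows "real n \<le> real n * harm_mean n m"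
    and "(n, m) \<in> bounded_designs m_max \<Longrightarrow> real n * harm_mean n m \<le> real n * real m_max"
    and "(\<Sum>i=1..n. inverse (real (m i))) / real n ^ 2 = 1 / (real n * harm_mean n m)"
proof -
  let ?S = "\<Sum>i=1..n. inverse (real (m i))"
  have n: "0 < real n" and m: "\<And>i. i \<in> {1..n} \<Longrightarrow> 1 \<le> real (m i)"
    using assms by (auto simp: design_def)
  have h: "harm_mean n m = real n / ?S" using n by (simp add: harm_mean_def field_simps)
  have "?S \<le> (\<Sum>i=1..n. 1)" by (rule sum_mono) (use m in \<open>simp add: inverse_le_1_iff\<close>)
  then have S1: "?S \<le> real n" by simp
  have S0: "0 < ?S" by (rule sum_pos) (use m n in \<open>auto, force\<close>)
  have "1 \<le> harm_mean n m" unfolding h using S0 S1 by (simp add: field_simps)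
  then show "real n \<le> real n * harm_mean n m" using n by simp
  show "?S / real n ^ 2 = 1 / (real n * harm_mean n m)"
    unfolding h using n S0 by (simp add: power2_eq_square)
  assume "(n, m) \<in> bounded_designs m_max"
  then have mm: "\<And>i. i \<in> {1..n} \<Longrightarrow> real (m i) \<le> real m_max" by (auto simp: bounded_designs_def)
  have "1 \<in> {1..n}" using n by simp
  then have M: "0 < real m_max" using m[of 1] mm[of 1] by linarith
  have "(\<Sum>i=1..n. inverse (real m_max)) \<le> ?S"
    by (rule sum_mono) (use m mm M in \<open>force intro!: le_imp_inverse_le\<close>)
  then have "real n / real m_max \<le> ?S" by (simp add: field_simps)
  then have "harm_mean n m \<le> real m_max" unfolding h using S0 M by (simp add: field_simps)
  then show "real n * harm_mean n m \<le> real n * real m_max" using n by simp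
qed

lemma weights_obs:
  assumes "design n m"
  shows "(\<Sum>i=1..n. \<Sum>j=1..m i. w_obs n m i j) = 1"
    and "sq_weights n m (w_obs n m) = 1 / (real n * arith_mean n m)"
proof -
  have M: "0 < real (total_visits n m)"
    using n_le_total_visits[OF assms] assms by (simp add: design_def)
  have sum: "(\<Sum>i=Suc 0..n. real (m i)) = real (total_visits n m)" by (simp add: total_visits_def)
  show "(\<Sum>i=1..n. \<Sum>j=1..m i. w_obs n m i j) = 1"
    using M by (simp add: w_obs_def sum_divide_distrib[symmetric] sum)
  have "sq_weights n m (w_obs n m) = real (total_visits n m) / (real (total_visits n m))\<^sup>2"
    unfolding sq_weights_def w_obs_def
    by (simp add: power_divide sum_divide_distrib[symmetric] sum)
  then show "sq_weights n m (w_obs n m) = 1 / (real n * arith_mean n m)"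
    unfolding total_visits_arith[OF assms] using M by (simp add: power2_eq_square)
qed

lemma weights_subj:
  assumes "design n m"
  shows "(\<Sum>i=1..n. \<Sum>j=1..m i. w_subj n m i j) = 1"
    and "sq_weights n m (w_subj n m) = 1 / (real n * harm_mean n m)"
proof -
  have n: "0 < real n" and m: "\<And>i. i \<in> {1..n} \<Longrightarrow> 0 < real (m i)"
    using assms by (auto simp: design_def Suc_le_eq)
  have "(\<Sum>i=1..n. \<Sum>j=1..m i. w_subj n m i j) = (\<Sum>i=1..n. 1 / real n)"
    by (rule sum.cong[OF refl]) (use m in \<open>force simp: w_subj_def\<close>)
  then show "(\<Sum>i=1..n. \<Sum>j=1..m i. w_subj n m i j) = 1" using n by simp
  have "sq_weights n m (w_subj n m) = (\<Sum>i=1..n. inverse (real (m i)) / real n ^ 2)"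
    unfolding sq_weights_def
    by (rule sum.cong[OF refl]) (use m in \<open>force simp: w_subj_def power2_eq_square field_simps\<close>)
  then show "sq_weights n m (w_subj n m) = 1 / (real n * harm_mean n m)"
    using harm_bounds(3)[OF assms] by (simp add: sum_divide_distrib)
qed

text \<open>Each of the \<open>M\<close> visits, \<open>M\<close> being the total, has fewer than
  \<open>m_max\<close> partners, and every product of weights is \<open>1 / M^2\<close>.\<close>

lemma cross_weights_obs_le:
  assumes d: "(n, m) \<in> bounded_designs m_max"
  shows "max (cross_weights n m (w_obs n m)) 0 \<le> real m_max / real (total_visits n m)"
proof -
  let ?M = "real (total_visits n m)"
  have dn: "design n m" and mm: "\<And>i. i \<in> {1..n} \<Longrightarrow> real (m i) \<le> real m_max"
    using d by (auto simp: bounded_designs_def)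
  have M: "0 < ?M" using n_le_total_visits[OF dn] dn by (simp add: design_def)
  have "cross_weights n m (w_obs n m) \<le> (\<Sum>i=1..n. real (m i) * (real m_max / ?M\<^sup>2))"
    unfolding cross_weights_def
  proof (rule sum_mono)
    fix i assume i: "i \<in> {1..n}"
    have "(\<Sum>j=1..m i. \<Sum>j'\<in>{1..m i} - {j}. w_obs n m i j * w_obs n m i j') \<le> (\<Sum>j=1..m i. real m_max / ?M\<^sup>2)"
    proof (rule sum_mono)
      fix j assume "j \<in> {1..m i}"
      have "(\<Sum>j'\<in>{1..m i} - {j}. w_obs n m i j * w_obs n m i j') = real (card ({1..m i} - {j})) / ?M\<^sup>2"
        by (simp add: w_obs_def power2_eq_square)
      also have "\<dots> \<le> real m_max / ?M\<^sup>2"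
        using mm[OF i] card_mono[of "{1..m i}" "{1..m i} - {j}"] by (intro divide_right_mono) auto
      finally show "(\<Sum>j'\<in>{1..m i} - {j}. w_obs n m i j * w_obs n m i j') \<le> real m_max / ?M\<^sup>2" .
    qed
    then show "(\<Sum>j=1..m i. \<Sum>j'\<in>{1..m i} - {j}. w_obs n m i j * w_obs n m i j') \<le> real (m i) * (real m_max / ?M\<^sup>2)"
      by simp
  qed
  also have "\<dots> = ?M * (real m_max / ?M\<^sup>2)"
    by (simp only: sum_distrib_right[symmetric] total_visits_def of_nat_sum)
  also have "\<dots> = real m_max / ?M" using M by (simp add: power2_eq_square)
  finally show ?thesis using M by simp
qed

text \<open>A subject contributes at most \<open>m i ^ 2\<close> products, each equal to
  \<open>1 / (n * m i)^2\<close>, so the total is at most \<open>1 / n\<close>. The inequality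
  \<open>M \<le> n * m_max\<close> for the total \<open>M\<close> converts this into the expression
  that also bounds the OBS cross weights.\<close>

lemma cross_weights_subj_le:
  assumes d: "(n, m) \<in> bounded_designs m_max"
  shows "max (cross_weights n m (w_subj n m)) 0 \<le> real m_max / real (total_visits n m)"
proof -
  let ?M = "real (total_visits n m)"
  have dn: "design n m" using d by (auto simp: bounded_designs_def)
  have M: "0 < ?M" using n_le_total_visits[OF dn] dn by (simp add: design_def)
  have n: "0 < real n" and m: "\<And>i. i \<in> {1..n} \<Longrightarrow> 0 < real (m i)"
    using dn by (auto simp: design_def Suc_le_eq)
  have "cross_weights n m (w_subj n m) \<le> (\<Sum>i=1..n. 1 / real n ^ 2)"
    unfolding cross_weights_def
  proof (rule sum_mono)
    fix i assume i: "i \<in> {1..n}"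
    have "(\<Sum>j=1..m i. \<Sum>j'\<in>{1..m i} - {j}. w_subj n m i j * w_subj n m i j')
        \<le> (\<Sum>j=1..m i. 1 / (real n ^ 2 * real (m i)))"
    proof (rule sum_mono)
      fix j assume "j \<in> {1..m i}"
      have "(\<Sum>j'\<in>{1..m i} - {j}. w_subj n m i j * w_subj n m i j')
          = real (card ({1..m i} - {j})) / (real n ^ 2 * real (m i) ^ 2)"
        by (simp add: w_subj_def power2_eq_square field_simps)
      also have "\<dots> \<le> real (m i) / (real n ^ 2 * real (m i) ^ 2)"
        using card_mono[of "{1..m i}" "{1..m i} - {j}"] by (intro divide_right_mono) auto
      also have "\<dots> = 1 / (real n ^ 2 * real (m i))"
        using m[OF i] by (simp add: power2_eq_square)
      finally show "(\<Sum>j'\<in>{1..m i} - {j}. w_subj n m i j * w_subj n m i j') \<le> 1 / (real n ^ 2 * real (m i))" .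
    qed
    then show "(\<Sum>j=1..m i. \<Sum>j'\<in>{1..m i} - {j}. w_subj n m i j * w_subj n m i j') \<le> 1 / real n ^ 2"
      using m[OF i] by simp
  qed
  also have "\<dots> = 1 / real n" using n by (simp add: power2_eq_square)
  also have "\<dots> \<le> real m_max / ?M"
  proof -
    have "?M \<le> real n * real m_max"
      using total_visits_le[OF d] by (metis of_nat_le_iff of_nat_mult)
    then show ?thesis using n M by (simp add: field_simps)
  qed
  finally show ?thesis using M by simp
qed

lemma C2_nonneg: "0 \<le> C2 P"
  by (simp add: C2_def normsq_def)

lemma upper_bound_K_star_le:
  assumes s: "0 < s" and Cs: "0 < Cs" and C1: "0 < C1 P" and N: "0 < N"
    and sq: "sq_weights n m w = 1 / N"
    and cross: "max (cross_weights n m w) 0 \<le> real m_max / real (total_visits n m)"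
  shows "upper_bound P s Cs n m w (K_star P s Cs N) \<le> optimal_rhs P s Cs m_max n m N"
  using mult_right_mono[OF cross C2_nonneg[of P]]
  unfolding upper_bound_eq'[OF sq] K_star_value[OF assms(1-4)] optimal_rhs_def
  by (simp add: mult.commute)

text \<open>To the right of the minimizer the power term decreases, and the linear term has slope
  \<open>C1 P / N\<close>; a move by at most one unit therefore costs at most that slope.\<close>

lemma upper_bound_near_K_star_le:
  assumes s: "0 < s" and Cs: "0 < Cs" and C1: "0 < C1 P" and N: "0 < N"
    and sq: "sq_weights n m w = 1 / N"
    and cross: "max (cross_weights n m w) 0 \<le> real m_max / real (total_visits n m)"
    and K: "K_star P s Cs N \<le> K" "K \<le> K_star P s Cs N + 1"
  shows "upper_bound P s Cs n m w K \<le> optimal_rhs P s Cs m_max n m N + C1 P / N"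
proof -
  let ?K = "K_star P s Cs N"
  have K0: "0 < ?K" by (rule K_star_pos[OF assms(1-4)])
  have "K powr (- 2 * s) \<le> ?K powr (- 2 * s)" using K0 K s by (intro powr_mono2') auto
  then have "Cs * (1 / N + 1) * K powr (- 2 * s) \<le> Cs * (1 / N + 1) * ?K powr (- 2 * s)"
    using Cs N by (intro mult_left_mono) auto
  moreover have "C1 P / N * K \<le> C1 P / N * (?K + 1)" using C1 N K by (intro mult_left_mono) auto
  moreover have "C1 P / N * (?K + 1) = C1 P / N * ?K + C1 P / N" by (simp add: algebra_simps)
  ultimately have "upper_bound P s Cs n m w K \<le> upper_bound P s Cs n m w ?K + C1 P / N"
    unfolding upper_bound_eq'[OF sq] by linarith
  then show ?thesis using upper_bound_K_star_le[OF assms(1-6)] by linarith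
qed

section \<open>The factor tending to 1 and comparison of rates\<close>

lemma C_factor_strict_antimono:
  assumes "0 < s" "0 < N" "N < N'"
  shows "1 < C_factor s N'" "C_factor s N' < C_factor s N"
proof -
  have "1 powr (1 / (2 * s + 1)) < (1 + 1 / N') powr (1 / (2 * s + 1))"
    using assms by (intro powr_less_mono2) auto
  then show "1 < C_factor s N'" by (simp add: C_factor_def)
  show "C_factor s N' < C_factor s N"
    unfolding C_factor_def using assms by (intro powr_less_mono2) (auto simp: frac_less2)
qed

lemma C_factor_tendsto:
  assumes s: "0 < s" and N: "\<And>n. 1 \<le> n \<Longrightarrow> real n \<le> N n"
  shows "(\<lambda>n. C_factor s (N n)) \<longlonglongrightarrow> 1"
proof -
  have "filterlim N at_top sequentially"
    by (rule filterlim_at_top_mono[OF filterlim_real_sequentially])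
       (use N in \<open>auto simp: eventually_sequentially\<close>)
  then have "(\<lambda>n. 1 / N n) \<longlonglongrightarrow> 0"
    by (auto intro: tendsto_divide_0 filterlim_at_top_imp_at_infinity)
  then have "(\<lambda>n. (1 + 1 / N n) powr (1 / (2 * s + 1))) \<longlonglongrightarrow> (1 + 0) powr (1 / (2 * s + 1))"
    by (intro tendsto_intros) auto
  then show ?thesis by (simp add: C_factor_def)
qed

lemma rate_antimono: "0 < s \<Longrightarrow> 0 < x \<Longrightarrow> x \<le> y \<Longrightarrow> rate s y \<le> rate s x"
  unfolding rate_def by (intro powr_mono2') auto

lemma rate_mult: "0 \<le> x \<Longrightarrow> 0 \<le> c \<Longrightarrow> rate s (x * c) = rate s c * rate s x"
  by (simp add: rate_def powr_mult)

lemma inverse_le_rate: "0 < s \<Longrightarrow> 1 \<le> x \<Longrightarrow> 1 / x \<le> rate s x"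
proof -
  assume "0 < s" "1 \<le> x"
  then have "x powr (- 1) \<le> x powr (- (2 * s) / (2 * s + 1))"
    by (intro powr_mono) (auto simp: field_simps)
  then show "1 / x \<le> rate s x" using \<open>1 \<le> x\<close> by (simp add: rate_def powr_minus_divide)
qed

text \<open>Sizes between \<open>n\<close> and \<open>n * m_max\<close> have rates between
  \<open>rate s n\<close> and \<open>rate s m_max * rate s n\<close>, because \<open>rate\<close> is
  multiplicative and decreasing. The hypotheses on \<open>f\<close> and \<open>g\<close> are
  symmetric, so one lemma gives both directions of every equivalence.\<close>

lemma rate_comparison:
  assumes s: "0 < s" and f: "\<And>n m. (n, m) \<in> bounded_designs m_max \<Longrightarrow> real n \<le> f n m \<and> f n m \<le> real n * real m_max"
    and g: "\<And>n m. (n, m) \<in> bounded_designs m_max \<Longrightarrow> real n \<le> g n m \<and> g n m \<le> real n * real m_max"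
  shows "lesssim_on (bounded_designs m_max) (\<lambda>(n, m). rate s (f n m)) (\<lambda>(n, m). rate s (g n m))"
proof (cases "m_max = 0")
  \<comment> \<open>Here \<open>rate s 0\<close> is 0 and its inverse would not be a positive
    constant, but visit counts are at least 1, so there is no design at all.\<close>
  case True
  then have "bounded_designs m_max = {}" by (force simp: bounded_designs_def design_def)
  then show ?thesis by (auto simp: lesssim_on_def intro: exI[of _ 1])
next
  case False
  let ?c = "rate s (real m_max)"
  have c: "0 < ?c" using False by (simp add: rate_def)
  have "rate s (f n m) \<le> inverse ?c * rate s (g n m)" if d: "(n, m) \<in> bounded_designs m_max" for n m
  proof -
    have n: "0 < real n" using d by (auto simp: bounded_designs_def design_def)
    have "?c * rate s (f n m) \<le> ?c * rate s (real n)"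
      using rate_antimono[OF s n] f[OF d] c by simp
    also have "\<dots> = rate s (real n * real m_max)" by (simp add: rate_mult)
    also have "\<dots> \<le> rate s (g n m)" using g[OF d] n by (intro rate_antimono[OF s]) auto
    finally show ?thesis using c by (simp add: field_simps)
  qed
  then show ?thesis unfolding lesssim_on_def using c by (intro exI[of _ "inverse ?c"]) auto
qed

text \<open>Since \<open>N \<ge> 1\<close>, the factor is at most
  \<open>2 powr (1 / (2 * s + 1))\<close>. The remaining positive terms are of order
  \<open>1 / n\<close>, which is below the rate because its exponent is smaller than 1. The extra
  \<open>C1 P / N\<close> on the left is the price of rounding.\<close>

lemma optimal_rhs_le_rate:
  assumes s: "0 < s" and Cs: "0 < Cs" and C1: "0 < C1 P" and mm: "0 \<le> mean_normsq P"
    and n: "1 \<le> n" "n \<le> total_visits n m" "real n \<le> N" 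
  shows "optimal_rhs P s Cs m_max n m N + C1 P / N
    \<le> (2 powr (1 / (2 * s + 1)) * ((2 * s + 1) / (2 * s) * (2 * s * Cs * C1 P powr (2 * s)) powr (1 / (2 * s + 1)))
        + C2 P * real m_max + C1 P) * rate s (real n)"
proof -
  let ?A = "(2 * s + 1) / (2 * s) * (2 * s * Cs * C1 P powr (2 * s)) powr (1 / (2 * s + 1))"
  have N: "1 \<le> N" using n by linarith
  have A: "0 \<le> ?A" using s by simp
  have "C_factor s N \<le> 2 powr (1 / (2 * s + 1))"
    unfolding C_factor_def using N s by (intro powr_mono2) (auto simp: field_simps)
  moreover have rN: "rate s N \<le> rate s (real n)" using n by (intro rate_antimono[OF s]) auto
  ultimately have "C_factor s N * ?A * rate s N \<le> 2 powr (1 / (2 * s + 1)) * ?A * rate s (real n)"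
    using A s by (intro mult_mono mult_nonneg_nonneg) (auto simp: rate_def)
  moreover have rn: "1 / real n \<le> rate s (real n)" using n by (intro inverse_le_rate[OF s]) auto
  have "C2 P * real m_max * (1 / real (total_visits n m)) \<le> C2 P * real m_max * rate s (real n)"
  proof (rule mult_left_mono)
    have "1 / real (total_visits n m) \<le> 1 / real n" using n by (intro divide_left_mono) auto
    then show "1 / real (total_visits n m) \<le> rate s (real n)" using rn by linarith
  qed (use C2_nonneg[of P] in simp)
  moreover have "C1 P * (1 / N) \<le> C1 P * rate s (real n)"
    using inverse_le_rate[OF s N] rN C1 by (intro mult_left_mono) auto
  moreover have "0 \<le> mean_normsq P / N" using mm N by simp
  ultimately show ?thesis unfolding optimal_rhs_def rate_def[symmetric]
    by (simp add: distrib_right)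
qed

section \<open>Independence and mean square errors\<close>

text \<open>Intersection stability places a finite intersection of events of group \<open>c\<close>
  inside \<open>G c\<close>. The probability of a joint intersection thus factors first over the
  groups by \<open>G\<close>, then inside each group by \<open>F c\<close>.\<close>

lemma (in prob_space) indep_sets_Sigma:
  fixes F :: "'c \<Rightarrow> 'i \<Rightarrow> 'a set set"
  assumes G: "indep_sets G C"
    and F: "\<And>c. c \<in> C \<Longrightarrow> indep_sets (F c) (I c)"
    and sub: "\<And>c i. c \<in> C \<Longrightarrow> i \<in> I c \<Longrightarrow> F c i \<subseteq> G c"
    and Int: "\<And>c. c \<in> C \<Longrightarrow> Int_stable (G c)"
  shows "indep_sets (\<lambda>(c, i). F c i) (Sigma C I)"
proof (rule indep_setsI)
  fix z assume "z \<in> Sigma C I"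
  then show "(case z of (c, i) \<Rightarrow> F c i) \<subseteq> events"
    using F by (auto simp: indep_sets_def)
next
  fix A J
  assume ne: "J \<noteq> {}" and J: "J \<subseteq> Sigma C I" and fin: "finite J"
    and A: "\<forall>j\<in>J. A j \<in> (case j of (c, i) \<Rightarrow> F c i)"
  define D where "D = fst ` J"
  define B where "B c = (\<Inter>i\<in>J `` {c}. A (c, i))" for c
  have J_eq: "J = Sigma D (\<lambda>c. J `` {c})" by (force simp: D_def)
  have D: "D \<subseteq> C" "D \<noteq> {}" "finite D" using J ne fin by (auto simp: D_def)
  have slice: "J `` {c} \<subseteq> I c" "J `` {c} \<noteq> {}" "finite (J `` {c})" if "c \<in> D" for c
    using that J fin by (auto simp: D_def intro: finite_Image)
  have inter: "(\<Inter>i\<in>K. A' i) \<in> G c"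
    if "finite K" "K \<noteq> {}" "\<And>i. i \<in> K \<Longrightarrow> A' i \<in> G c" "c \<in> C" for K :: "'i set" and A' c
    using that
  proof (induction K rule: finite_ne_induct)
    case (insert x K)
    then show ?case using Int[of c] by (auto simp: Int_stable_def)
  qed auto
  have BG: "B c \<in> G c" if "c \<in> D" for c
    unfolding B_def
  proof (rule inter)
    fix i assume "i \<in> J `` {c}"
    then show "A (c, i) \<in> G c" using A sub[of c i] J by auto
  qed (use slice[OF that] D that in auto)
  have "(\<Inter>j\<in>J. A j) = (\<Inter>c\<in>D. B c)"
    unfolding B_def D_def by fastforce
  also have "prob \<dots> = (\<Prod>c\<in>D. prob (B c))"
    using BG D by (intro indep_setsD[OF G]) auto
  also have "\<dots> = (\<Prod>c\<in>D. \<Prod>i\<in>J `` {c}. prob (A (c, i)))"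
  proof (rule prod.cong[OF refl])
    fix c assume "c \<in> D"
    then show "prob (B c) = (\<Prod>i\<in>J `` {c}. prob (A (c, i)))"
      unfolding B_def using slice[of c] D A by (intro indep_setsD[OF F]) auto
  qed
  also have "\<dots> = (\<Prod>(c, i)\<in>Sigma D (\<lambda>c. J `` {c}). prob (A (c, i)))"
    using D slice by (intro prod.Sigma) auto
  also have "\<dots> = (\<Prod>j\<in>J. prob (A j))"
    by (subst J_eq[symmetric]) (auto intro: prod.cong)
  finally show "prob (\<Inter>j\<in>J. A j) = (\<Prod>j\<in>J. prob (A j))" .
qed

lemma (in prob_space) measurable_generators:
  assumes F: "indep_sets F J" and K: "K \<subseteq> J"
    and X: "X \<in> sigma (space M) (\<Union>i\<in>K. F i) \<rightarrow>\<^sub>M S"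
  shows "random_variable S X"
    and "A \<in> sets S \<Longrightarrow> X -` A \<inter> space M \<in> sigma_sets (space M) (\<Union>i\<in>K. F i)"
proof -
  have ev: "(\<Union>i\<in>K. F i) \<subseteq> events" using F K by (auto simp: indep_sets_def)
  then have sp: "(\<Union>i\<in>K. F i) \<subseteq> Pow (space M)" using sets.sets_into_space by blast
  show "X -` A \<inter> space M \<in> sigma_sets (space M) (\<Union>i\<in>K. F i)" if "A \<in> sets S" for A
    using measurable_sets[OF X that] by (simp add: sets_measure_of[OF sp] space_measure_of[OF sp])
  have "sigma_sets (space M) (\<Union>i\<in>K. F i) \<subseteq> events"
    using ev by (rule sets.sigma_sets_subset)
  then have "sets (sigma (space M) (\<Union>i\<in>K. F i)) \<subseteq> events"
    by (simp only: sets_measure_of[OF sp])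
  moreover have "space (sigma (space M) (\<Union>i\<in>K. F i)) = space M"
    by (rule space_measure_of[OF sp])
  ultimately show "random_variable S X"
    using measurable_sets[OF X] measurable_space[OF X] by (intro measurableI) (metis subsetD)+
qed

text \<open>Disjoint subfamilies of an independent family generate independent sigma-algebras.
  Measurability of \<open>X\<close> and \<open>Y\<close> with respect to these is all that is asked,
  so they may themselves be tuples, and longer products arise by iteration.\<close>

lemma (in prob_space) distr_Pair_generators:
  assumes F: "indep_sets F J" "\<And>i. i \<in> J \<Longrightarrow> Int_stable (F i)"
    and KL: "K \<subseteq> J" "L \<subseteq> J" "K \<inter> L = {}"
    and X: "X \<in> sigma (space M) (\<Union>i\<in>K. F i) \<rightarrow>\<^sub>M S"
    and Y: "Y \<in> sigma (space M) (\<Union>i\<in>L. F i) \<rightarrow>\<^sub>M T"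
  shows "distr M (S \<Otimes>\<^sub>M T) (\<lambda>\<omega>. (X \<omega>, Y \<omega>)) = distr M S X \<Otimes>\<^sub>M distr M T Y"
proof -
  let ?I = "\<lambda>b. if b then K else L"
  note [measurable] = measurable_generators(1)[OF F(1) KL(1) X] measurable_generators(1)[OF F(1) KL(2) Y]
  have "indep_sets (\<lambda>b. sigma_sets (space M) (\<Union>i\<in>?I b. F i)) UNIV"
  proof (rule indep_sets_collect_sigma)
    show "indep_sets F (\<Union>b\<in>UNIV. ?I b)"
      by (rule indep_sets_mono_index[OF _ F(1)]) (use KL in \<open>auto split: if_splits\<close>)
    show "disjoint_family_on ?I UNIV" using KL by (auto simp: disjoint_family_on_def)
  qed (use F(2) KL in \<open>auto split: if_splits\<close>)
  then have "indep_set (sigma_sets (space M) (\<Union>i\<in>K. F i)) (sigma_sets (space M) (\<Union>i\<in>L. F i))"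
    unfolding indep_set_def
    by (rule indep_sets_mono_sets) (simp split: bool.split)
  note indep = indep_setD[OF this measurable_generators(2)[OF F(1) KL(1) X] measurable_generators(2)[OF F(1) KL(2) Y]]
  note mX = measurable_generators(1)[OF F(1) KL(1) X]
  note mY = measurable_generators(1)[OF F(1) KL(2) Y]
  have mXY: "(\<lambda>\<omega>. (X \<omega>, Y \<omega>)) \<in> M \<rightarrow>\<^sub>M S \<Otimes>\<^sub>M T" by measurable
  interpret X: prob_space "distr M S X" by (rule prob_space_distr) simp
  interpret Y: prob_space "distr M T Y" by (rule prob_space_distr) simp
  interpret XY: pair_prob_space "distr M S X" "distr M T Y" ..
  show ?thesis
  proof (rule pair_measure_eqI[symmetric])
    fix A B assume A: "A \<in> sets (distr M S X)" and B: "B \<in> sets (distr M T Y)"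
    have "(\<lambda>\<omega>. (X \<omega>, Y \<omega>)) -` (A \<times> B) \<inter> space M = (X -` A \<inter> space M) \<inter> (Y -` B \<inter> space M)"
      by auto
    moreover have "A \<in> sets S" "B \<in> sets T" using A B by simp_all
    ultimately show "emeasure (distr M S X) A * emeasure (distr M T Y) B
        = emeasure (distr M (S \<Otimes>\<^sub>M T) (\<lambda>\<omega>. (X \<omega>, Y \<omega>))) (A \<times> B)"
      using indep[of A B]
      by (simp only: emeasure_distr[OF mXY pair_measureI] emeasure_distr[OF mX] emeasure_distr[OF mY] emeasure_eq_measure)
        (metis ennreal_mult' measure_nonneg)
  qed (auto intro: X.sigma_finite_measure_axioms Y.sigma_finite_measure_axioms)
qed

lemma integrable_square_imp_integrable:
  assumes "finite_measure M" "f \<in> borel_measurable M" "integrable M (\<lambda>x. (f x)\<^sup>2)"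
  shows "integrable M (f :: 'a \<Rightarrow> real)"
proof -
  interpret finite_measure M by fact
  show ?thesis
  proof (rule Bochner_Integration.integrable_bound[of _ "\<lambda>x. 1 + (f x)\<^sup>2"])
    show "AE x in M. norm (f x) \<le> norm (1 + (f x)\<^sup>2)"
    proof (rule AE_I2)
      fix x
      have "0 \<le> (\<bar>f x\<bar> - 1)\<^sup>2" by simp
      then have "\<bar>f x\<bar> \<le> 1 + (f x)\<^sup>2"
        by (simp add: power2_diff)
      then show "norm (f x) \<le> norm (1 + (f x)\<^sup>2)" by simp
    qed
  qed (use assms in auto)
qed

lemma integrable_mult_L2:
  assumes "f \<in> borel_measurable M" "integrable M (\<lambda>x. (f x)\<^sup>2)"
    and "g \<in> borel_measurable M" "integrable M (\<lambda>x. (g x)\<^sup>2)"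
  shows "integrable M (\<lambda>x. f x * g x :: real)"
proof (rule Bochner_Integration.integrable_bound[of _ "\<lambda>x. (f x)\<^sup>2 + (g x)\<^sup>2"])
  show "AE x in M. norm (f x * g x) \<le> norm ((f x)\<^sup>2 + (g x)\<^sup>2)"
  proof (rule AE_I2)
    fix x
    have "0 \<le> (\<bar>f x\<bar> - \<bar>g x\<bar>)\<^sup>2" by simp
    then have "2 * (\<bar>f x\<bar> * \<bar>g x\<bar>) \<le> (f x)\<^sup>2 + (g x)\<^sup>2"
      by (simp add: power2_diff)
    moreover have "0 \<le> \<bar>f x\<bar> * \<bar>g x\<bar>" by simp
    ultimately have "\<bar>f x * g x\<bar> \<le> (f x)\<^sup>2 + (g x)\<^sup>2"
      unfolding abs_mult by linarith
    then show "norm (f x * g x) \<le> norm ((f x)\<^sup>2 + (g x)\<^sup>2)" by simp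
  qed
qed (use assms in auto)

lemma integral_pair_mult:
  fixes f :: "'a \<Rightarrow> real"
  assumes "prob_space N" "f \<in> borel_measurable N" "integrable N (\<lambda>x. (f x)\<^sup>2)"
  shows "(\<integral>z. f (fst z) * f (snd z) \<partial>(N \<Otimes>\<^sub>M N)) = (\<integral>x. f x \<partial>N)\<^sup>2"
proof -
  interpret N: prob_space N by fact
  interpret NN: pair_prob_space N N ..
  have fi: "integrable N f"
    using N.finite_measure_axioms assms(2,3) by (rule integrable_square_imp_integrable)
  have [measurable]: "f \<in> borel_measurable N" by fact
  have int: "integrable (N \<Otimes>\<^sub>M N) (\<lambda>z. f (fst z) * f (snd z))"
    by (rule NN.Fubini_integrable) (use fi in \<open>auto simp: abs_mult\<close>)
  have "(\<integral>z. f (fst z) * f (snd z) \<partial>(N \<Otimes>\<^sub>M N)) = (\<integral>x. (\<integral>y. f x * f y \<partial>N) \<partial>N)"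
    using NN.integral_fst'[OF int] by simp
  also have "\<dots> = (\<integral>x. f x \<partial>N)\<^sup>2" by (simp add: power2_eq_square)
  finally show ?thesis .
qed

text \<open>Given \<open>X\<close>, the variables \<open>S\<close> and \<open>S'\<close> are
  independent with the same law, so the conditional expectation of the product is the square of the
  conditional mean. The laws of the two pairs provide square integrability of the factors.\<close>

lemma (in prob_space) expectation_shared_effect:
  fixes f :: "'x \<times> 's \<Rightarrow> real"
  assumes rv [measurable]: "random_variable Q X" "random_variable R S" "random_variable R S'"
    and law: "distr M Q X = Q" "distr M (R \<Otimes>\<^sub>M R) (\<lambda>\<omega>. (S \<omega>, S' \<omega>)) = R \<Otimes>\<^sub>M R"
      "distr M (Q \<Otimes>\<^sub>M (R \<Otimes>\<^sub>M R)) (\<lambda>\<omega>. (X \<omega>, S \<omega>, S' \<omega>)) = Q \<Otimes>\<^sub>M (R \<Otimes>\<^sub>M R)"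
      "distr M (Q \<Otimes>\<^sub>M R) (\<lambda>\<omega>. (X \<omega>, S \<omega>)) = Q \<Otimes>\<^sub>M R"
      "distr M (Q \<Otimes>\<^sub>M R) (\<lambda>\<omega>. (X \<omega>, S' \<omega>)) = Q \<Otimes>\<^sub>M R"
      "distr M R S = R"
    and f [measurable]: "f \<in> borel_measurable (Q \<Otimes>\<^sub>M R)"
    and f2: "integrable (Q \<Otimes>\<^sub>M R) (\<lambda>z. (f z)\<^sup>2)"
  shows "expectation (\<lambda>\<omega>. f (X \<omega>, S \<omega>) * f (X \<omega>, S' \<omega>)) = (\<integral>x. (\<integral>s. f (x, s) \<partial>R)\<^sup>2 \<partial>Q)"
proof -
  interpret Q: prob_space Q using prob_space_distr[of X Q] law by simp
  interpret R: prob_space R using prob_space_distr[of S R] law by simp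
  interpret QR: pair_prob_space Q R ..
  interpret RR: pair_prob_space R R ..
  interpret QRR: pair_prob_space Q "R \<Otimes>\<^sub>M R" ..
  have i: "integrable M (\<lambda>\<omega>. (f (X \<omega>, S \<omega>))\<^sup>2)" "integrable M (\<lambda>\<omega>. (f (X \<omega>, S' \<omega>))\<^sup>2)"
    using integrable_distr[of "\<lambda>\<omega>. (X \<omega>, S \<omega>)" M "Q \<Otimes>\<^sub>M R" "\<lambda>z. (f z)\<^sup>2"]
      integrable_distr[of "\<lambda>\<omega>. (X \<omega>, S' \<omega>)" M "Q \<Otimes>\<^sub>M R" "\<lambda>z. (f z)\<^sup>2"] f2
    by (simp_all add: law)
  let ?h = "\<lambda>(x, s, s'). f (x, s) * f (x, s')"
  have "integrable M (\<lambda>\<omega>. f (X \<omega>, S \<omega>) * f (X \<omega>, S' \<omega>))"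
    by (rule integrable_mult_L2) (use i in auto)
  \<comment> \<open>Integrability on the triple product is inherited from \<open>M\<close>, where
    each factor is square integrable by the law of its own pair.\<close>
  then have int: "integrable (Q \<Otimes>\<^sub>M (R \<Otimes>\<^sub>M R)) ?h"
    by (subst law(3)[symmetric], subst integrable_distr_eq) (simp_all add: case_prod_beta)
  have "expectation (\<lambda>\<omega>. f (X \<omega>, S \<omega>) * f (X \<omega>, S' \<omega>))
      = (\<integral>z. ?h z \<partial>(Q \<Otimes>\<^sub>M (R \<Otimes>\<^sub>M R)))"
    by (subst law(3)[symmetric], subst integral_distr) (simp_all add: case_prod_beta)
  also have "\<dots> = (\<integral>x. (\<integral>z. f (x, fst z) * f (x, snd z) \<partial>(R \<Otimes>\<^sub>M R)) \<partial>Q)"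
    by (subst QRR.integral_fst'[symmetric, OF int]) (simp add: case_prod_beta)
  also have "\<dots> = (\<integral>x. (\<integral>s. f (x, s) \<partial>R)\<^sup>2 \<partial>Q)"
  proof (rule integral_cong_AE)
    have "AE x in Q. integrable R (\<lambda>s. (f (x, s))\<^sup>2)"
      using QR.AE_integrable_fst'[OF f2] .
    then show "AE x in Q. (\<integral>z. f (x, fst z) * f (x, snd z) \<partial>(R \<Otimes>\<^sub>M R)) = (\<integral>s. f (x, s) \<partial>R)\<^sup>2"
      using AE_space
    proof eventually_elim
      case (elim x)
      then show ?case
        by (intro integral_pair_mult R.prob_space_axioms) auto
    qed
  qed measurable
  finally show ?thesis .
qed

text \<open>The first index component is the subject. Weights summing to 1 turn the error into
  \<open>\<Sum>a\<in>I. w a * (V a \<omega> - b)\<close>, so only covariances survive: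
  \<open>c - b\<^sup>2\<close> on the diagonal, \<open>d\<close> between different visits of one
  subject, and 0 across subjects.\<close>

lemma (in prob_space) weighted_mean_square_error:
  fixes V :: "nat \<times> nat \<Rightarrow> 'a \<Rightarrow> real" and w :: "nat \<times> nat \<Rightarrow> real"
  assumes fin: "finite I"
    and meas: "\<And>a. a \<in> I \<Longrightarrow> random_variable borel (V a)"
    and int: "\<And>a. a \<in> I \<Longrightarrow> integrable M (\<lambda>\<omega>. (V a \<omega>)\<^sup>2)"
    and mean: "\<And>a. a \<in> I \<Longrightarrow> expectation (V a) = b"
    and sq: "\<And>a. a \<in> I \<Longrightarrow> expectation (\<lambda>\<omega>. (V a \<omega>)\<^sup>2) = c"
    and same: "\<And>a a'. a \<in> I \<Longrightarrow> a' \<in> I \<Longrightarrow> a \<noteq> a' \<Longrightarrow> fst a = fst a' \<Longrightarrow>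
       expectation (\<lambda>\<omega>. V a \<omega> * V a' \<omega>) = b\<^sup>2 + d"
    and diff: "\<And>a a'. a \<in> I \<Longrightarrow> a' \<in> I \<Longrightarrow> fst a \<noteq> fst a' \<Longrightarrow>
       expectation (\<lambda>\<omega>. V a \<omega> * V a' \<omega>) = b\<^sup>2"
    and w: "(\<Sum>a\<in>I. w a) = 1"
  shows "integrable M (\<lambda>\<omega>. ((\<Sum>a\<in>I. w a * V a \<omega>) - b)\<^sup>2)"
    and "expectation (\<lambda>\<omega>. ((\<Sum>a\<in>I. w a * V a \<omega>) - b)\<^sup>2) =
      (\<Sum>a\<in>I. (w a)\<^sup>2) * (c - b\<^sup>2) + (\<Sum>a\<in>I. \<Sum>a' | a' \<in> I \<and> a' \<noteq> a \<and> fst a' = fst a. w a * w a') * d"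
proof -
  have i1: "integrable M (V a)" if "a \<in> I" for a
    using finite_measure_axioms meas[OF that] int[OF that] by (rule integrable_square_imp_integrable)
  have i2: "integrable M (\<lambda>\<omega>. V a \<omega> * V a' \<omega>)" if "a \<in> I" "a' \<in> I" for a a'
    using meas[OF that(1)] int[OF that(1)] meas[OF that(2)] int[OF that(2)] by (rule integrable_mult_L2)
  have expand: "((\<Sum>a\<in>I. w a * V a \<omega>) - b)\<^sup>2
      = (\<Sum>a\<in>I. \<Sum>a'\<in>I. w a * w a' * (V a \<omega> * V a' \<omega> - b * V a \<omega> - b * V a' \<omega> + b\<^sup>2))" for \<omega>
  proof -
    have "(\<Sum>a\<in>I. w a * V a \<omega>) - b = (\<Sum>a\<in>I. w a * V a \<omega>) - (\<Sum>a\<in>I. w a) * b" using w by simp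
    also have "\<dots> = (\<Sum>a\<in>I. w a * (V a \<omega> - b))"
      by (simp add: sum_distrib_right sum_subtractf right_diff_distrib)
    finally have *: "(\<Sum>a\<in>I. w a * V a \<omega>) - b = (\<Sum>a\<in>I. w a * (V a \<omega> - b))" .
    show ?thesis unfolding * power2_eq_square sum_product
      by (intro sum.cong refl) (simp add: algebra_simps)
  qed
  let ?U = "\<lambda>a a' \<omega>. w a * w a' * (V a \<omega> * V a' \<omega> - b * V a \<omega> - b * V a' \<omega> + b\<^sup>2)"
  have i3: "integrable M (?U a a')" if "a \<in> I" "a' \<in> I" for a a'
    using i1[OF that(1)] i1[OF that(2)] i2[OF that] by simp
  then have i4: "integrable M (\<lambda>\<omega>. \<Sum>a'\<in>I. ?U a a' \<omega>)" if "a \<in> I" for a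
    using that by (rule_tac Bochner_Integration.integrable_sum) blast
  show "integrable M (\<lambda>\<omega>. ((\<Sum>a\<in>I. w a * V a \<omega>) - b)\<^sup>2)"
    unfolding expand by (rule Bochner_Integration.integrable_sum) (rule i4)
  have "expectation (?U a a') = w a * w a' * (expectation (\<lambda>\<omega>. V a \<omega> * V a' \<omega>) - b\<^sup>2)"
    if "a \<in> I" "a' \<in> I" for a a'
    using i1[OF that(1)] i1[OF that(2)] i2[OF that] mean that
    by (simp add: prob_space power2_eq_square)
  note ex = this
  have cov: "expectation (\<lambda>\<omega>. V a \<omega> * V a' \<omega>)
      = b\<^sup>2 + (if a' = a then c - b\<^sup>2 else 0) + (if a' \<noteq> a \<and> fst a' = fst a then d else 0)"
    if "a \<in> I" "a' \<in> I" for a a'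
    using that sq[of a] same[of a a'] diff[of a a'] by (auto simp: power2_eq_square)
  have "expectation (\<lambda>\<omega>. ((\<Sum>a\<in>I. w a * V a \<omega>) - b)\<^sup>2)
      = (\<Sum>a\<in>I. \<Sum>a'\<in>I. w a * w a' * (expectation (\<lambda>\<omega>. V a \<omega> * V a' \<omega>) - b\<^sup>2))"
    unfolding expand
    by (subst Bochner_Integration.integral_sum, erule i4, rule sum.cong[OF refl])
       (subst Bochner_Integration.integral_sum, erule (1) i3, rule sum.cong[OF refl], erule (1) ex)
  also have "\<dots> = (\<Sum>a\<in>I. \<Sum>a'\<in>I. (if a' = a then w a * w a * (c - b\<^sup>2) else 0) +
        (if a' \<noteq> a \<and> fst a' = fst a then w a * w a' * d else 0))"
    by (intro sum.cong refl) (simp add: cov)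
  also have "\<dots> = (\<Sum>a\<in>I. (w a)\<^sup>2) * (c - b\<^sup>2) + (\<Sum>a\<in>I. \<Sum>a' | a' \<in> I \<and> a' \<noteq> a \<and> fst a' = fst a. w a * w a') * d"
    by (simp add: sum.distrib sum_distrib_right fin sum.delta power2_eq_square sum.If_cases Int_def)
  finally show "expectation (\<lambda>\<omega>. ((\<Sum>a\<in>I. w a * V a \<omega>) - b)\<^sup>2) =
      (\<Sum>a\<in>I. (w a)\<^sup>2) * (c - b\<^sup>2) + (\<Sum>a\<in>I. \<Sum>a' | a' \<in> I \<and> a' \<noteq> a \<and> fst a' = fst a. w a * w a') * d" .
qed

section \<open>Orthonormal expansions\<close>

lemma L2_basis: "orthonormal_basis N \<phi> \<Longrightarrow> 1 \<le> k \<Longrightarrow> L2 N (\<phi> k)"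
  by (simp add: orthonormal_basis_def)

lemma integral_basis_mult:
  "orthonormal_basis N \<phi> \<Longrightarrow> 1 \<le> j \<Longrightarrow> 1 \<le> k \<Longrightarrow>
    (\<integral>t. \<phi> j t * \<phi> k t \<partial>N) = (if j = k then 1 else 0)"
  by (simp add: orthonormal_basis_def)

lemma L2_mult_integrable: "L2 N f \<Longrightarrow> L2 N g \<Longrightarrow> integrable N (\<lambda>x. f x * g x)"
  unfolding L2_def by (blast intro: integrable_mult_L2)

text \<open>This is Pythagoras with arbitrary coefficients \<open>c\<close>. Estimated coefficients
  split the loss into estimation error and truncation bias; with the Fourier coefficients as
  \<open>c\<close> the first sum vanishes, which yields Bessel's inequality and Parseval's
  identity.\<close>

lemma orthonormal_expansion:
  assumes B: "orthonormal_basis N \<phi>" and f: "L2 N f" and A: "finite A" "A \<subseteq> {1..}"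
  shows "integrable N (\<lambda>t. ((\<Sum>k\<in>A. c k * \<phi> k t) - f t)\<^sup>2)"
    and "(\<integral>t. ((\<Sum>k\<in>A. c k * \<phi> k t) - f t)\<^sup>2 \<partial>N)
      = (\<Sum>k\<in>A. (c k - (\<integral>t. f t * \<phi> k t \<partial>N))\<^sup>2) + (normsq N f - (\<Sum>k\<in>A. (\<integral>t. f t * \<phi> k t \<partial>N)\<^sup>2))"
proof -
  let ?b = "\<lambda>k. \<integral>t. f t * \<phi> k t \<partial>N"
  have i1: "integrable N (\<lambda>t. \<phi> j t * \<phi> k t)" if "j \<in> A" "k \<in> A" for j k
    using L2_basis[OF B] A that by (blast intro: L2_mult_integrable)
  have i2: "integrable N (\<lambda>t. f t * \<phi> k t)" if "k \<in> A" for k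
    using L2_basis[OF B] A that f by (blast intro: L2_mult_integrable)
  have i3: "integrable N (\<lambda>t. (f t)\<^sup>2)" using f by (simp add: L2_def)
  have i4: "integrable N (\<lambda>t. \<Sum>k\<in>A. c j * c k * (\<phi> j t * \<phi> k t))" if "j \<in> A" for j
    by (rule Bochner_Integration.integrable_sum) (simp add: i1 that)
  have i5: "integrable N (\<lambda>t. \<Sum>j\<in>A. \<Sum>k\<in>A. c j * c k * (\<phi> j t * \<phi> k t))"
    by (rule Bochner_Integration.integrable_sum) (rule i4)
  have i6: "integrable N (\<lambda>t. \<Sum>k\<in>A. 2 * c k * (f t * \<phi> k t))"
    by (rule Bochner_Integration.integrable_sum) (simp add: i2)
  have expand: "((\<Sum>k\<in>A. c k * \<phi> k t) - f t)\<^sup>2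
      = (\<Sum>j\<in>A. \<Sum>k\<in>A. c j * c k * (\<phi> j t * \<phi> k t)) - (\<Sum>k\<in>A. 2 * c k * (f t * \<phi> k t)) + (f t)\<^sup>2" for t
    by (simp add: power2_diff power2_eq_square sum_product sum_distrib_left algebra_simps)
  show "integrable N (\<lambda>t. ((\<Sum>k\<in>A. c k * \<phi> k t) - f t)\<^sup>2)"
    unfolding expand using i3 i5 i6 by (intro Bochner_Integration.integrable_add Bochner_Integration.integrable_diff)
  have "(\<integral>t. (\<Sum>j\<in>A. \<Sum>k\<in>A. c j * c k * (\<phi> j t * \<phi> k t)) \<partial>N) = (\<Sum>j\<in>A. \<Sum>k\<in>A. c j * c k * (if j = k then 1 else 0))"
  proof (subst Bochner_Integration.integral_sum, erule i4, rule sum.cong[OF refl])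
    fix j assume j: "j \<in> A"
    show "(\<integral>t. (\<Sum>k\<in>A. c j * c k * (\<phi> j t * \<phi> k t)) \<partial>N) = (\<Sum>k\<in>A. c j * c k * (if j = k then 1 else 0))"
      using A j by (subst Bochner_Integration.integral_sum)
        (auto simp: i1 integral_basis_mult[OF B] subset_iff intro!: sum.cong)
  qed
  also have "\<dots> = (\<Sum>j\<in>A. (c j)\<^sup>2)"
    using A by (simp add: power2_eq_square if_distrib[of "\<lambda>x. _ * x"] cong: if_cong)
  finally have e5: "(\<integral>t. (\<Sum>j\<in>A. \<Sum>k\<in>A. c j * c k * (\<phi> j t * \<phi> k t)) \<partial>N) = (\<Sum>j\<in>A. (c j)\<^sup>2)" .
  have e6: "(\<integral>t. (\<Sum>k\<in>A. 2 * c k * (f t * \<phi> k t)) \<partial>N) = (\<Sum>k\<in>A. 2 * c k * ?b k)"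
    by (subst Bochner_Integration.integral_sum) (auto simp: i2)
  have "(\<integral>t. ((\<Sum>k\<in>A. c k * \<phi> k t) - f t)\<^sup>2 \<partial>N) = (\<Sum>j\<in>A. (c j)\<^sup>2) - (\<Sum>k\<in>A. 2 * c k * ?b k) + normsq N f"
    unfolding expand using i3 i5 i6 e5 e6 by (simp add: normsq_def)
  also have "\<dots> = (\<Sum>k\<in>A. (c k - ?b k)\<^sup>2) + (normsq N f - (\<Sum>k\<in>A. (?b k)\<^sup>2))"
    by (simp add: power2_diff sum.distrib sum_subtractf mult.assoc)
  finally show "(\<integral>t. ((\<Sum>k\<in>A. c k * \<phi> k t) - f t)\<^sup>2 \<partial>N)
      = (\<Sum>k\<in>A. (c k - ?b k)\<^sup>2) + (normsq N f - (\<Sum>k\<in>A. (?b k)\<^sup>2))" .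
qed

lemma bessel_inequality:
  assumes "orthonormal_basis N \<phi>" "L2 N f" "finite A" "A \<subseteq> {1..}"
  shows "(\<Sum>k\<in>A. (\<integral>t. f t * \<phi> k t \<partial>N)\<^sup>2) \<le> normsq N f"
proof -
  have "0 \<le> (\<integral>t. ((\<Sum>k\<in>A. (\<integral>r. f r * \<phi> k r \<partial>N) * \<phi> k t) - f t)\<^sup>2 \<partial>N)" by simp
  then show ?thesis unfolding orthonormal_expansion(2)[OF assms] by simp
qed

text \<open>Completeness is encoded in \<open>orthonormal_basis\<close> as convergence of the
  residual norms to 0, and the squared residual norm is exactly the gap in Bessel's
  inequality.\<close>

lemma parseval:
  assumes B: "orthonormal_basis N \<phi>" and f: "L2 N f"
  shows "(\<lambda>K. \<Sum>k=1..K. (\<integral>t. f t * \<phi> k t \<partial>N)\<^sup>2) \<longlonglongrightarrow> normsq N f"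
proof -
  have "normsq N (\<lambda>t. f t - (\<Sum>k=1..K. (\<integral>r. f r * \<phi> k r \<partial>N) * \<phi> k t))
      = normsq N f - (\<Sum>k=1..K. (\<integral>t. f t * \<phi> k t \<partial>N)\<^sup>2)" for K
    using orthonormal_expansion(2)[OF B f, of "{1..K}" "\<lambda>k. \<integral>r. f r * \<phi> k r \<partial>N"]
    unfolding normsq_def by (subst power2_commute) auto
  then have "(\<lambda>K. normsq N f - (\<Sum>k=1..K. (\<integral>t. f t * \<phi> k t \<partial>N)\<^sup>2)) \<longlonglongrightarrow> 0"
    using B f unfolding orthonormal_basis_def by auto
  from tendsto_diff[OF tendsto_const[of "normsq N f"] this] show ?thesis by simp
qed

text \<open>The cross term vanishes because \<open>f\<close> is centred. Extended values make the
  bound applicable to the field at a fixed \<open>(u, t)\<close>, where its second moment may be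
  infinite.\<close>

lemma nn_integral_square_sum_le:
  assumes "prob_space M" and f: "f \<in> borel_measurable M" "integrable M f" "(\<integral>x. f x \<partial>M) = 0"
  shows "(\<integral>\<^sup>+x. ennreal ((m + c * f x)\<^sup>2) \<partial>M) \<le> ennreal (m\<^sup>2) + ennreal (c\<^sup>2) * (\<integral>\<^sup>+x. ennreal ((f x)\<^sup>2) \<partial>M)"
proof (cases "(\<integral>\<^sup>+x. ennreal ((f x)\<^sup>2) \<partial>M) = \<infinity>")
  \<comment> \<open>The right-hand side is infinite unless \<open>c = 0\<close>. In that case
    \<open>0 * \<infinity>\<close> is 0 in \<open>ennreal\<close> and the integrand on the left is
    the constant \<open>m\<^sup>2\<close>.\<close>
  case True
  show ?thesis
  proof (cases "c = 0")
    case True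
    interpret prob_space M by fact
    show ?thesis using True by (simp add: emeasure_space_1)
  qed (simp add: True ennreal_mult_top)
next
  case False
  interpret prob_space M by fact
  have [measurable]: "f \<in> borel_measurable M" by fact
  have i2: "integrable M (\<lambda>x. (f x)\<^sup>2)"
    using False by (intro integrableI_bounded) (auto simp: less_top)
  have expand: "(m + c * f x)\<^sup>2 = m\<^sup>2 + 2 * m * c * f x + c\<^sup>2 * (f x)\<^sup>2" for x
    by (simp add: power2_eq_square algebra_simps)
  have "integrable M (\<lambda>x. (m + c * f x)\<^sup>2)" unfolding expand using f i2 by simp
  then have "(\<integral>\<^sup>+x. ennreal ((m + c * f x)\<^sup>2) \<partial>M) = ennreal (\<integral>x. (m + c * f x)\<^sup>2 \<partial>M)"
    by (rule nn_integral_eq_integral) simp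
  also have "(\<integral>x. (m + c * f x)\<^sup>2 \<partial>M) = m\<^sup>2 + c\<^sup>2 * (\<integral>x. (f x)\<^sup>2 \<partial>M)"
    unfolding expand using f i2 by (simp add: prob_space)
  also have "ennreal \<dots> = ennreal (m\<^sup>2) + ennreal (c\<^sup>2) * (\<integral>\<^sup>+x. ennreal ((f x)\<^sup>2) \<partial>M)"
    using nn_integral_eq_integral[OF i2] by (simp add: ennreal_plus ennreal_mult)
  finally show ?thesis by simp
qed

section \<open>Moments of a single observation\<close>

text \<open>Random fields are only jointly measurable, so evaluation at a random time is treated as a map on tuples.\<close>

definition eval_field :: "('a \<Rightarrow> 'b \<Rightarrow> 'c) \<times> 'a \<times> 'b \<Rightarrow> 'c" where
  "eval_field z = fst z (fst (snd z)) (snd (snd z))"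

definition eval_noise :: "('a \<Rightarrow> 'c) \<times> 'a \<Rightarrow> 'c" where
  "eval_noise z = fst z (snd z)"

text \<open>The nesting \<open>(x, (t, e))\<close> separates the field, which all visits of a
  subject share, from the time and noise that each visit draws afresh. The value is the contribution
  of one visit to the coefficient estimator, before weighting.\<close>

definition obs_term :: "'u fda_model \<Rightarrow> nat \<Rightarrow> 'u \<Rightarrow> ('u \<Rightarrow> real \<Rightarrow> real) \<times> real \<times> ('u \<Rightarrow> real) \<Rightarrow> real" where
  "obs_term P k u = (\<lambda>(x, t, e). (mean_fn P u t + x u t + noise_scale P t * e u)
     * (basis_fn P k t / time_dens P t))"

lemma obs_term_eval: "obs_term P k u z =
  (mean_fn P u (fst (snd z)) + eval_field (fst z, u, fst (snd z)) + noise_scale P (fst (snd z)) * eval_noise (snd (snd z), u))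
     * (basis_fn P k (fst (snd z)) / time_dens P (fst (snd z)))"
  by (simp add: obs_term_def eval_field_def eval_noise_def split_beta)

locale fda =
  fixes P :: "('u::{metric_space,second_countable_topology}) fda_model"
  assumes model: "model_ok P" and Gamma: "Gamma_continuous P" and C1_pos: "0 < C1 P"
begin

abbreviation U where "U \<equiv> nu P"
abbreviation T where "T \<equiv> lebT P"
abbreviation X where "X \<equiv> field_law P"
abbreviation E where "E \<equiv> noise_law P"
abbreviation g where "g \<equiv> time_dens P"
abbreviation \<mu> where "\<mu> \<equiv> mean_fn P"
abbreviation \<phi> where "\<phi> \<equiv> basis_fn P"
abbreviation \<tau> where "\<tau> \<equiv> noise_scale P"
abbreviation \<beta> where "\<beta> \<equiv> mean_coef P"

definition time_law :: "real measure" where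
  "time_law = density T (\<lambda>t. ennreal (g t))"

lemma basis: "orthonormal_basis T \<phi>"
  using model by (simp add: model_ok_def)

lemma space_T [simp]: "space T = tdom P"
  by (simp add: lebT_def space_restrict_space)

lemma sets_T: "sets T = sets (restrict_space borel (tdom P))"
  by (simp add: lebT_def sets_restrict_space)

lemma space_U [simp]: "space U = UNIV"
  using model sets_eq_imp_space_eq[of U borel] by (simp add: model_ok_def)

lemma g_pos: "t \<in> tdom P \<Longrightarrow> 0 < g t"
  using model by (simp add: model_ok_def time_ok_def)

lemma measurable_g [measurable]: "g \<in> borel_measurable T"
proof -
  obtain L where "L-lipschitz_on (tdom P) g" using model by (auto simp: model_ok_def time_ok_def)
  then have "g \<in> borel_measurable (restrict_space borel (tdom P))"
    by (intro borel_measurable_continuous_on_restrict lipschitz_on_continuous_on)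
  then show ?thesis by (simp add: measurable_cong_sets[OF sets_T refl])
qed

lemma measurable_\<tau> [measurable]: "\<tau> \<in> borel_measurable T"
  using model by (simp add: model_ok_def noise_ok_def)

lemma measurable_\<phi> [measurable]: "1 \<le> k \<Longrightarrow> \<phi> k \<in> borel_measurable T"
  using L2_basis[OF basis] by (simp add: L2_def)

lemma measurable_\<mu>: "(\<lambda>(u, t). \<mu> u t) \<in> borel_measurable (U \<Otimes>\<^sub>M T)"
  using model by (simp add: model_ok_def mean_ok_def L2_def UT_def)

lemma measurable_\<mu>' [measurable (raw)]:
  assumes "f \<in> M \<rightarrow>\<^sub>M U" "h \<in> M \<rightarrow>\<^sub>M T"
  shows "(\<lambda>x. \<mu> (f x) (h x)) \<in> borel_measurable M"
  using measurable_compose[OF measurable_Pair[OF assms] measurable_\<mu>] by simp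

lemma measurable_eval_field [measurable]: "eval_field \<in> borel_measurable (X \<Otimes>\<^sub>M (U \<Otimes>\<^sub>M T))"
proof -
  have "eval_field = (\<lambda>(x :: 'u \<Rightarrow> real \<Rightarrow> real, u, t). x u t)" by (auto simp: eval_field_def fun_eq_iff)
  then show ?thesis using model by (simp add: model_ok_def field_ok_def UT_def)
qed

lemma measurable_eval_noise [measurable]: "eval_noise \<in> borel_measurable (E \<Otimes>\<^sub>M U)"
proof -
  have "eval_noise = (\<lambda>(e :: 'u \<Rightarrow> real, u). e u)" by (auto simp: eval_noise_def fun_eq_iff)
  then show ?thesis using model by (simp add: model_ok_def noise_ok_def)
qed

lemma sets_time_law [measurable_cong]: "sets time_law = sets T"
  by (simp add: time_law_def)

lemma space_time_law [simp]: "space time_law = tdom P"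
  by (simp add: time_law_def)

lemma finite_measure_U: "finite_measure U"
  using model by (simp add: model_ok_def)

lemma finite_measure_T: "finite_measure T"
proof
  have "emeasure T (tdom P) = emeasure lborel (tdom P)"
    unfolding lebT_def tdom_def by (subst emeasure_restrict_space) auto
  also have "\<dots> < \<infinity>" unfolding tdom_def by (simp add: emeasure_lborel_Icc_eq)
  finally show "emeasure T (space T) \<noteq> \<infinity>" by simp
qed

lemma prob_space_X: "prob_space X"
  using model by (simp add: model_ok_def field_ok_def)

lemma prob_space_E: "prob_space E"
  using model by (simp add: model_ok_def noise_ok_def)

lemma prob_space_time_law: "prob_space time_law"
proof
  have "(\<integral>\<^sup>+t. ennreal (g t) \<partial>T) = 1" using model by (simp add: model_ok_def time_ok_def)
  moreover have "(\<integral>\<^sup>+t. ennreal (g t) * indicator (space time_law) t \<partial>T) = (\<integral>\<^sup>+t. ennreal (g t) \<partial>T)"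
    by (rule nn_integral_cong) simp
  ultimately show "emeasure time_law (space time_law) = 1"
    unfolding time_law_def by (subst emeasure_density) (simp_all add: time_law_def[symmetric] sets.top[of T, simplified])
qed

sublocale U: finite_measure U by (rule finite_measure_U)
sublocale T: finite_measure T by (rule finite_measure_T)
sublocale X: prob_space X by (rule prob_space_X)
sublocale E: prob_space E by (rule prob_space_E)
sublocale time: prob_space time_law by (rule prob_space_time_law)
sublocale UT: pair_sigma_finite U T ..
sublocale XT: pair_sigma_finite X T ..
sublocale XU: pair_sigma_finite X U ..
sublocale te: pair_prob_space time_law E ..
sublocale Xte: pair_prob_space X "time_law \<Otimes>\<^sub>M E" ..

lemma measurable_obs_term:
  assumes k: "1 \<le> k" and f: "f \<in> M \<rightarrow>\<^sub>M U" and h: "h \<in> M \<rightarrow>\<^sub>M X \<Otimes>\<^sub>M (time_law \<Otimes>\<^sub>M E)"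
  shows "(\<lambda>x. obs_term P k (f x) (h x)) \<in> borel_measurable M"
proof -
  note [measurable] = f h measurable_\<phi>[OF k]
  have [measurable]: "(\<lambda>x. fst (snd (h x))) \<in> M \<rightarrow>\<^sub>M T"
    using measurable_compose[OF h, of "\<lambda>z. fst (snd z)" T] by simp
  show ?thesis unfolding obs_term_eval by measurable
qed

lemma field_mean_zero: "t \<in> tdom P \<Longrightarrow> integrable X (\<lambda>x. x u t)" "t \<in> tdom P \<Longrightarrow> (\<integral>x. x u t \<partial>X) = 0"
  using model by (auto simp: model_ok_def field_ok_def)

lemma noise_moments:
  "integrable E (\<lambda>e. e u)" "(\<integral>e. e u \<partial>E) = 0" "integrable E (\<lambda>e. (e u)\<^sup>2)" "(\<integral>e. (e u)\<^sup>2 \<partial>E) = 1"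
proof -
  have *: "integrable E (\<lambda>e. e u)" "(\<integral>e. e u \<partial>E) = 0" "integrable E (\<lambda>e. (e u)\<^sup>2)"
      "E.variance (\<lambda>e. e u) = 1"
    using model unfolding model_ok_def noise_ok_def by blast+
  show "integrable E (\<lambda>e. e u)" "(\<integral>e. e u \<partial>E) = 0" "integrable E (\<lambda>e. (e u)\<^sup>2)" by (rule *)+
  show "(\<integral>e. (e u)\<^sup>2 \<partial>E) = 1" using *(4) unfolding *(2) by simp
qed

text \<open>The field is integrated out first, then the noise; both are centred, so each step just
  adds a second moment. The density of the observation time cancels one of the two factors
  \<open>1 / g t\<close>.\<close>

lemma second_moment_le:
  assumes k: "1 \<le> k"
  shows "(\<integral>\<^sup>+z. ennreal ((obs_term P k u z)\<^sup>2) \<partial>(X \<Otimes>\<^sub>M (time_law \<Otimes>\<^sub>M E)))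
    \<le> (\<integral>\<^sup>+t. (ennreal ((\<mu> u t)\<^sup>2) + (\<integral>\<^sup>+x. ennreal ((eval_field (x, u, t))\<^sup>2) \<partial>X) + ennreal ((\<tau> t)\<^sup>2))
         * ennreal ((\<phi> k t)\<^sup>2 / g t) \<partial>T)"
proof -
  note [measurable] = measurable_\<phi>[OF k]
  note [measurable (raw)] = measurable_obs_term[OF k]
  let ?h = "\<lambda>t e. \<integral>\<^sup>+x. ennreal ((obs_term P k u (x, t, e))\<^sup>2) \<partial>X"
  have "(\<integral>\<^sup>+z. ennreal ((obs_term P k u z)\<^sup>2) \<partial>(X \<Otimes>\<^sub>M (time_law \<Otimes>\<^sub>M E)))
      = (\<integral>\<^sup>+s. ?h (fst s) (snd s) \<partial>(time_law \<Otimes>\<^sub>M E))"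
    by (subst Xte.nn_integral_snd[symmetric]) auto
  also have "\<dots> = (\<integral>\<^sup>+t. (\<integral>\<^sup>+e. ?h t e \<partial>E) \<partial>time_law)"
    by (subst E.nn_integral_fst[symmetric]) auto
  also have "\<dots> = (\<integral>\<^sup>+t. ennreal (g t) * (\<integral>\<^sup>+e. ?h t e \<partial>E) \<partial>T)"
    unfolding time_law_def by (subst nn_integral_density) auto
  also have "\<dots> \<le> (\<integral>\<^sup>+t. (ennreal ((\<mu> u t)\<^sup>2) + (\<integral>\<^sup>+x. ennreal ((eval_field (x, u, t))\<^sup>2) \<partial>X) + ennreal ((\<tau> t)\<^sup>2))
         * ennreal ((\<phi> k t)\<^sup>2 / g t) \<partial>T)"
  proof (rule nn_integral_mono)
    fix t assume "t \<in> space T"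
    then have t: "t \<in> tdom P" and [measurable]: "t \<in> space T" by simp_all
    let ?c = "\<phi> k t / g t"
    let ?x2 = "\<integral>\<^sup>+x. ennreal ((eval_field (x, u, t))\<^sup>2) \<partial>X"
    have [measurable]: "(\<lambda>e. e u) \<in> borel_measurable E" "(\<lambda>x. x u t) \<in> borel_measurable X"
      using noise_moments(1) field_mean_zero(1)[OF t] by (auto dest: borel_measurable_integrable)
    have "?h t e \<le> ennreal (?c\<^sup>2) * (ennreal ((\<mu> u t + \<tau> t * e u)\<^sup>2) + ?x2)" for e
    proof -
      have "?h t e = (\<integral>\<^sup>+x. ennreal (?c\<^sup>2) * ennreal (((\<mu> u t + \<tau> t * e u) + 1 * x u t)\<^sup>2) \<partial>X)"
        by (rule nn_integral_cong)
          (simp add: obs_term_def ennreal_mult[symmetric] power_mult_distrib[symmetric] algebra_simps)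
      also have "\<dots> = ennreal (?c\<^sup>2) * (\<integral>\<^sup>+x. ennreal (((\<mu> u t + \<tau> t * e u) + 1 * x u t)\<^sup>2) \<partial>X)"
        by (rule nn_integral_cmult) measurable
      also have "\<dots> \<le> ennreal (?c\<^sup>2) * (ennreal ((\<mu> u t + \<tau> t * e u)\<^sup>2) + ennreal (1\<^sup>2) * (\<integral>\<^sup>+x. ennreal ((x u t)\<^sup>2) \<partial>X))"
        by (intro mult_left_mono nn_integral_square_sum_le X.prob_space_axioms field_mean_zero[OF t]) auto
      finally show ?thesis by (simp add: eval_field_def)
    qed
    then have "(\<integral>\<^sup>+e. ?h t e \<partial>E) \<le> (\<integral>\<^sup>+e. ennreal (?c\<^sup>2) * (ennreal ((\<mu> u t + \<tau> t * e u)\<^sup>2) + ?x2) \<partial>E)"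
      by (intro nn_integral_mono) simp
    also have "\<dots> = ennreal (?c\<^sup>2) * ((\<integral>\<^sup>+e. ennreal ((\<mu> u t + \<tau> t * e u)\<^sup>2) \<partial>E) + ?x2)"
      by (subst nn_integral_cmult, measurable, subst nn_integral_add) (auto simp: E.emeasure_space_1)
    also have "\<dots> \<le> ennreal (?c\<^sup>2) * ((ennreal ((\<mu> u t)\<^sup>2) + ennreal ((\<tau> t)\<^sup>2) * (\<integral>\<^sup>+e. ennreal ((e u)\<^sup>2) \<partial>E)) + ?x2)"
      using nn_integral_square_sum_le[OF E.prob_space_axioms _ noise_moments(1,2)]
      by (intro mult_left_mono add_right_mono) auto
    also have "(\<integral>\<^sup>+e. ennreal ((e u)\<^sup>2) \<partial>E) = 1"
      using nn_integral_eq_integral[OF noise_moments(3)[of u]] noise_moments(4)[of u] by simp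
    finally have "ennreal (g t) * (\<integral>\<^sup>+e. ?h t e \<partial>E)
        \<le> ennreal (g t) * (ennreal (?c\<^sup>2) * ((ennreal ((\<mu> u t)\<^sup>2) + ennreal ((\<tau> t)\<^sup>2) * 1) + ?x2))"
      by (rule mult_left_mono) simp
    also have "\<dots> = (ennreal (g t) * ennreal (?c\<^sup>2)) * (ennreal ((\<mu> u t)\<^sup>2) + ?x2 + ennreal ((\<tau> t)\<^sup>2))"
      by (simp add: mult.assoc ac_simps)
    also have "ennreal (g t) * ennreal (?c\<^sup>2) = ennreal ((\<phi> k t)\<^sup>2 / g t)"
      using g_pos[OF t] by (simp add: ennreal_mult[symmetric] power2_eq_square)
    finally show "ennreal (g t) * (\<integral>\<^sup>+e. ?h t e \<partial>E)
      \<le> (ennreal ((\<mu> u t)\<^sup>2) + ?x2 + ennreal ((\<tau> t)\<^sup>2)) * ennreal ((\<phi> k t)\<^sup>2 / g t)"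
      by (simp add: mult.commute)
  qed
  finally show ?thesis .
qed


text \<open>The infimum is the denominator of \<open>C1 P\<close>. Division by zero gives 0, so the
  assumption \<open>0 < C1 P\<close> rules out a vanishing infimum.\<close>

lemma g_min_pos: "0 < (INF t\<in>tdom P. g t)"
proof -
  have "tdom P \<noteq> {}" using model by (simp add: tdom_def model_ok_def)
  then have "0 \<le> (INF t\<in>tdom P. g t)" by (intro cINF_greatest) (auto dest: g_pos)
  then show ?thesis using C1_pos unfolding C1_def by (cases "(INF t\<in>tdom P. g t) = 0") auto
qed

lemma g_min_le: "t \<in> tdom P \<Longrightarrow> (INF t\<in>tdom P. g t) \<le> g t"
  by (intro cINF_lower bdd_belowI2[of _ 0]) (auto dest: g_pos)

lemma mean_L2: "t \<in> tdom P \<Longrightarrow> L2 U (\<lambda>u. \<mu> u t)"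
  using model by (simp add: model_ok_def mean_ok_def)

text \<open>The right-hand side is the numerator of \<open>C1 P\<close>, whose three summands bound
  the three integrals separately; the middle integral is \<open>Gamma_X P t t\<close>.\<close>

lemma nn_integral_U_second_moments_le:
  assumes t: "t \<in> tdom P"
  shows "(\<integral>\<^sup>+u. ennreal ((\<mu> u t)\<^sup>2) + (\<integral>\<^sup>+x. ennreal ((eval_field (x, u, t))\<^sup>2) \<partial>X) + ennreal ((\<tau> t)\<^sup>2) \<partial>U)
    \<le> ennreal (C1 P * (INF t\<in>tdom P. g t))"
proof -
  have [measurable]: "t \<in> space T" using t by simp
  let ?a = "SUP t\<in>tdom P. normsq U (\<lambda>u. \<mu> u t)"
  let ?b = "SUP z\<in>tdom P \<times> tdom P. \<bar>Gamma_X P (fst z) (snd z)\<bar>"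
  let ?c = "SUP t\<in>tdom P. \<bar>\<tau> t\<bar>"
  have "(\<integral>\<^sup>+u. ennreal ((\<mu> u t)\<^sup>2) \<partial>U) = ennreal (normsq U (\<lambda>u. \<mu> u t))"
    unfolding normsq_def using mean_L2[OF t] by (intro nn_integral_eq_integral) (auto simp: L2_def)
  also have "\<dots> \<le> ennreal ?a"
    using model t by (intro ennreal_leI cSUP_upper) (auto simp: model_ok_def mean_ok_def)
  finally have a: "(\<integral>\<^sup>+u. ennreal ((\<mu> u t)\<^sup>2) \<partial>U) \<le> ennreal ?a" .
  have i: "integrable (X \<Otimes>\<^sub>M U) (\<lambda>(x, u). (x u t)\<^sup>2)"
    using Gamma t by (simp add: Gamma_continuous_def)
  have "(\<integral>\<^sup>+u. (\<integral>\<^sup>+x. ennreal ((eval_field (x, u, t))\<^sup>2) \<partial>X) \<partial>U) = (\<integral>\<^sup>+z. ennreal ((eval_field (fst z, snd z, t))\<^sup>2) \<partial>(X \<Otimes>\<^sub>M U))"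
    by (subst XU.nn_integral_snd[symmetric]) auto
  also have "\<dots> = ennreal (\<integral>z. (fst z (snd z) t)\<^sup>2 \<partial>(X \<Otimes>\<^sub>M U))"
    using i unfolding eval_field_def by (subst nn_integral_eq_integral[symmetric]) (auto simp: split_beta')
  also have "(\<integral>z. (fst z (snd z) t)\<^sup>2 \<partial>(X \<Otimes>\<^sub>M U)) = Gamma_X P t t"
    unfolding Gamma_X_def using XU.integral_fst'[of "\<lambda>z. (fst z (snd z) t)\<^sup>2"] i
    by (simp add: split_beta' power2_eq_square)
  also have "ennreal \<dots> \<le> ennreal ?b"
  \<comment> \<open>A real supremum is an upper bound only for a set that is bounded above; here
    this comes from continuity on the compact square.\<close>
  proof (intro ennreal_leI)
    have "compact (tdom P \<times> tdom P)" by (simp add: tdom_def compact_Times)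
    moreover have "continuous_on (tdom P \<times> tdom P) (\<lambda>z. \<bar>Gamma_X P (fst z) (snd z)\<bar>)"
      using Gamma by (auto simp: Gamma_continuous_def split_beta' intro: continuous_on_rabs)
    ultimately have "bdd_above ((\<lambda>z. \<bar>Gamma_X P (fst z) (snd z)\<bar>) ` (tdom P \<times> tdom P))"
      by (intro bounded_imp_bdd_above compact_imp_bounded compact_continuous_image)
    then have "\<bar>Gamma_X P (fst (t, t)) (snd (t, t))\<bar> \<le> ?b"
      using t by (intro cSUP_upper) auto
    then show "Gamma_X P t t \<le> ?b" by simp
  qed
  finally have b: "(\<integral>\<^sup>+u. (\<integral>\<^sup>+x. ennreal ((eval_field (x, u, t))\<^sup>2) \<partial>X) \<partial>U) \<le> ennreal ?b" .
  \<comment> \<open>Boundedness is assumed for \<open>\<tau>\<close> but needed for its absolute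
    value; nonnegativity makes the two images coincide.\<close>
  have "(\<lambda>t. \<bar>\<tau> t\<bar>) ` tdom P = \<tau> ` tdom P"
    using model by (intro image_cong) (auto simp: model_ok_def noise_ok_def)
  then have "\<bar>\<tau> t\<bar> \<le> ?c"
    using model t by (intro cSUP_upper) (auto simp: model_ok_def noise_ok_def)
  then have "(\<tau> t)\<^sup>2 \<le> ?c\<^sup>2" by (metis abs_ge_zero power2_abs power_mono)
  then have "ennreal ((\<tau> t)\<^sup>2) * emeasure U UNIV \<le> ennreal (?c\<^sup>2) * emeasure U UNIV"
    by (intro mult_right_mono ennreal_leI) auto
  also have "\<dots> = ennreal (?c\<^sup>2 * measure U (space U))"
    by (simp add: U.emeasure_eq_measure ennreal_mult)
  finally have c: "(\<integral>\<^sup>+u. ennreal ((\<tau> t)\<^sup>2) \<partial>U) \<le> ennreal (?c\<^sup>2 * measure U (space U))" by simp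
  have a0: "0 \<le> ?a" using model t
    by (intro cSUP_upper2[OF _ t]) (auto simp: model_ok_def mean_ok_def normsq_def)
  have b0: "0 \<le> ?b"
  proof -
    have "bdd_above ((\<lambda>z. \<bar>Gamma_X P (fst z) (snd z)\<bar>) ` (tdom P \<times> tdom P))"
      using Gamma by (intro bounded_imp_bdd_above compact_imp_bounded compact_continuous_image)
        (auto simp: Gamma_continuous_def split_beta' tdom_def compact_Times intro: continuous_on_rabs)
    then show ?thesis using t by (intro cSUP_upper2[OF _ SigmaI[OF t t]]) auto
  qed
  have "(\<integral>\<^sup>+u. ennreal ((\<mu> u t)\<^sup>2) + (\<integral>\<^sup>+x. ennreal ((eval_field (x, u, t))\<^sup>2) \<partial>X) + ennreal ((\<tau> t)\<^sup>2) \<partial>U)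
      = (\<integral>\<^sup>+u. ennreal ((\<mu> u t)\<^sup>2) \<partial>U) + (\<integral>\<^sup>+u. (\<integral>\<^sup>+x. ennreal ((eval_field (x, u, t))\<^sup>2) \<partial>X) \<partial>U) + (\<integral>\<^sup>+u. ennreal ((\<tau> t)\<^sup>2) \<partial>U)"
    by (subst nn_integral_add, measurable)+
  also have "\<dots> \<le> ennreal ?a + ennreal ?b + ennreal (?c\<^sup>2 * measure U (space U))"
    using a b c by (intro add_mono)
  also have "\<dots> = ennreal (?a + ?b + ?c\<^sup>2 * measure U (space U))"
    using a0 b0 by (simp add: ennreal_plus)
  also have "?a + ?b + ?c\<^sup>2 * measure U (space U) = C1 P * (INF t\<in>tdom P. g t)"
    using g_min_pos unfolding C1_def by simp
  finally show ?thesis .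
qed

text \<open>With \<open>u\<close> integrated first, the bound of the preceding lemma is uniform in
  \<open>t\<close>. Its factor, the infimum of \<open>g\<close>, absorbs the remaining
  \<open>1 / g t\<close>, and the unit norm of the basis function leaves a bound independent of
  \<open>k\<close>.\<close>

lemma integrated_second_moment_le:
  assumes k: "1 \<le> k"
  shows "(\<integral>\<^sup>+u. (\<integral>\<^sup>+z. ennreal ((obs_term P k u z)\<^sup>2) \<partial>(X \<Otimes>\<^sub>M (time_law \<Otimes>\<^sub>M E))) \<partial>U) \<le> ennreal (C1 P)"
proof -
  note [measurable] = measurable_\<phi>[OF k]
  let ?gm = "INF t\<in>tdom P. g t"
  let ?f = "\<lambda>u t. ennreal ((\<mu> u t)\<^sup>2) + (\<integral>\<^sup>+x. ennreal ((eval_field (x, u, t))\<^sup>2) \<partial>X) + ennreal ((\<tau> t)\<^sup>2)"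
  have "(\<integral>\<^sup>+u. (\<integral>\<^sup>+z. ennreal ((obs_term P k u z)\<^sup>2) \<partial>(X \<Otimes>\<^sub>M (time_law \<Otimes>\<^sub>M E))) \<partial>U)
      \<le> (\<integral>\<^sup>+u. (\<integral>\<^sup>+t. ?f u t * ennreal ((\<phi> k t)\<^sup>2 / g t) \<partial>T) \<partial>U)"
    by (intro nn_integral_mono second_moment_le k)
  also have "\<dots> = (\<integral>\<^sup>+t. (\<integral>\<^sup>+u. ?f u t * ennreal ((\<phi> k t)\<^sup>2 / g t) \<partial>U) \<partial>T)"
    by (subst UT.Fubini') auto
  also have "\<dots> \<le> (\<integral>\<^sup>+t. ennreal (C1 P) * ennreal ((\<phi> k t)\<^sup>2) \<partial>T)"
  proof (rule nn_integral_mono)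
    fix t assume "t \<in> space T"
    then have t: "t \<in> tdom P" and [measurable]: "t \<in> space T" by simp_all
    have "(\<integral>\<^sup>+u. ?f u t * ennreal ((\<phi> k t)\<^sup>2 / g t) \<partial>U) = (\<integral>\<^sup>+u. ?f u t \<partial>U) * ennreal ((\<phi> k t)\<^sup>2 / g t)"
      by (rule nn_integral_multc) measurable
    also have "\<dots> \<le> ennreal (C1 P * ?gm) * ennreal ((\<phi> k t)\<^sup>2 / g t)"
      by (intro mult_right_mono nn_integral_U_second_moments_le t) simp
    also have "\<dots> = ennreal (C1 P * ?gm * ((\<phi> k t)\<^sup>2 / g t))"
      using C1_pos g_min_pos g_pos[OF t] by (intro ennreal_mult[symmetric]) auto
    also have "\<dots> \<le> ennreal (C1 P * (\<phi> k t)\<^sup>2)"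
    proof (intro ennreal_leI)
      have "?gm * ((\<phi> k t)\<^sup>2 / g t) \<le> g t * ((\<phi> k t)\<^sup>2 / g t)"
        using g_min_le[OF t] g_pos[OF t] by (intro mult_right_mono) auto
      also have "\<dots> = (\<phi> k t)\<^sup>2" using g_pos[OF t] by simp
      finally show "C1 P * ?gm * ((\<phi> k t)\<^sup>2 / g t) \<le> C1 P * (\<phi> k t)\<^sup>2"
        unfolding mult.assoc using C1_pos by (intro mult_left_mono) auto
    qed
    also have "\<dots> = ennreal (C1 P) * ennreal ((\<phi> k t)\<^sup>2)" using C1_pos by (intro ennreal_mult) auto
    finally show "(\<integral>\<^sup>+u. ?f u t * ennreal ((\<phi> k t)\<^sup>2 / g t) \<partial>U) \<le> ennreal (C1 P) * ennreal ((\<phi> k t)\<^sup>2)" .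
  qed
  also have "\<dots> = ennreal (C1 P) * (\<integral>\<^sup>+t. ennreal ((\<phi> k t)\<^sup>2) \<partial>T)" by (rule nn_integral_cmult) measurable
  also have "(\<integral>\<^sup>+t. ennreal ((\<phi> k t)\<^sup>2) \<partial>T) = ennreal (\<integral>t. (\<phi> k t)\<^sup>2 \<partial>T)"
    using L2_basis[OF basis k] by (intro nn_integral_eq_integral) (auto simp: L2_def)
  also have "(\<integral>t. (\<phi> k t)\<^sup>2 \<partial>T) = 1"
    using integral_basis_mult[OF basis k k] by (simp add: power2_eq_square)
  finally show ?thesis by simp
qed

section \<open>Integrability and moments at almost every point of \<open>\<U>\<close>\<close>

definition good_point :: "'u \<Rightarrow> bool" where
  "good_point u \<longleftrightarrow> L2 T (\<mu> u) \<and> integrable (X \<Otimes>\<^sub>M T) (\<lambda>z. (eval_field (fst z, u, snd z))\<^sup>2) \<and>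
     (\<forall>k\<ge>1. integrable (X \<Otimes>\<^sub>M (time_law \<Otimes>\<^sub>M E)) (\<lambda>z. (obs_term P k u z)\<^sup>2))"

definition field_energy :: "'u \<Rightarrow> real" where
  "field_energy u = (\<integral>z. (eval_field (fst z, u, snd z))\<^sup>2 \<partial>(X \<Otimes>\<^sub>M T))"

definition second_moment :: "nat \<Rightarrow> 'u \<Rightarrow> real" where
  "second_moment k u = (\<integral>z. (obs_term P k u z)\<^sup>2 \<partial>(X \<Otimes>\<^sub>M (time_law \<Otimes>\<^sub>M E)))"

definition field_coef_var :: "nat \<Rightarrow> 'u \<Rightarrow> real" where
  "field_coef_var k u = (\<integral>x. (\<integral>t. eval_field (x, u, t) * \<phi> k t \<partial>T)\<^sup>2 \<partial>X)"

lemma integrable_mean_sq: "integrable (U \<Otimes>\<^sub>M T) (\<lambda>z. (\<mu> (fst z) (snd z))\<^sup>2)"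
  using model by (simp add: model_ok_def mean_ok_def L2_def UT_def split_beta')

lemma integrable_field_sq: "integrable (X \<Otimes>\<^sub>M (U \<Otimes>\<^sub>M T)) (\<lambda>z. (eval_field z)\<^sup>2)"
  using model by (simp add: model_ok_def field_ok_def UT_def split_beta' eval_field_def)

lemma AE_mean_L2: "AE u in U. L2 T (\<mu> u)"
proof -
  have "AE u in U. integrable T (\<lambda>t. (\<mu> u t)\<^sup>2)"
    using UT.AE_integrable_fst'[OF integrable_mean_sq] by simp
  moreover have "\<mu> u \<in> borel_measurable T" for u
    using measurable_\<mu>'[of "\<lambda>_. u" T "\<lambda>t. t"] by simp
  ultimately show ?thesis by (simp add: L2_def)
qed

text \<open>\<open>C2\<close> integrates over the paths last, while the pointwise analysis needs
  \<open>u\<close> outermost; Tonelli's theorem reconciles the two orders.\<close>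

lemma field_energy_integral:
  "(\<integral>\<^sup>+u. (\<integral>\<^sup>+z. ennreal ((eval_field (fst z, u, snd z))\<^sup>2) \<partial>(X \<Otimes>\<^sub>M T)) \<partial>U) = ennreal (C2 P)"
proof -
  interpret XUT: pair_sigma_finite X "U \<Otimes>\<^sub>M T" ..
  have "(\<integral>\<^sup>+u. (\<integral>\<^sup>+z. ennreal ((eval_field (fst z, u, snd z))\<^sup>2) \<partial>(X \<Otimes>\<^sub>M T)) \<partial>U)
      = (\<integral>\<^sup>+u. (\<integral>\<^sup>+x. (\<integral>\<^sup>+t. ennreal ((eval_field (x, u, t))\<^sup>2) \<partial>T) \<partial>X) \<partial>U)"
    by (intro nn_integral_cong) (subst T.nn_integral_fst[symmetric], auto)
  also have "\<dots> = (\<integral>\<^sup>+x. (\<integral>\<^sup>+u. (\<integral>\<^sup>+t. ennreal ((eval_field (x, u, t))\<^sup>2) \<partial>T) \<partial>U) \<partial>X)"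
    by (subst XU.Fubini') auto
  also have "\<dots> = (\<integral>\<^sup>+x. (\<integral>\<^sup>+z. ennreal ((eval_field (x, z))\<^sup>2) \<partial>(U \<Otimes>\<^sub>M T)) \<partial>X)"
    by (intro nn_integral_cong) (subst T.nn_integral_fst[symmetric], auto)
  also have "\<dots> = (\<integral>\<^sup>+z. ennreal ((eval_field z)\<^sup>2) \<partial>(X \<Otimes>\<^sub>M (U \<Otimes>\<^sub>M T)))"
    by (subst UT.nn_integral_fst[symmetric]) auto
  also have "\<dots> = ennreal (\<integral>z. (eval_field z)\<^sup>2 \<partial>(X \<Otimes>\<^sub>M (U \<Otimes>\<^sub>M T)))"
    by (rule nn_integral_eq_integral[OF integrable_field_sq]) simp
  also have "(\<integral>z. (eval_field z)\<^sup>2 \<partial>(X \<Otimes>\<^sub>M (U \<Otimes>\<^sub>M T))) = C2 P"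
    unfolding XUT.integral_fst'[OF integrable_field_sq, symmetric]
    by (simp add: C2_def normsq_def UT_def eval_field_def split_beta')
  finally show ?thesis .
qed

text \<open>It turns a finite iterated extended integral into statements on real integrals, and is
  used both for the energy of the field and for the second moments of single terms.\<close>

lemma AE_finite_nn_integral:
  assumes f: "(\<lambda>(u, z). f u z :: real) \<in> borel_measurable (U \<Otimes>\<^sub>M N)" and N: "sigma_finite_measure N"
    and le: "(\<integral>\<^sup>+u. (\<integral>\<^sup>+z. ennreal ((f u z)\<^sup>2) \<partial>N) \<partial>U) < \<infinity>"
  shows "AE u in U. integrable N (\<lambda>z. (f u z)\<^sup>2)"
    and "integrable U (\<lambda>u. \<integral>z. (f u z)\<^sup>2 \<partial>N)"
    and "ennreal (\<integral>u. (\<integral>z. (f u z)\<^sup>2 \<partial>N) \<partial>U) = (\<integral>\<^sup>+u. (\<integral>\<^sup>+z. ennreal ((f u z)\<^sup>2) \<partial>N) \<partial>U)"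
proof -
  interpret N: sigma_finite_measure N by fact
  interpret UN: pair_sigma_finite U N ..
  have [measurable]: "(\<lambda>z. f (fst z) (snd z)) \<in> borel_measurable (U \<Otimes>\<^sub>M N)" using f by (simp add: split_beta')
  have nn: "(\<integral>\<^sup>+z. ennreal ((f (fst z) (snd z))\<^sup>2) \<partial>(U \<Otimes>\<^sub>M N)) = (\<integral>\<^sup>+u. (\<integral>\<^sup>+z. ennreal ((f u z)\<^sup>2) \<partial>N) \<partial>U)"
    by (subst N.nn_integral_fst[symmetric]) auto
  have i: "integrable (U \<Otimes>\<^sub>M N) (\<lambda>z. (f (fst z) (snd z))\<^sup>2)"
    using le by (intro integrableI_bounded) (auto simp: nn)
  show "AE u in U. integrable N (\<lambda>z. (f u z)\<^sup>2)" "integrable U (\<lambda>u. \<integral>z. (f u z)\<^sup>2 \<partial>N)"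
    using UN.AE_integrable_fst'[OF i] UN.integrable_fst'[OF i] by simp_all
  show "ennreal (\<integral>u. (\<integral>z. (f u z)\<^sup>2 \<partial>N) \<partial>U) = (\<integral>\<^sup>+u. (\<integral>\<^sup>+z. ennreal ((f u z)\<^sup>2) \<partial>N) \<partial>U)"
    using UN.integral_fst'[OF i] nn nn_integral_eq_integral[OF i] by simp
qed

lemma
  shows AE_field_energy: "AE u in U. integrable (X \<Otimes>\<^sub>M T) (\<lambda>z. (eval_field (fst z, u, snd z))\<^sup>2)"
    and integrable_field_energy: "integrable U field_energy"
    and integral_field_energy: "(\<integral>u. field_energy u \<partial>U) = C2 P"
proof -
  note * = AE_finite_nn_integral[of "\<lambda>u z. eval_field (fst z, u, snd z)" "X \<Otimes>\<^sub>M T", OF _ XT.sigma_finite_measure_axioms, unfolded field_energy_integral]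
  show "AE u in U. integrable (X \<Otimes>\<^sub>M T) (\<lambda>z. (eval_field (fst z, u, snd z))\<^sup>2)"
    by (rule *) auto
  show "integrable U field_energy" unfolding field_energy_def[abs_def] by (rule *) auto
  have "ennreal (\<integral>u. field_energy u \<partial>U) = ennreal (C2 P)"
    unfolding field_energy_def by (rule *) auto
  moreover have "0 \<le> (\<integral>u. field_energy u \<partial>U)" by (simp add: field_energy_def)
  ultimately show "(\<integral>u. field_energy u \<partial>U) = C2 P" by (simp add: C2_nonneg)
qed

lemma
  assumes k: "1 \<le> k"
  shows AE_second_moment: "AE u in U. integrable (X \<Otimes>\<^sub>M (time_law \<Otimes>\<^sub>M E)) (\<lambda>z. (obs_term P k u z)\<^sup>2)"
    and integrable_second_moment: "integrable U (second_moment k)"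
    and integral_second_moment_le: "(\<integral>u. second_moment k u \<partial>U) \<le> C1 P"
proof -
  note [measurable (raw)] = measurable_obs_term[OF k]
  note * = AE_finite_nn_integral[of "obs_term P k" "X \<Otimes>\<^sub>M (time_law \<Otimes>\<^sub>M E)", OF _ Xte.P.sigma_finite_measure_axioms]
  have m: "(\<lambda>(u, z). obs_term P k u z) \<in> borel_measurable (U \<Otimes>\<^sub>M (X \<Otimes>\<^sub>M (time_law \<Otimes>\<^sub>M E)))" by measurable
  have fin: "(\<integral>\<^sup>+u. (\<integral>\<^sup>+z. ennreal ((obs_term P k u z)\<^sup>2) \<partial>(X \<Otimes>\<^sub>M (time_law \<Otimes>\<^sub>M E))) \<partial>U) < \<infinity>"
    using integrated_second_moment_le[OF k] by (auto intro: le_less_trans)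
  show "AE u in U. integrable (X \<Otimes>\<^sub>M (time_law \<Otimes>\<^sub>M E)) (\<lambda>z. (obs_term P k u z)\<^sup>2)"
    by (rule *(1)[OF m fin])
  show "integrable U (second_moment k)"
    unfolding second_moment_def[abs_def] by (rule *(2)[OF m fin])
  have "ennreal (\<integral>u. second_moment k u \<partial>U) \<le> ennreal (C1 P)"
    unfolding second_moment_def *(3)[OF m fin] by (rule integrated_second_moment_le[OF k])
  then show "(\<integral>u. second_moment k u \<partial>U) \<le> C1 P" using C1_pos by (simp add: ennreal_le_iff)
qed

text \<open>One null set has to serve every \<open>k\<close>; this is possible because the basis is
  countable.\<close>

lemma AE_good_point: "AE u in U. good_point u"
proof -
  have "AE u in U. \<forall>k. 1 \<le> k \<longrightarrow> integrable (X \<Otimes>\<^sub>M (time_law \<Otimes>\<^sub>M E)) (\<lambda>z. (obs_term P k u z)\<^sup>2)"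
    unfolding AE_all_countable using AE_second_moment by auto
  then show ?thesis using AE_mean_L2 AE_field_energy
    by eventually_elim (simp add: good_point_def)
qed


definition field_coef :: "nat \<Rightarrow> 'u \<Rightarrow> ('u \<Rightarrow> real \<Rightarrow> real) \<Rightarrow> real" where
  "field_coef k u x = (\<integral>t. eval_field (x, u, t) * \<phi> k t \<partial>T)"

lemma measurable_field_coef [measurable]: "1 \<le> k \<Longrightarrow> field_coef k u \<in> borel_measurable X"
  unfolding field_coef_def[abs_def] by measurable

context
  fixes u assumes good: "good_point u"
begin

lemma AE_field_L2: "AE x in X. L2 T (\<lambda>t. eval_field (x, u, t))"
proof -
  have "AE x in X. integrable T (\<lambda>t. (eval_field (x, u, t))\<^sup>2)"
    using XT.AE_integrable_fst'[of "\<lambda>z. (eval_field (fst z, u, snd z))\<^sup>2"] good by (simp add: good_point_def)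
  then show ?thesis using AE_space by eventually_elim (simp add: L2_def)
qed

lemma field_energy_fst:
  "integrable X (\<lambda>x. normsq T (\<lambda>t. eval_field (x, u, t)))" "(\<integral>x. normsq T (\<lambda>t. eval_field (x, u, t)) \<partial>X) = field_energy u"
  using XT.integrable_fst'[of "\<lambda>z. (eval_field (fst z, u, snd z))\<^sup>2"] XT.integral_fst'[of "\<lambda>z. (eval_field (fst z, u, snd z))\<^sup>2"] good
  by (simp_all add: good_point_def normsq_def field_energy_def)

lemma integrable_field_coef_sq:
  assumes k: "1 \<le> k"
  shows "integrable X (\<lambda>x. (field_coef k u x)\<^sup>2)"
proof (rule Bochner_Integration.integrable_bound[OF field_energy_fst(1)])
  show "AE x in X. norm ((field_coef k u x)\<^sup>2) \<le> norm (normsq T (\<lambda>t. eval_field (x, u, t)))"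
    using AE_field_L2
  proof eventually_elim
    case (elim x)
    then show ?case using bessel_inequality[OF basis elim, of "{k}"] k by (simp add: field_coef_def)
  qed
qed (use k in measurable)

lemma sum_field_coef_var_le:
  assumes A: "finite A" "A \<subseteq> {1..}"
  shows "(\<Sum>k\<in>A. field_coef_var k u) \<le> field_energy u"
proof -
  have "(\<Sum>k\<in>A. field_coef_var k u) = (\<integral>x. (\<Sum>k\<in>A. (field_coef k u x)\<^sup>2) \<partial>X)"
    unfolding field_coef_var_def field_coef_def[symmetric]
    by (rule Bochner_Integration.integral_sum[symmetric], rule integrable_field_coef_sq) (use A in auto)
  also have "\<dots> \<le> (\<integral>x. normsq T (\<lambda>t. eval_field (x, u, t)) \<partial>X)"
  proof (rule integral_mono_AE)
    show "integrable X (\<lambda>x. \<Sum>k\<in>A. (field_coef k u x)\<^sup>2)"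
      by (rule Bochner_Integration.integrable_sum, rule integrable_field_coef_sq) (use A in auto)
    show "AE x in X. (\<Sum>k\<in>A. (field_coef k u x)\<^sup>2) \<le> normsq T (\<lambda>t. eval_field (x, u, t))"
      using AE_field_L2
    proof eventually_elim
      case (elim x)
      then show ?case using bessel_inequality[OF basis elim A] by (simp add: field_coef_def)
    qed
  qed (rule field_energy_fst(1))
  finally show ?thesis by (simp add: field_energy_fst(2))
qed

text \<open>Fubini moves the expectation under the integral over \<open>t\<close>, where the field
  is centred at every time. Hence the second moment \<open>field_coef_var\<close> really is a
  variance.\<close>

lemma integral_field_coef:
  assumes k: "1 \<le> k"
  shows "integrable X (field_coef k u)" "(\<integral>x. field_coef k u x \<partial>X) = 0"
proof -
  show i: "integrable X (field_coef k u)"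
    using X.finite_measure_axioms measurable_field_coef[OF k] integrable_field_coef_sq[OF k]
    by (rule integrable_square_imp_integrable)
  note [measurable] = measurable_\<phi>[OF k]
  have "integrable (X \<Otimes>\<^sub>M T) (\<lambda>z. (\<phi> k (snd z))\<^sup>2)"
    using L2_basis[OF basis k] by (intro XT.Fubini_integrable) (auto simp: L2_def)
  then have int: "integrable (X \<Otimes>\<^sub>M T) (\<lambda>z. eval_field (fst z, u, snd z) * \<phi> k (snd z))"
    using good by (intro integrable_mult_L2) (auto simp: good_point_def)
  have "(\<integral>x. field_coef k u x \<partial>X) = (\<integral>z. eval_field (fst z, u, snd z) * \<phi> k (snd z) \<partial>(X \<Otimes>\<^sub>M T))"
    using XT.integral_fst'[OF int] by (simp add: field_coef_def)
  also have "\<dots> = (\<integral>t. (\<integral>x. eval_field (x, u, t) * \<phi> k t \<partial>X) \<partial>T)"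
    using XT.integral_snd[of "\<lambda>x t. eval_field (x, u, t) * \<phi> k t"] int by (simp add: split_beta')
  also have "\<dots> = (\<integral>t. 0 \<partial>T)"
  proof (rule Bochner_Integration.integral_cong[OF refl])
    fix t assume "t \<in> space T"
    then have "(\<integral>x. eval_field (x, u, t) \<partial>X) = 0" using field_mean_zero(2)[of t u] by (simp add: eval_field_def)
    then show "(\<integral>x. eval_field (x, u, t) * \<phi> k t \<partial>X) = 0" by simp
  qed
  finally show "(\<integral>x. field_coef k u x \<partial>X) = 0" by simp
qed

text \<open>With the path fixed, the noise averages out and the density cancels
  \<open>1 / g\<close>, which leaves the Fourier coefficient of mean plus path. Exceptional paths
  are those whose section at \<open>u\<close> is not square integrable in time, or for which the
  term is not integrable.\<close>

lemma AE_conditional_mean: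
  assumes k: "1 \<le> k"
  shows "AE x in X. integrable (time_law \<Otimes>\<^sub>M E) (\<lambda>s. obs_term P k u (x, s))"
    and "AE x in X. (\<integral>s. obs_term P k u (x, s) \<partial>(time_law \<Otimes>\<^sub>M E)) = \<beta> k u + field_coef k u x"
proof -
  note [measurable (raw)] = measurable_obs_term[OF k]
  note [measurable] = measurable_\<phi>[OF k]
  have "AE x in X. integrable (time_law \<Otimes>\<^sub>M E) (\<lambda>s. (obs_term P k u (x, s))\<^sup>2)"
    using Xte.AE_integrable_fst'[of "\<lambda>z. (obs_term P k u z)\<^sup>2"] good k by (simp add: good_point_def)
  then show AE: "AE x in X. integrable (time_law \<Otimes>\<^sub>M E) (\<lambda>s. obs_term P k u (x, s))"
    using AE_space
  proof eventually_elim
    case (elim x)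
    then show ?case by (rule_tac integrable_square_imp_integrable[OF te.P.finite_measure_axioms]) auto
  qed
  show "AE x in X. (\<integral>s. obs_term P k u (x, s) \<partial>(time_law \<Otimes>\<^sub>M E)) = \<beta> k u + field_coef k u x"
    using AE AE_field_L2 AE_space
  proof eventually_elim
    case (elim x)
    have x [measurable]: "x \<in> space X" by fact
    have mu: "L2 T (\<mu> u)" using good by (simp add: good_point_def)
    have i: "integrable T (\<lambda>t. \<mu> u t * \<phi> k t)" "integrable T (\<lambda>t. eval_field (x, u, t) * \<phi> k t)"
      by (rule L2_mult_integrable[OF mu L2_basis[OF basis k]], rule L2_mult_integrable[OF elim(2) L2_basis[OF basis k]])
    have "(\<integral>s. obs_term P k u (x, s) \<partial>(time_law \<Otimes>\<^sub>M E)) = (\<integral>t. (\<integral>e. obs_term P k u (x, t, e) \<partial>E) \<partial>time_law)"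
      using te.integral_fst'[OF elim(1)] by simp
    also have "\<dots> = (\<integral>t. (\<mu> u t + eval_field (x, u, t)) * (\<phi> k t / g t) \<partial>time_law)"
      using noise_moments(1,2)[of u]
      by (intro Bochner_Integration.integral_cong refl) (simp add: obs_term_def eval_field_def E.prob_space)
    also have "\<dots> = (\<integral>t. g t *\<^sub>R ((\<mu> u t + eval_field (x, u, t)) * (\<phi> k t / g t)) \<partial>T)"
      unfolding time_law_def by (rule integral_density) (auto intro!: AE_I2 less_imp_le g_pos)
    also have "\<dots> = (\<integral>t. \<mu> u t * \<phi> k t + eval_field (x, u, t) * \<phi> k t \<partial>T)"
    proof (rule Bochner_Integration.integral_cong[OF refl])
      fix t assume "t \<in> space T"
      then show "g t *\<^sub>R ((\<mu> u t + eval_field (x, u, t)) * (\<phi> k t / g t)) = \<mu> u t * \<phi> k t + eval_field (x, u, t) * \<phi> k t"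
        using g_pos[of t] by (simp add: distrib_right)
    qed
    also have "\<dots> = \<beta> k u + field_coef k u x"
      using i by (simp add: mean_coef_def field_coef_def)
    finally show ?case .
  qed
qed

text \<open>All three parts come from the conditional mean given the path. The third is the mixed
  moment of two visits of one subject: the squared mean plus the variance of the shared field
  coefficient.\<close>

lemma integral_obs_term:
  assumes k: "1 \<le> k"
  shows "integrable (X \<Otimes>\<^sub>M (time_law \<Otimes>\<^sub>M E)) (obs_term P k u)"
    and "(\<integral>z. obs_term P k u z \<partial>(X \<Otimes>\<^sub>M (time_law \<Otimes>\<^sub>M E))) = \<beta> k u"
    and "(\<integral>x. (\<integral>s. obs_term P k u (x, s) \<partial>(time_law \<Otimes>\<^sub>M E))\<^sup>2 \<partial>X) = (\<beta> k u)\<^sup>2 + field_coef_var k u"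
proof -
  note [measurable (raw)] = measurable_obs_term[OF k]
  show int: "integrable (X \<Otimes>\<^sub>M (time_law \<Otimes>\<^sub>M E)) (obs_term P k u)"
    using good k by (rule_tac integrable_square_imp_integrable[OF Xte.P.finite_measure_axioms])
      (auto simp: good_point_def)
  have "(\<integral>z. obs_term P k u z \<partial>(X \<Otimes>\<^sub>M (time_law \<Otimes>\<^sub>M E))) = (\<integral>x. \<beta> k u + field_coef k u x \<partial>X)"
    unfolding Xte.integral_fst'[OF int, symmetric]
    using AE_conditional_mean(2)[OF k] measurable_field_coef[OF k] by (intro integral_cong_AE) auto
  also have "\<dots> = \<beta> k u"
    using integral_field_coef[OF k] by (simp add: X.prob_space)
  finally show "(\<integral>z. obs_term P k u z \<partial>(X \<Otimes>\<^sub>M (time_law \<Otimes>\<^sub>M E))) = \<beta> k u" .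
  have "(\<integral>x. (\<integral>s. obs_term P k u (x, s) \<partial>(time_law \<Otimes>\<^sub>M E))\<^sup>2 \<partial>X) = (\<integral>x. (\<beta> k u + field_coef k u x)\<^sup>2 \<partial>X)"
    using AE_conditional_mean(2)[OF k] measurable_field_coef[OF k] by (intro integral_cong_AE) auto
  also have "\<dots> = (\<integral>x. (\<beta> k u)\<^sup>2 + (field_coef k u x)\<^sup>2 + 2 * \<beta> k u * field_coef k u x \<partial>X)"
    by (simp add: power2_sum)
  also have "\<dots> = (\<beta> k u)\<^sup>2 + field_coef_var k u"
    using integral_field_coef[OF k] integrable_field_coef_sq[OF k]
    by (simp add: X.prob_space field_coef_var_def field_coef_def[symmetric])
  finally show "(\<integral>x. (\<integral>s. obs_term P k u (x, s) \<partial>(time_law \<Otimes>\<^sub>M E))\<^sup>2 \<partial>X) = (\<beta> k u)\<^sup>2 + field_coef_var k u" .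
qed

end

lemma
  assumes k: "1 \<le> k"
  shows integrable_mean_coef_sq: "integrable U (\<lambda>u. (\<beta> k u)\<^sup>2)"
    and mean_coef_measurable: "\<beta> k \<in> borel_measurable U"
proof -
  note [measurable] = measurable_\<phi>[OF k]
  show [measurable]: "\<beta> k \<in> borel_measurable U"
    unfolding mean_coef_def[abs_def] by measurable
  show "integrable U (\<lambda>u. (\<beta> k u)\<^sup>2)"
  proof (rule Bochner_Integration.integrable_bound)
    show "integrable U (\<lambda>u. normsq T (\<mu> u))"
      using UT.integrable_fst'[OF integrable_mean_sq] by (simp add: normsq_def)
    show "AE u in U. norm ((\<beta> k u)\<^sup>2) \<le> norm (normsq T (\<mu> u))"
      using AE_mean_L2
    proof eventually_elim
      case (elim u)
      then show ?case using bessel_inequality[OF basis elim, of "{k}"] k by (simp add: mean_coef_def)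
    qed
  qed measurable
qed

lemma integral_normsq_mean:
  "integrable U (\<lambda>u. normsq T (\<mu> u))" "(\<integral>u. normsq T (\<mu> u) \<partial>U) = mean_normsq P"
  using UT.integrable_fst'[OF integrable_mean_sq] UT.integral_fst'[OF integrable_mean_sq]
  by (simp_all add: normsq_def mean_normsq_def UT_def split_beta')

text \<open>Parseval's identity at almost every \<open>u\<close> is integrated by dominated
  convergence; Bessel's inequality supplies the dominating function
  \<open>normsq T (\<mu> u)\<close>.\<close>

lemma mean_coef_sums: "(\<lambda>K. \<Sum>k=1..K. normsq U (\<beta> k)) \<longlonglongrightarrow> mean_normsq P"
proof -
  have "(\<lambda>K. \<integral>u. (\<Sum>k=1..K. (\<beta> k u)\<^sup>2) \<partial>U) \<longlonglongrightarrow> (\<integral>u. normsq T (\<mu> u) \<partial>U)"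
  proof (rule integral_dominated_convergence[where w = "\<lambda>u. normsq T (\<mu> u)"])
    show "AE u in U. (\<lambda>K. \<Sum>k=1..K. (\<beta> k u)\<^sup>2) \<longlonglongrightarrow> normsq T (\<mu> u)"
      using AE_mean_L2
    proof eventually_elim
      case (elim u)
      then show ?case using parseval[OF basis elim] by (simp add: mean_coef_def)
    qed
    show "AE u in U. norm (\<Sum>k=1..K. (\<beta> k u)\<^sup>2) \<le> normsq T (\<mu> u)" for K
      using AE_mean_L2
    proof eventually_elim
      case (elim u)
      then show ?case using bessel_inequality[OF basis elim, of "{1..K}"]
        by (simp add: mean_coef_def abs_of_nonneg sum_nonneg subset_iff)
    qed
    show "(\<lambda>u. \<Sum>k=1..K. (\<beta> k u)\<^sup>2) \<in> borel_measurable U" for K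
      by (intro borel_measurable_sum borel_measurable_power mean_coef_measurable) simp
  qed (use integral_normsq_mean(1) in auto)
  moreover have "(\<integral>u. (\<Sum>k=1..K. (\<beta> k u)\<^sup>2) \<partial>U) = (\<Sum>k=1..K. normsq U (\<beta> k))" for K
    unfolding normsq_def by (rule Bochner_Integration.integral_sum) (simp add: integrable_mean_coef_sq)
  ultimately show ?thesis by (simp add: integral_normsq_mean(2))
qed

text \<open>Every tail index satisfies \<open>k \<ge> K\<close>, so its term may be multiplied by
  \<open>(k / K) powr (2 * s) \<ge> 1\<close>. Only this property links \<open>J\<close> to the real
  level \<open>K\<close>. Finite tails are bounded first, and the limit in the upper end gives the
  full tail.\<close>

lemma bias_le:
  assumes smooth: "mean_smooth P s Cs" and s: "0 < s" and K: "0 < K" and J: "\<And>k. J < k \<Longrightarrow> K \<le> real k"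
  shows "mean_normsq P - (\<Sum>k=1..J. normsq U (\<beta> k)) \<le> Cs * K powr (- 2 * s)"
proof -
  have nn: "0 \<le> normsq U (\<beta> k)" for k by (simp add: normsq_def)
  have "(\<Sum>k=1..L. normsq U (\<beta> k)) - (\<Sum>k=1..J. normsq U (\<beta> k)) \<le> Cs * K powr (- 2 * s)" if L: "J \<le> L" for L
  proof -
    have "(\<Sum>k=1..L. normsq U (\<beta> k)) - (\<Sum>k=1..J. normsq U (\<beta> k)) = (\<Sum>k\<in>{Suc J..L}. normsq U (\<beta> k))"
    proof -
      have "{1..L} = {1..J} \<union> {Suc J..L}" using L by auto
      then show ?thesis by (simp add: sum.union_disjoint)
    qed
    also have "\<dots> \<le> (\<Sum>k\<in>{Suc J..L}. K powr (- 2 * s) * (real k powr (2 * s) * normsq U (\<beta> k)))"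
    proof (rule sum_mono)
      fix k assume k: "k \<in> {Suc J..L}"
      have "1 = K powr (- 2 * s) * K powr (2 * s)" using K by (simp add: powr_add[symmetric])
      also have "\<dots> \<le> K powr (- 2 * s) * real k powr (2 * s)"
        using J[of k] k K s by (intro mult_left_mono powr_mono2) auto
      finally have "1 * normsq U (\<beta> k) \<le> K powr (- 2 * s) * real k powr (2 * s) * normsq U (\<beta> k)"
        using nn by (intro mult_right_mono)
      then show "normsq U (\<beta> k) \<le> K powr (- 2 * s) * (real k powr (2 * s) * normsq U (\<beta> k))"
        by (simp add: mult.assoc)
    qed
    also have "\<dots> = K powr (- 2 * s) * (\<Sum>k\<in>{Suc J..L}. real k powr (2 * s) * normsq U (\<beta> k))"
      by (simp add: sum_distrib_left)
    also have "\<dots> \<le> K powr (- 2 * s) * (\<Sum>\<^sub>\<infinity>k\<in>{1..}. real k powr (2 * s) * normsq U (\<beta> k))"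
      using smooth nn by (intro mult_left_mono finite_sum_le_infsum) (auto simp: mean_smooth_def)
    also have "\<dots> \<le> K powr (- 2 * s) * Cs"
      using smooth by (intro mult_left_mono) (auto simp: mean_smooth_def)
    finally show ?thesis by (simp add: mult.commute)
  qed
  then have "eventually (\<lambda>L. (\<Sum>k=1..L. normsq U (\<beta> k)) - (\<Sum>k=1..J. normsq U (\<beta> k)) \<le> Cs * K powr (- 2 * s)) sequentially"
    by (auto simp: eventually_sequentially)
  with tendsto_diff[OF mean_coef_sums tendsto_const] show ?thesis
    by (rule tendsto_upperbound) simp
qed

end

section \<open>The risk of a sample\<close>

text \<open>It allows subject indices to be replaced by pairs, so that times, fields and noises can
  share one index type.\<close>

lemma (in prob_space) indep_sets_reindex:
  assumes f: "inj_on f I" and G: "indep_sets G (f ` I)"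
  shows "indep_sets (\<lambda>i. G (f i)) I"
proof (rule indep_setsI)
  fix A J assume J: "J \<noteq> {}" "J \<subseteq> I" "finite J" and A: "\<forall>j\<in>J. A j \<in> G (f j)"
  have inv: "inv_into I f (f j) = j" if "j \<in> J" for j using f J(2) that by (auto intro: inv_into_f_f)
  have "prob (\<Inter>i\<in>f ` J. A (inv_into I f i)) = (\<Prod>i\<in>f ` J. prob (A (inv_into I f i)))"
    using J A inv by (intro indep_setsD[OF G]) auto
  moreover have "(\<Prod>i\<in>f ` J. prob (A (inv_into I f i))) = (\<Prod>j\<in>J. prob (A j))"
    using inv inj_on_subset[OF f J(2)] by (simp add: prod.reindex)
  ultimately show "prob (\<Inter>j\<in>J. A j) = (\<Prod>j\<in>J. prob (A j))" using inv by simp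
qed (use G in \<open>auto simp: indep_sets_def\<close>)

lemma Int_stable_vimages: "Int_stable {Z -` A \<inter> S | A. A \<in> sets N}"
proof (rule Int_stableI)
  fix a b assume "a \<in> {Z -` A \<inter> S | A. A \<in> sets N}" "b \<in> {Z -` A \<inter> S | A. A \<in> sets N}"
  then obtain A B where "A \<in> sets N" "B \<in> sets N" and "a \<inter> b = Z -` (A \<inter> B) \<inter> S" by auto
  then show "a \<inter> b \<in> {Z -` A \<inter> S | A. A \<in> sets N}" by blast
qed

lemma Int_stable_events_of: "Int_stable (events_of M N I Z)"
proof -
  have "sigma_algebra (space M) (events_of M N I Z)"
    unfolding events_of_def by (rule sigma_algebra_sigma_sets) auto
  then interpret sigma_algebra "space M" "events_of M N I Z" .
  show ?thesis by (rule Int_stableI) (rule Int)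
qed

locale fda_sampled = fda P for P :: "('u::{metric_space,second_countable_topology}) fda_model" +
  fixes n :: nat and m :: "nat \<Rightarrow> nat" and S :: "('w, 'u) fda_sample"
  assumes sample: "sample_ok P n m S"
begin

abbreviation \<Omega> where "\<Omega> \<equiv> prob_sp S"
abbreviation Q where "Q \<equiv> time_law \<Otimes>\<^sub>M E"
abbreviation tm where "tm \<equiv> \<lambda>(i, j). obs_time S i j"
abbreviation ns where "ns \<equiv> \<lambda>(i, j). obs_noise S i j"

text \<open>Time and noise are bundled because they are what a visit does not share with the other
  visits of its subject.\<close>

definition visit_draw :: "nat \<times> nat \<Rightarrow> 'w \<Rightarrow> real \<times> ('u \<Rightarrow> real)" where
  "visit_draw a \<omega> = (tm a \<omega>, ns a \<omega>)"

sublocale prob_space \<Omega>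
  using sample by (simp add: sample_ok_def)

definition gens :: "nat \<Rightarrow> nat \<times> nat \<Rightarrow> 'w set set" where
  "gens c a = (if c = 0 then {tm a -` A \<inter> space \<Omega> | A. A \<in> sets T}
    else if c = 1 then {subj_field S (fst a) -` A \<inter> space \<Omega> | A. A \<in> sets X}
    else {ns a -` A \<inter> space \<Omega> | A. A \<in> sets E})"

text \<open>Times, fields and noises are tagged \<open>0\<close>, \<open>1\<close>, \<open>2\<close>; the field of subject \<open>i\<close> has index \<open>(i, 0)\<close>.\<close>

definition gen_index :: "(nat \<times> nat \<times> nat) set" where
  "gen_index = Sigma {0, 1, 2} (\<lambda>c. if c = 1 then {1..n} \<times> {0} else visits n m)"

text \<open>The groups are independent as generated sigma-algebras \<open>events_of\<close>, which
  are intersection stable; inside a group, independence of the variables applies to the preimage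
  events. The two layers then merge.\<close>

lemma indep_gens: "indep_sets (\<lambda>(c, a). gens c a) gen_index"
  unfolding gen_index_def
proof (rule indep_sets_Sigma)
  let ?G = "\<lambda>c::nat. if c = 0 then events_of \<Omega> T (visits n m) tm
    else if c = 1 then events_of \<Omega> X {1..n} (subj_field S) else events_of \<Omega> E (visits n m) ns"
  show "indep_sets ?G {0, 1, 2}" using sample by (simp add: sample_ok_def)
  show "Int_stable (?G c)" for c by (simp add: Int_stable_events_of)
  fix c :: nat assume c: "c \<in> {0, 1, 2}"
  have X: "indep_sets (\<lambda>i. {subj_field S i -` A \<inter> space \<Omega> | A. A \<in> sets X}) {1..n}"
    using sample by (simp add: sample_ok_def indep_vars_def2)
  have "indep_sets (\<lambda>a::nat \<times> nat. {subj_field S (fst a) -` A \<inter> space \<Omega> | A. A \<in> sets X}) ({1..n} \<times> {0})"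
    by (rule indep_sets_reindex[where f = fst]) (use X in \<open>auto simp: inj_on_def\<close>)
  then show "indep_sets (gens c) (if c = 1 then {1..n} \<times> {0} else visits n m)"
    using sample c unfolding gens_def[abs_def] by (auto simp: sample_ok_def indep_vars_def2)
  show "gens c a \<subseteq> ?G c" if "a \<in> (if c = 1 then {1..n} \<times> {0} else visits n m)" for a
    using c that unfolding gens_def events_of_def
    by (auto split: if_splits intro!: sigma_sets.Basic) (metis atLeastAtMost_iff)
qed

lemma Int_stable_gens: "Int_stable (case z of (c, a) \<Rightarrow> gens c a)"
  by (simp add: gens_def Int_stable_vimages split: prod.split)

abbreviation gen_space where
  "gen_space K \<equiv> sigma (space \<Omega>) (\<Union>z\<in>K. case z of (c, a) \<Rightarrow> gens c a)"

lemma rv_time: "a \<in> visits n m \<Longrightarrow> tm a \<in> \<Omega> \<rightarrow>\<^sub>M T"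
  and rv_noise: "a \<in> visits n m \<Longrightarrow> ns a \<in> \<Omega> \<rightarrow>\<^sub>M E"
  and rv_field: "i \<in> {1..n} \<Longrightarrow> subj_field S i \<in> \<Omega> \<rightarrow>\<^sub>M X"
  using sample by (auto simp: sample_ok_def indep_vars_def2)

lemma measurable_gen_space:
  assumes "(c, a) \<in> K" "Z \<in> space \<Omega> \<rightarrow> space N" "gens c a = {Z -` A \<inter> space \<Omega> | A. A \<in> sets N}"
  shows "Z \<in> gen_space K \<rightarrow>\<^sub>M N"
proof -
  have sp: "(\<Union>z\<in>K. case z of (c, a) \<Rightarrow> gens c a) \<subseteq> Pow (space \<Omega>)"
    by (auto simp: gens_def split: if_splits)
  show ?thesis
  proof (rule measurableI)
    fix A assume "A \<in> sets N"
    then show "Z -` A \<inter> space (gen_space K) \<in> sets (gen_space K)"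
      unfolding sets_measure_of[OF sp] space_measure_of[OF sp] using assms
      by (intro sigma_sets.Basic) blast
  qed (use assms in \<open>auto simp: space_measure_of[OF sp]\<close>)
qed

lemma gen_time: "(0, a) \<in> K \<Longrightarrow> a \<in> visits n m \<Longrightarrow> tm a \<in> gen_space K \<rightarrow>\<^sub>M time_law"
  using measurable_gen_space[of 0 a K "tm a" T] measurable_space[OF rv_time[of a]]
  by (auto simp: gens_def measurable_cong_sets[OF refl sets_time_law])

lemma gen_noise: "(2, a) \<in> K \<Longrightarrow> a \<in> visits n m \<Longrightarrow> ns a \<in> gen_space K \<rightarrow>\<^sub>M E"
  using measurable_gen_space[of 2 a K "ns a" E] measurable_space[OF rv_noise[of a]]
  by (auto simp: gens_def)

lemma gen_field: "(1, i, 0) \<in> K \<Longrightarrow> i \<in> {1..n} \<Longrightarrow> subj_field S i \<in> gen_space K \<rightarrow>\<^sub>M X"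
  using measurable_gen_space[of 1 "(i, 0)" K "subj_field S i" X] measurable_space[OF rv_field[of i]]
  by (auto simp: gens_def)

lemma gen_draw:
  "(0, a) \<in> K \<Longrightarrow> (2, a) \<in> K \<Longrightarrow> a \<in> visits n m \<Longrightarrow> visit_draw a \<in> gen_space K \<rightarrow>\<^sub>M Q"
  unfolding visit_draw_def[abs_def] by (intro measurable_Pair gen_time gen_noise)

lemma rv_draw: "a \<in> visits n m \<Longrightarrow> visit_draw a \<in> \<Omega> \<rightarrow>\<^sub>M Q"
  unfolding visit_draw_def[abs_def]
  by (intro measurable_Pair) (auto simp: measurable_cong_sets[OF refl sets_time_law] rv_time rv_noise)

lemma law_time: "a \<in> visits n m \<Longrightarrow> distr \<Omega> time_law (tm a) = time_law"
proof -
  assume "a \<in> visits n m"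
  then have "distributed \<Omega> T (tm a) (\<lambda>t. ennreal (g t))" using sample by (auto simp: sample_ok_def)
  then have "distr \<Omega> T (tm a) = time_law" unfolding time_law_def by (rule distributed_distr_eq_density)
  moreover have "distr \<Omega> time_law (tm a) = distr \<Omega> T (tm a)" by (rule distr_cong) (simp_all add: sets_time_law)
  ultimately show ?thesis by simp
qed

lemma law_noise: "a \<in> visits n m \<Longrightarrow> distr \<Omega> E (ns a) = E"
  using sample by (auto simp: sample_ok_def)

lemma law_field: "i \<in> {1..n} \<Longrightarrow> distr \<Omega> X (subj_field S i) = X"
  using sample by (auto simp: sample_ok_def)

lemma visitsD: "a \<in> visits n m \<Longrightarrow> fst a \<in> {1..n}"
  by (auto simp: visits_def)

lemma gen_index_mem:
  "a \<in> visits n m \<Longrightarrow> {(0, a), (2, a)} \<subseteq> gen_index" "i \<in> {1..n} \<Longrightarrow> {(1, i, 0)} \<subseteq> gen_index"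
  by (auto simp: gen_index_def)

section \<open>Product laws of fields and visits\<close>

lemmas law_Pair = distr_Pair_generators[OF indep_gens Int_stable_gens]

lemma law_draw: "a \<in> visits n m \<Longrightarrow> distr \<Omega> Q (visit_draw a) = Q"
  using law_Pair[of "{(0, a)}" "{(2, a)}" "tm a" time_law "ns a" E] gen_time[of a "{(0, a)}"] gen_noise[of a "{(2, a)}"]
    gen_index_mem(1)[of a]
  by (simp add: law_time law_noise visit_draw_def[abs_def])

lemma law_draw_draw:
  assumes "a \<in> visits n m" "b \<in> visits n m" "a \<noteq> b"
  shows "distr \<Omega> (Q \<Otimes>\<^sub>M Q) (\<lambda>\<omega>. (visit_draw a \<omega>, visit_draw b \<omega>)) = Q \<Otimes>\<^sub>M Q"
  using law_Pair[of "{(0, a), (2, a)}" "{(0, b), (2, b)}" "visit_draw a" Q "visit_draw b" Q]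
    gen_draw[of a "{(0, a), (2, a)}"] gen_draw[of b "{(0, b), (2, b)}"]
    gen_index_mem(1)[of a] gen_index_mem(1)[of b] assms
  by (simp add: law_draw)

lemma law_field_draw:
  assumes "i \<in> {1..n}" "a \<in> visits n m"
  shows "distr \<Omega> (X \<Otimes>\<^sub>M Q) (\<lambda>\<omega>. (subj_field S i \<omega>, visit_draw a \<omega>)) = X \<Otimes>\<^sub>M Q"
  using law_Pair[of "{(1, i, 0)}" "{(0, a), (2, a)}" "subj_field S i" X "visit_draw a" Q]
    gen_draw[of a "{(0, a), (2, a)}"] gen_field[of i "{(1, i, 0)}"]
    gen_index_mem(1)[of a] gen_index_mem(2)[of i] assms
  by (simp add: law_draw law_field)

text \<open>The two draws count as a single variable, generated by four times and noises, whose
  index set is disjoint from that of the field.\<close>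

lemma law_field_draw_draw:
  assumes "i \<in> {1..n}" "a \<in> visits n m" "b \<in> visits n m" "a \<noteq> b"
  shows "distr \<Omega> (X \<Otimes>\<^sub>M (Q \<Otimes>\<^sub>M Q)) (\<lambda>\<omega>. (subj_field S i \<omega>, visit_draw a \<omega>, visit_draw b \<omega>))
    = X \<Otimes>\<^sub>M (Q \<Otimes>\<^sub>M Q)"
proof -
  let ?K = "{(0, a), (2, a), (0, b), (2, b)}"
  have "(\<lambda>\<omega>. (visit_draw a \<omega>, visit_draw b \<omega>)) \<in> gen_space ?K \<rightarrow>\<^sub>M Q \<Otimes>\<^sub>M Q"
    using assms by (intro measurable_Pair gen_draw) auto
  then show ?thesis
    using law_Pair[of "{(1, i, 0)}" ?K "subj_field S i" X "\<lambda>\<omega>. (visit_draw a \<omega>, visit_draw b \<omega>)" "Q \<Otimes>\<^sub>M Q"]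
      gen_field[of i "{(1, i, 0)}"] gen_index_mem(1)[of a] gen_index_mem(1)[of b] gen_index_mem(2)[of i] assms
    by (simp add: law_draw_draw law_field)
qed

lemma law_two_subjects:
  assumes "i \<in> {1..n}" "i' \<in> {1..n}" "i \<noteq> i'" "a \<in> visits n m" "b \<in> visits n m" "a \<noteq> b"
  shows "distr \<Omega> ((X \<Otimes>\<^sub>M Q) \<Otimes>\<^sub>M (X \<Otimes>\<^sub>M Q))
      (\<lambda>\<omega>. ((subj_field S i \<omega>, visit_draw a \<omega>), (subj_field S i' \<omega>, visit_draw b \<omega>)))
    = (X \<Otimes>\<^sub>M Q) \<Otimes>\<^sub>M (X \<Otimes>\<^sub>M Q)"
proof -
  let ?K = "{(1, i, 0), (0, a), (2, a)}" and ?L = "{(1, i', 0), (0, b), (2, b)}"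
  have "(\<lambda>\<omega>. (subj_field S i \<omega>, visit_draw a \<omega>)) \<in> gen_space ?K \<rightarrow>\<^sub>M X \<Otimes>\<^sub>M Q"
      "(\<lambda>\<omega>. (subj_field S i' \<omega>, visit_draw b \<omega>)) \<in> gen_space ?L \<rightarrow>\<^sub>M X \<Otimes>\<^sub>M Q"
    using assms by (intro measurable_Pair gen_draw gen_field; auto)+
  then show ?thesis
    using law_Pair[of ?K ?L "\<lambda>\<omega>. (subj_field S i \<omega>, visit_draw a \<omega>)" "X \<Otimes>\<^sub>M Q"
        "\<lambda>\<omega>. (subj_field S i' \<omega>, visit_draw b \<omega>)" "X \<Otimes>\<^sub>M Q"]
      gen_index_mem(1)[of a] gen_index_mem(1)[of b] gen_index_mem(2)[of i] gen_index_mem(2)[of i'] assms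
    by (simp add: law_field_draw)
qed

section \<open>Mean square error of one estimated coefficient\<close>

definition summand :: "nat \<Rightarrow> 'u \<Rightarrow> nat \<times> nat \<Rightarrow> 'w \<Rightarrow> real" where
  "summand k u a \<omega> = obs_term P k u (subj_field S (fst a) \<omega>, visit_draw a \<omega>)"

lemma coef_hat_eq: "coef_hat P n m S w k \<omega> u = (\<Sum>a\<in>visits n m. w (fst a) (snd a) * summand k u a \<omega>)"
  unfolding coef_hat_def visits_def
  by (subst sum.Sigma) (auto simp: summand_def visit_draw_def obs_term_def obs_Y_def split_beta mult.assoc intro!: sum.cong)

lemma measurable_draw_pair: "a \<in> visits n m \<Longrightarrow> (\<lambda>\<omega>. (subj_field S (fst a) \<omega>, visit_draw a \<omega>)) \<in> \<Omega> \<rightarrow>\<^sub>M X \<Otimes>\<^sub>M Q"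
  by (intro measurable_Pair rv_field rv_draw visitsD)

lemma measurable_summand:
  assumes "1 \<le> k" "a \<in> visits n m"
  shows "(\<lambda>(u, \<omega>). summand k u a \<omega>) \<in> borel_measurable (U \<Otimes>\<^sub>M \<Omega>)"
    and "summand k u a \<in> borel_measurable \<Omega>"
proof -
  note [measurable (raw)] = measurable_obs_term[OF assms(1)]
  note [measurable] = measurable_draw_pair[OF assms(2)]
  show "(\<lambda>(u, \<omega>). summand k u a \<omega>) \<in> borel_measurable (U \<Otimes>\<^sub>M \<Omega>)" unfolding summand_def by measurable
  show "summand k u a \<in> borel_measurable \<Omega>" unfolding summand_def[abs_def] by measurable
qed

text \<open>The general formula for weighted sums applies with
  \<open>d = field_coef_var k u\<close>. Two visits of one subject are handled by conditioning on
  the shared field; for different subjects the joint law is a product of two copies of one law, and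
  the expectation factors.\<close>

lemma mean_square_error_coef:
  assumes good: "good_point u" and k: "1 \<le> k" and w: "(\<Sum>i=1..n. \<Sum>j=1..m i. w i j) = 1"
  shows "integrable \<Omega> (\<lambda>\<omega>. (coef_hat P n m S w k \<omega> u - \<beta> k u)\<^sup>2)"
    and "expectation (\<lambda>\<omega>. (coef_hat P n m S w k \<omega> u - \<beta> k u)\<^sup>2)
      = sq_weights n m w * (second_moment k u - (\<beta> k u)\<^sup>2) + cross_weights n m w * field_coef_var k u"
proof -
  note [measurable (raw)] = measurable_obs_term[OF k]
  let ?f = "obs_term P k u" and ?V = "visits n m" and ?w = "\<lambda>a. w (fst a) (snd a)"
  have f2: "integrable (X \<Otimes>\<^sub>M Q) (\<lambda>z. (?f z)\<^sup>2)" using good k by (simp add: good_point_def)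
  have law: "distr \<Omega> (X \<Otimes>\<^sub>M Q) (\<lambda>\<omega>. (subj_field S (fst a) \<omega>, visit_draw a \<omega>)) = X \<Otimes>\<^sub>M Q" if "a \<in> ?V" for a
    using that by (intro law_field_draw visitsD)
  have fin: "finite ?V" by (auto simp: visits_def)
  have int: "integrable \<Omega> (\<lambda>\<omega>. (summand k u a \<omega>)\<^sup>2)" if a: "a \<in> ?V" for a
    using integrable_distr[OF measurable_draw_pair[OF a], of "\<lambda>z. (?f z)\<^sup>2"] f2 law[OF a]
    by (simp add: summand_def)
  have mean: "expectation (summand k u a) = \<beta> k u" if a: "a \<in> ?V" for a
    using integral_distr[OF measurable_draw_pair[OF a], of ?f] law[OF a] integral_obs_term(2)[OF good k]
    by (simp add: summand_def[abs_def])
  have sq: "expectation (\<lambda>\<omega>. (summand k u a \<omega>)\<^sup>2) = second_moment k u" if a: "a \<in> ?V" for a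
    using integral_distr[OF measurable_draw_pair[OF a], of "\<lambda>z. (?f z)\<^sup>2"] law[OF a]
    by (simp add: summand_def[abs_def] second_moment_def)
  have same: "expectation (\<lambda>\<omega>. summand k u a \<omega> * summand k u b \<omega>) = (\<beta> k u)\<^sup>2 + field_coef_var k u"
    if ab: "a \<in> ?V" "b \<in> ?V" "a \<noteq> b" "fst a = fst b" for a b
  proof -
    have b: "fst b \<in> {1..n}" using ab(2) by (rule visitsD)
    have "?f \<in> borel_measurable (X \<Otimes>\<^sub>M Q)" by measurable
    note expectation_shared_effect[OF rv_field[OF b] rv_draw[OF ab(1)] rv_draw[OF ab(2)] law_field[OF b]
        law_draw_draw[OF ab(1-3)] law_field_draw_draw[OF b ab(1-3)]
        law_field_draw[OF b ab(1)] law_field_draw[OF b ab(2)] law_draw[OF ab(1)] this f2]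
    then have "expectation (\<lambda>\<omega>. summand k u a \<omega> * summand k u b \<omega>) = (\<integral>x. (\<integral>s. ?f (x, s) \<partial>Q)\<^sup>2 \<partial>X)"
      unfolding summand_def ab(4) .
    then show ?thesis by (simp add: integral_obs_term(3)[OF good k])
  qed
  have diff: "expectation (\<lambda>\<omega>. summand k u a \<omega> * summand k u b \<omega>) = (\<beta> k u)\<^sup>2"
    if ab: "a \<in> ?V" "b \<in> ?V" "fst a \<noteq> fst b" for a b
  proof -
    let ?Z = "\<lambda>\<omega>. ((subj_field S (fst a) \<omega>, visit_draw a \<omega>), (subj_field S (fst b) \<omega>, visit_draw b \<omega>))"
    have [measurable]: "?Z \<in> \<Omega> \<rightarrow>\<^sub>M (X \<Otimes>\<^sub>M Q) \<Otimes>\<^sub>M (X \<Otimes>\<^sub>M Q)"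
      using ab by (intro measurable_Pair measurable_draw_pair)
    have "expectation (\<lambda>\<omega>. summand k u a \<omega> * summand k u b \<omega>)
        = (\<integral>z. ?f (fst z) * ?f (snd z) \<partial>(distr \<Omega> ((X \<Otimes>\<^sub>M Q) \<Otimes>\<^sub>M (X \<Otimes>\<^sub>M Q)) ?Z))"
      by (subst integral_distr) (auto simp: summand_def)
    also have "\<dots> = (\<integral>z. ?f z \<partial>(X \<Otimes>\<^sub>M Q))\<^sup>2"
      using ab by (subst law_two_subjects) (auto dest: visitsD intro!: integral_pair_mult Xte.P.prob_space_axioms f2)
    finally show ?thesis by (simp add: integral_obs_term(2)[OF good k])
  qed
  have w': "(\<Sum>a\<in>?V. ?w a) = 1"
    using w unfolding visits_def by (subst (asm) sum.Sigma) (auto simp: split_beta)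
  note mse = weighted_mean_square_error[where V = "summand k u" and w = ?w, OF fin _ int mean sq same diff w']
  show "integrable \<Omega> (\<lambda>\<omega>. (coef_hat P n m S w k \<omega> u - \<beta> k u)\<^sup>2)"
    unfolding coef_hat_eq by (rule mse(1)) (rule measurable_summand(2)[OF k])
  have "expectation (\<lambda>\<omega>. (coef_hat P n m S w k \<omega> u - \<beta> k u)\<^sup>2)
    = (\<Sum>a\<in>?V. (?w a)\<^sup>2) * (second_moment k u - (\<beta> k u)\<^sup>2)
      + (\<Sum>a\<in>?V. \<Sum>b | b \<in> ?V \<and> b \<noteq> a \<and> fst b = fst a. ?w a * ?w b) * field_coef_var k u"
    unfolding coef_hat_eq by (rule mse(2)) (rule measurable_summand(2)[OF k])
  also have "(\<Sum>a\<in>?V. (?w a)\<^sup>2) = sq_weights n m w"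
    unfolding sq_weights_def visits_def by (subst sum.Sigma) (auto simp: split_beta)
  \<comment> \<open>Visits \<open>b\<close> of the same subject as \<open>a\<close>, other than
    \<open>a\<close> itself, correspond to the visit numbers \<open>j'\<close> different from that
    of \<open>a\<close>.\<close>
  also have "(\<Sum>a\<in>?V. \<Sum>b | b \<in> ?V \<and> b \<noteq> a \<and> fst b = fst a. ?w a * ?w b) = cross_weights n m w"
  proof -
    have "(\<Sum>b | b \<in> ?V \<and> b \<noteq> a \<and> fst b = fst a. ?w a * ?w b)
        = (\<Sum>j'\<in>{1..m (fst a)} - {snd a}. w (fst a) (snd a) * w (fst a) j')" if "a \<in> ?V" for a
      by (rule sum.reindex_bij_witness[of _ "\<lambda>j'. (fst a, j')" snd])
        (use that in \<open>auto simp: visits_def prod_eq_iff\<close>)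
    then show ?thesis unfolding cross_weights_def
      by (subst sum.Sigma) (auto simp: visits_def split_beta intro!: sum.cong)
  qed
  finally show "expectation (\<lambda>\<omega>. (coef_hat P n m S w k \<omega> u - \<beta> k u)\<^sup>2)
      = sq_weights n m w * (second_moment k u - (\<beta> k u)\<^sup>2) + cross_weights n m w * field_coef_var k u" .
qed

end

section \<open>The integrated risk at a real truncation level\<close>

lemma risk_cong:
  assumes "{k. 1 \<le> k \<and> real k \<le> K} = {k. 1 \<le> k \<and> real k \<le> L}"
  shows "risk P n m S w K = risk P n m S w L"
  using assms by (simp add: risk_def mu_hat_def)

context fda_sampled begin

lemma measurable_coef_hat:
  assumes k: "1 \<le> k"
  shows "(\<lambda>z. coef_hat P n m S w k (snd z) (fst z)) \<in> borel_measurable (U \<Otimes>\<^sub>M \<Omega>)"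
  unfolding coef_hat_eq using measurable_summand[OF k]
  by (auto intro!: borel_measurable_sum borel_measurable_times simp: split_beta' simp del: One_nat_def)

text \<open>Pythagoras holds for every \<open>\<omega>\<close>, and its residual part is
  deterministic, so the expectation affects only the coefficient errors. Nonnegativity of
  \<open>R\<close> is recorded because \<open>ennreal\<close> sends negative numbers to 0.\<close>

lemma truncation_error:
  assumes good: "good_point u" and w: "(\<Sum>i=1..n. \<Sum>j=1..m i. w i j) = 1" and A: "finite A" "A \<subseteq> {1..}"
  defines "R \<equiv> (\<Sum>k\<in>A. sq_weights n m w * (second_moment k u - (\<beta> k u)\<^sup>2) + cross_weights n m w * field_coef_var k u)
      + (normsq T (\<mu> u) - (\<Sum>k\<in>A. (\<beta> k u)\<^sup>2))"
  shows "(\<integral>\<^sup>+\<omega>. (\<integral>\<^sup>+t. ennreal (((\<Sum>k\<in>A. coef_hat P n m S w k \<omega> u * \<phi> k t) - \<mu> u t)\<^sup>2) \<partial>T) \<partial>\<Omega>) = ennreal R"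
    and "0 \<le> R"
proof -
  have mu: "L2 T (\<mu> u)" using good by (simp add: good_point_def)
  let ?D = "\<lambda>\<omega>. (\<Sum>k\<in>A. (coef_hat P n m S w k \<omega> u - \<beta> k u)\<^sup>2) + (normsq T (\<mu> u) - (\<Sum>k\<in>A. (\<beta> k u)\<^sup>2))"
  have D0: "0 \<le> ?D \<omega>" for \<omega>
    using bessel_inequality[OF basis mu A] by (intro add_nonneg_nonneg sum_nonneg) (auto simp: mean_coef_def)
  have A1: "1 \<le> k" if "k \<in> A" for k using A that by auto
  have i: "integrable \<Omega> (\<lambda>\<omega>. \<Sum>k\<in>A. (coef_hat P n m S w k \<omega> u - \<beta> k u)\<^sup>2)"
    by (rule Bochner_Integration.integrable_sum) (rule mean_square_error_coef(1)[OF good A1 w])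
  have "(\<integral>\<^sup>+t. ennreal (((\<Sum>k\<in>A. coef_hat P n m S w k \<omega> u * \<phi> k t) - \<mu> u t)\<^sup>2) \<partial>T) = ennreal (?D \<omega>)" for \<omega>
    using nn_integral_eq_integral[OF orthonormal_expansion(1)[OF basis mu A, of "\<lambda>k. coef_hat P n m S w k \<omega> u"]]
      orthonormal_expansion(2)[OF basis mu A, of "\<lambda>k. coef_hat P n m S w k \<omega> u"]
    by (simp add: mean_coef_def)
  then have "(\<integral>\<^sup>+\<omega>. (\<integral>\<^sup>+t. ennreal (((\<Sum>k\<in>A. coef_hat P n m S w k \<omega> u * \<phi> k t) - \<mu> u t)\<^sup>2) \<partial>T) \<partial>\<Omega>)
      = (\<integral>\<^sup>+\<omega>. ennreal (?D \<omega>) \<partial>\<Omega>)" by simp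
  also have "\<dots> = ennreal (expectation ?D)"
    using i D0 by (intro nn_integral_eq_integral) auto
  also have ED: "expectation ?D = R"
  proof -
    have "expectation (\<lambda>\<omega>. \<Sum>k\<in>A. (coef_hat P n m S w k \<omega> u - \<beta> k u)\<^sup>2)
      = (\<Sum>k\<in>A. sq_weights n m w * (second_moment k u - (\<beta> k u)\<^sup>2) + cross_weights n m w * field_coef_var k u)"
      by (subst Bochner_Integration.integral_sum, rule mean_square_error_coef(1)[OF good A1 w], assumption,
          rule sum.cong[OF refl], rule mean_square_error_coef(2)[OF good A1 w])
    then show ?thesis using i by (simp add: R_def prob_space)
  qed
  finally show "(\<integral>\<^sup>+\<omega>. (\<integral>\<^sup>+t. ennreal (((\<Sum>k\<in>A. coef_hat P n m S w k \<omega> u * \<phi> k t) - \<mu> u t)\<^sup>2) \<partial>T) \<partial>\<Omega>) = ennreal R" .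
  have "0 \<le> expectation ?D" using D0 by (intro Bochner_Integration.integral_nonneg) auto
  then show "0 \<le> R" unfolding ED .
qed

lemma sq_weights_nonneg: "0 \<le> sq_weights n m w"
  by (auto simp: sq_weights_def intro!: sum_nonneg)

lemma risk_le_upper_bound:
  assumes w: "(\<Sum>i=1..n. \<Sum>j=1..m i. w i j) = 1"
    and smooth: "mean_smooth P s Cs" and s: "0 < s" and K: "0 < K"
  shows "risk P n m S w K \<le> ereal (upper_bound P s Cs n m w K)"
proof -
  \<comment> \<open>For \<open>K < 1\<close> this gives \<open>J = 0\<close> and an empty
    \<open>A\<close>: the estimator is 0, the risk is pure bias, and the argument below still
    applies.\<close>
  define J where "J = nat \<lfloor>K\<rfloor>"
  define A where "A = {1..J}"
  let ?q = "sq_weights n m w" and ?d = "cross_weights n m w"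
  have J: "real J \<le> K" using K unfolding J_def by linarith
  have set: "{k. 1 \<le> k \<and> real k \<le> K} = A" unfolding J_def A_def using K by (auto simp: le_nat_floor le_nat_iff le_floor_iff)
  have A: "finite A" "A \<subseteq> {1..}" "card A = J" by (auto simp: A_def)
  have A1: "1 \<le> k" if "k \<in> A" for k using that by (simp add: A_def)
  note q = sq_weights_nonneg[of w]
  let ?H = "\<lambda>u \<omega> t. ennreal (((\<Sum>k\<in>A. coef_hat P n m S w k \<omega> u * \<phi> k t) - \<mu> u t)\<^sup>2)"
  \<comment> \<open>This majorant at \<open>u\<close> replaces the signed cross term by its positive
    part times the field energy, so it holds for either sign of the cross weights.\<close>
  let ?B = "\<lambda>u. ?q * (\<Sum>k\<in>A. second_moment k u - (\<beta> k u)\<^sup>2) + max ?d 0 * field_energy u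
      + (normsq T (\<mu> u) - (\<Sum>k\<in>A. (\<beta> k u)\<^sup>2))"
  interpret UO: pair_sigma_finite U \<Omega> ..
  have H: "(\<lambda>x. ?H (fst (fst x)) (snd (fst x)) (snd x)) \<in> borel_measurable ((U \<Otimes>\<^sub>M \<Omega>) \<Otimes>\<^sub>M T)"
  proof -
    have *: "(\<lambda>x. coef_hat P n m S w k (snd (fst x)) (fst (fst x))) \<in> borel_measurable ((U \<Otimes>\<^sub>M \<Omega>) \<Otimes>\<^sub>M T)" if "k \<in> A" for k
      using measurable_compose[OF measurable_fst measurable_coef_hat(1)[OF A1[OF that]]] .
    have **: "(\<lambda>x. \<phi> k (snd x)) \<in> borel_measurable ((U \<Otimes>\<^sub>M \<Omega>) \<Otimes>\<^sub>M T)" if "k \<in> A" for k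
      using measurable_compose[OF measurable_snd measurable_\<phi>[OF A1[OF that]]] .
    have [measurable]: "(\<lambda>x. \<Sum>k\<in>A. coef_hat P n m S w k (snd (fst x)) (fst (fst x)) * \<phi> k (snd x))
        \<in> borel_measurable ((U \<Otimes>\<^sub>M \<Omega>) \<Otimes>\<^sub>M T)"
      by (intro borel_measurable_sum borel_measurable_times * **)
    show ?thesis by measurable
  qed
  \<comment> \<open>The risk integrates over \<open>u\<close> inside the expectation, whereas the
    error is controlled for fixed \<open>u\<close>; thus \<open>u\<close> has to become the
    outermost variable.\<close>
  have swap: "(\<integral>\<^sup>+\<omega>. (\<integral>\<^sup>+z. ennreal ((mu_hat P n m S w K \<omega> (fst z) (snd z) - mean_fn P (fst z) (snd z))\<^sup>2) \<partial>UT P) \<partial>\<Omega>)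
      = (\<integral>\<^sup>+u. (\<integral>\<^sup>+\<omega>. (\<integral>\<^sup>+t. ?H u \<omega> t \<partial>T) \<partial>\<Omega>) \<partial>U)"
  proof -
    have "(\<integral>\<^sup>+z. ennreal ((mu_hat P n m S w K \<omega> (fst z) (snd z) - mean_fn P (fst z) (snd z))\<^sup>2) \<partial>UT P)
        = (\<integral>\<^sup>+u. (\<integral>\<^sup>+t. ?H u \<omega> t \<partial>T) \<partial>U)" if \<omega>: "\<omega> \<in> space \<Omega>" for \<omega>
    proof -
      have "(\<lambda>z. ((fst z, \<omega>), snd z)) \<in> U \<Otimes>\<^sub>M T \<rightarrow>\<^sub>M (U \<Otimes>\<^sub>M \<Omega>) \<Otimes>\<^sub>M T" using \<omega> by measurable
      from measurable_compose[OF this H]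
      have "(\<lambda>z. ?H (fst z) \<omega> (snd z)) \<in> borel_measurable (U \<Otimes>\<^sub>M T)" by (simp only: fst_conv snd_conv)
      from T.nn_integral_fst[OF this] show ?thesis by (simp add: UT_def mu_hat_def set[simplified])
    qed
    then have "(\<integral>\<^sup>+\<omega>. (\<integral>\<^sup>+z. ennreal ((mu_hat P n m S w K \<omega> (fst z) (snd z) - mean_fn P (fst z) (snd z))\<^sup>2) \<partial>UT P) \<partial>\<Omega>)
      = (\<integral>\<^sup>+\<omega>. (\<integral>\<^sup>+u. (\<integral>\<^sup>+t. ?H u \<omega> t \<partial>T) \<partial>U) \<partial>\<Omega>)" by (intro nn_integral_cong) simp
    also have "\<dots> = (\<integral>\<^sup>+u. (\<integral>\<^sup>+\<omega>. (\<integral>\<^sup>+t. ?H u \<omega> t \<partial>T) \<partial>\<Omega>) \<partial>U)"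
    proof (rule UO.Fubini')
      have "(\<lambda>x. \<integral>\<^sup>+t. ?H (fst x) (snd x) t \<partial>T) \<in> borel_measurable (U \<Otimes>\<^sub>M \<Omega>)"
        by (rule T.borel_measurable_nn_integral) (unfold split_beta', rule H)
      then show "(\<lambda>(u, \<omega>). \<integral>\<^sup>+t. ?H u \<omega> t \<partial>T) \<in> borel_measurable (U \<Otimes>\<^sub>M \<Omega>)" by (simp add: split_beta')
    qed
    finally show ?thesis .
  qed
  have pointwise: "AE u in U. (\<integral>\<^sup>+\<omega>. (\<integral>\<^sup>+t. ?H u \<omega> t \<partial>T) \<partial>\<Omega>) \<le> ennreal (?B u) \<and> 0 \<le> ?B u"
    using AE_good_point
  proof eventually_elim
    case (elim u)
    have "0 \<le> (\<Sum>k\<in>A. field_coef_var k u)" by (intro sum_nonneg) (simp add: field_coef_var_def)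
    then have "?d * (\<Sum>k\<in>A. field_coef_var k u) \<le> max ?d 0 * field_energy u"
      using sum_field_coef_var_le[OF elim A(1,2)] by (intro mult_mono) auto
    then show ?case
      using truncation_error[OF elim w A(1,2)]
      by (auto simp: sum.distrib sum_distrib_left[symmetric] intro!: ennreal_leI)
  qed
  have i: "integrable U ?B"
    by (intro Bochner_Integration.integrable_add Bochner_Integration.integrable_diff integrable_mult_right
        Bochner_Integration.integrable_sum integrable_second_moment integrable_mean_coef_sq
        integrable_field_energy integral_normsq_mean(1) A1)
  have "(\<integral>\<^sup>+u. (\<integral>\<^sup>+\<omega>. (\<integral>\<^sup>+t. ?H u \<omega> t \<partial>T) \<partial>\<Omega>) \<partial>U) \<le> (\<integral>\<^sup>+u. ennreal (?B u) \<partial>U)"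
    using pointwise by (intro nn_integral_mono_AE) auto
  also have "\<dots> = ennreal (\<integral>u. ?B u \<partial>U)"
    using pointwise by (intro nn_integral_eq_integral i) auto
  finally have le: "risk P n m S w K \<le> enn2ereal (ennreal (\<integral>u. ?B u \<partial>U))"
    unfolding risk_def swap by (simp add: less_eq_ennreal.rep_eq)
  have "0 \<le> (\<integral>u. ?B u \<partial>U)" using pointwise by (intro integral_nonneg_AE) auto
  with le have le: "risk P n m S w K \<le> ereal (\<integral>u. ?B u \<partial>U)" by (simp add: enn2ereal_ennreal)
  let ?b = "\<Sum>k\<in>A. normsq U (\<beta> k)"
  have "(\<integral>u. ?B u \<partial>U) = ?q * (\<Sum>k\<in>A. (\<integral>u. second_moment k u \<partial>U) - normsq U (\<beta> k)) + max ?d 0 * C2 P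
      + (mean_normsq P - ?b)"
  proof -
    have 1: "integrable U (\<lambda>u. \<Sum>k\<in>A. second_moment k u - (\<beta> k u)\<^sup>2)"
      by (intro Bochner_Integration.integrable_diff
        Bochner_Integration.integrable_sum integrable_second_moment integrable_mean_coef_sq A1)
    have 2: "integrable U (\<lambda>u. \<Sum>k\<in>A. (\<beta> k u)\<^sup>2)"
      by (intro Bochner_Integration.integrable_sum integrable_mean_coef_sq A1)
    have 3: "(\<integral>u. (\<Sum>k\<in>A. second_moment k u - (\<beta> k u)\<^sup>2) \<partial>U) = (\<Sum>k\<in>A. (\<integral>u. second_moment k u \<partial>U) - normsq U (\<beta> k))"
    proof -
      have ik: "integrable U (second_moment k)" "integrable U (\<lambda>u. (\<beta> k u)\<^sup>2)" if "k \<in> A" for k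
        by (rule integrable_second_moment[OF A1[OF that]], rule integrable_mean_coef_sq[OF A1[OF that]])
      show ?thesis unfolding normsq_def
        by (subst Bochner_Integration.integral_sum) (simp_all add: ik)
    qed
    have 4: "(\<integral>u. (\<Sum>k\<in>A. (\<beta> k u)\<^sup>2) \<partial>U) = ?b"
      unfolding normsq_def by (rule Bochner_Integration.integral_sum) (rule integrable_mean_coef_sq[OF A1])
    show ?thesis
      using 1 2 integral_normsq_mean(1) integrable_field_energy
      by (simp add: 3 4 integral_normsq_mean(2) integral_field_energy)
  qed
  also have "\<dots> \<le> ?q * (real J * C1 P - ?b) + max ?d 0 * C2 P + (mean_normsq P - ?b)"
  proof -
    have "(\<Sum>k\<in>A. (\<integral>u. second_moment k u \<partial>U) - normsq U (\<beta> k)) \<le> (\<Sum>k\<in>A. C1 P - normsq U (\<beta> k))"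
      by (intro sum_mono diff_right_mono integral_second_moment_le A1)
    then have "(\<Sum>k\<in>A. (\<integral>u. second_moment k u \<partial>U) - normsq U (\<beta> k)) \<le> real J * C1 P - ?b"
      by (simp add: sum_subtractf A(3))
    then show ?thesis using q by (intro add_right_mono mult_left_mono)
  qed
  \<comment> \<open>The tail estimate is used twice: for the bias itself, and to replace the
    subtracted \<open>?b\<close> by \<open>mean_normsq P\<close> minus the tail. The second use
    produces the power term inside the factor \<open>?q\<close>.\<close>
  also have "\<dots> \<le> upper_bound P s Cs n m w K"
  proof -
    have tail: "mean_normsq P - ?b \<le> Cs * K powr (- 2 * s)"
      unfolding A_def
    proof (rule bias_le[OF smooth s K])
      fix k assume "J < k"
      then show "K \<le> real k" unfolding J_def using K by linarith
    qed
    have "real J * C1 P \<le> C1 P * K" using J C1_pos by (simp add: mult.commute)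
    then have "?q * (real J * C1 P - ?b) \<le> ?q * (C1 P * K - mean_normsq P + Cs * K powr (- 2 * s))"
      using tail q by (intro mult_left_mono) auto
    then show ?thesis unfolding upper_bound_eq using tail by linarith
  qed
  finally have "(\<integral>u. ?B u \<partial>U) \<le> upper_bound P s Cs n m w K" .
  then show ?thesis using le by (meson ereal_less_eq(3) order_trans)
qed

end

text \<open>For a nearest integer \<open>r\<close>, which may lie below \<open>K\<close> or even be \<open>0\<close>, take \<open>r + 1 / 2\<close>.\<close>

lemma exists_near_level:
  assumes "0 < K" "K' \<in> {K, of_int \<lceil>K\<rceil>, of_int (round K)}"
  obtains L where "K \<le> L" "L \<le> K + 1"
    "\<And>P n m S w. risk P n m S w K' = risk P n m S w L"
proof (cases "K' = of_int (round K)")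
  case True
  let ?r = "round K"
  have "real k \<le> of_int ?r \<longleftrightarrow> real k \<le> of_int ?r + 1 / 2" for k
  proof (cases "int k \<le> ?r")
    case False
    then have "of_int (?r + 1) \<le> (of_int (int k) :: real)" by (intro of_int_le_iff[THEN iffD2]) simp
    then show ?thesis by simp
  qed linarith
  then have "risk P n m S w K' = risk P n m S w (of_int ?r + 1 / 2)" for P n m S w
    unfolding True by (intro risk_cong) simp
  \<comment> \<open>By definition \<open>round K\<close> is the floor of \<open>K + 1 / 2\<close>,
    so it lies above \<open>K - 1 / 2\<close> and does not exceed \<open>K + 1 / 2\<close>.\<close>
  moreover have "K \<le> of_int ?r + 1 / 2" "of_int ?r + 1 / 2 \<le> K + 1"
    unfolding round_def by linarith+
  ultimately show ?thesis by (rule that[rotated 2])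
next
  case False
  then have "K' = K \<or> K' = of_int \<lceil>K\<rceil>" using assms(2) by simp
  then have "K \<le> K' \<and> K' \<le> K + 1" by (elim disjE) (simp, linarith)
  then show ?thesis by (intro that[of K']) auto
qed

theorem corollary1:
  fixes P :: "('u::{metric_space,second_countable_topology}) fda_model"
    and s Cs :: real and m_max :: nat
  assumes "model_ok P"
    and "basis_lipschitz P"
    and "0 < s" and "0 < Cs" and "mean_smooth P s Cs"
    and "Gamma_continuous P"
    and "0 < C1 P"
  shows
    \<comment> \<open>optimal truncations\<close>
    "(\<forall>n m. design n m \<longrightarrow>
        {K. is_arg_min (upper_bound P s Cs n m (w_obs n m)) (\<lambda>K. 0 < K) K}
          = {K_star P s Cs (real n * arith_mean n m)} \<and>
        {K. is_arg_min (upper_bound P s Cs n m (w_subj n m)) (\<lambda>K. 0 < K) K}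
          = {K_star P s Cs (real n * harm_mean n m)})
     \<and>
     \<comment> \<open>risk bounds\<close>
     (\<forall>(n, m)\<in>bounded_designs m_max.
        upper_bound P s Cs n m (w_obs n m) (K_star P s Cs (real n * arith_mean n m))
          \<le> optimal_rhs P s Cs m_max n m (real n * arith_mean n m) \<and>
        upper_bound P s Cs n m (w_subj n m) (K_star P s Cs (real n * harm_mean n m))
          \<le> optimal_rhs P s Cs m_max n m (real n * harm_mean n m))
     \<and>
     (\<forall>(n, m)\<in>bounded_designs m_max. \<forall>S :: ('w, 'u) fda_sample. sample_ok P n m S \<longrightarrow>
        risk P n m S (w_obs n m) (K_star P s Cs (real n * arith_mean n m))
          \<le> ereal (optimal_rhs P s Cs m_max n m (real n * arith_mean n m)) \<and>
        risk P n m S (w_subj n m) (K_star P s Cs (real n * harm_mean n m))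
          \<le> ereal (optimal_rhs P s Cs m_max n m (real n * harm_mean n m)))
     \<and>
     \<comment> \<open>the factor decreases to 1\<close>
     (\<forall>N N'. 0 < N \<longrightarrow> N < N' \<longrightarrow> 1 < C_factor s N' \<and> C_factor s N' < C_factor s N) \<and>
     (\<forall>m. (\<forall>n\<ge>1. (n, m n) \<in> bounded_designs m_max) \<longrightarrow>
        (\<lambda>n. C_factor s (real n * arith_mean n (m n))) \<longlonglongrightarrow> 1 \<and>
        (\<lambda>n. C_factor s (real n * harm_mean n (m n))) \<longlonglongrightarrow> 1) \<and>
     (\<forall>m. (\<forall>n\<ge>1. (n, m) \<in> bounded_designs m_max) \<longrightarrow>
        decseq (\<lambda>n. C_factor s (real (Suc n) * arith_mean (Suc n) m)))
     \<and>
     \<comment> \<open>rates, with constants depending neither on the design nor on the sample\<close>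
     (\<exists>C>0. \<forall>(n, m)\<in>bounded_designs m_max. \<forall>S :: ('w, 'u) fda_sample. sample_ok P n m S \<longrightarrow>
        (let K1 = K_star P s Cs (real n * arith_mean n m);
             K2 = K_star P s Cs (real n * harm_mean n m)
         in (\<forall>K\<in>{K1, of_int \<lceil>K1\<rceil>, of_int (round K1)}.
               risk P n m S (w_obs n m) K \<le> ereal (C * rate s (real n * harm_mean n m))) \<and>
            (\<forall>K\<in>{K2, of_int \<lceil>K2\<rceil>, of_int (round K2)}.
               risk P n m S (w_subj n m) K \<le> ereal (C * rate s (real n * harm_mean n m)))))
     \<and>
     asymp_equal_on (bounded_designs m_max)
       (\<lambda>(n, m). rate s (real n * harm_mean n m)) (\<lambda>(n, m). rate s (real n * arith_mean n m)) \<and>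
     asymp_equal_on (bounded_designs m_max)
       (\<lambda>(n, m). rate s (real n * arith_mean n m)) (\<lambda>(n, m). rate s (real n)) \<and>
     asymp_equal_on (bounded_designs m_max)
       (\<lambda>(n, m). rate s (real n)) (\<lambda>(n, m). rate s (real (total_visits n m)))"
proof -
  note s = \<open>0 < s\<close> and Cs = \<open>0 < Cs\<close> and smooth = \<open>mean_smooth P s Cs\<close> and C1 = \<open>0 < C1 P\<close>
  interpret fda P using assms by unfold_locales
  let ?B = "bounded_designs m_max"
  let ?Na = "\<lambda>n m. real n * arith_mean n m" and ?Nh = "\<lambda>n m. real n * harm_mean n m"
  let ?u = "upper_bound P s Cs" and ?o = "optimal_rhs P s Cs m_max" and ?K = "K_star P s Cs"
  have dn: "design n m" if "(n, m) \<in> ?B" for n m using that by (simp add: bounded_designs_def)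
  have n: "1 \<le> n" if "design n m" for n m using that by (simp add: design_def)
  have Na: "real n \<le> ?Na n m" if "design n m" for n m
    using total_visits_arith[OF that] n_le_total_visits[OF that] by simp
  have Na': "?Na n m \<le> real n * real m_max" if "(n, m) \<in> ?B" for n m
    using total_visits_arith[OF dn[OF that]] total_visits_le[OF that] by (metis of_nat_le_iff of_nat_mult)
  note Nh = harm_bounds(1) and Nh' = harm_bounds(2)[OF dn]
  have pos: "0 < ?Na n m" "0 < ?Nh n m" if "design n m" for n m
    using Na[OF that] Nh[OF that] n[OF that] by linarith+
  have argmin: "{K. is_arg_min (?u n m (w_obs n m)) (\<lambda>K. 0 < K) K} = {?K (?Na n m)} \<and>
        {K. is_arg_min (?u n m (w_subj n m)) (\<lambda>K. 0 < K) K} = {?K (?Nh n m)}" if d: "design n m" for n m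
    using is_arg_min_upper_bound[OF s Cs C1 pos(1)[OF d] weights_obs(2)[OF d]]
      is_arg_min_upper_bound[OF s Cs C1 pos(2)[OF d] weights_subj(2)[OF d]] by simp
  have bound: "?u n m (w_obs n m) (?K (?Na n m)) \<le> ?o n m (?Na n m)"
      "?u n m (w_subj n m) (?K (?Nh n m)) \<le> ?o n m (?Nh n m)" if b: "(n, m) \<in> ?B" for n m
    using upper_bound_K_star_le[OF s Cs C1 pos(1)[OF dn[OF b]] weights_obs(2)[OF dn[OF b]] cross_weights_obs_le[OF b]]
      upper_bound_K_star_le[OF s Cs C1 pos(2)[OF dn[OF b]] weights_subj(2)[OF dn[OF b]] cross_weights_subj_le[OF b]] .
  \<comment> \<open>The level is left arbitrary, since the same bound is needed at the optimal level
    and at the nearby levels that represent rounding.\<close>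
  have risk: "risk P n m S (w_obs n m) K \<le> ereal (?u n m (w_obs n m) K)"
      "risk P n m S (w_subj n m) K \<le> ereal (?u n m (w_subj n m) K)"
    if "design n m" "sample_ok P n m S" "0 < K" for n m and S :: "('w, 'u) fda_sample" and K
  proof -
    interpret fda_sampled P n m S by unfold_locales (rule that(2))
    show "risk P n m S (w_obs n m) K \<le> ereal (?u n m (w_obs n m) K)"
      "risk P n m S (w_subj n m) K \<le> ereal (?u n m (w_subj n m) K)"
      using risk_le_upper_bound[OF weights_obs(1)[OF that(1)] smooth s that(3)]
        risk_le_upper_bound[OF weights_subj(1)[OF that(1)] smooth s that(3)] .
  qed
  have risk_star: "risk P n m S (w_obs n m) (?K (?Na n m)) \<le> ereal (?o n m (?Na n m)) \<and>
        risk P n m S (w_subj n m) (?K (?Nh n m)) \<le> ereal (?o n m (?Nh n m))"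
    if b: "(n, m) \<in> ?B" and S: "sample_ok P n m S" for n m and S :: "('w, 'u) fda_sample"
    using risk(1)[OF dn[OF b] S K_star_pos[OF s Cs C1 pos(1)[OF dn[OF b]]]]
      risk(2)[OF dn[OF b] S K_star_pos[OF s Cs C1 pos(2)[OF dn[OF b]]]] bound[OF b]
    by (meson ereal_less_eq(3) order_trans)
  \<comment> \<open>For a fixed sequence of visit counts, \<open>n\<close> times the arithmetic mean
    is the total number of visits, which grows with each new subject because that subject has at
    least one visit.\<close>
  have dec: "decseq (\<lambda>n. C_factor s (?Na (Suc n) m))" if b: "\<forall>n\<ge>1. (n, m) \<in> ?B" for m
  proof (rule decseq_SucI)
    fix k
    have d: "design (Suc k) m" "design (Suc (Suc k)) m" using b dn by auto
    then have "total_visits (Suc k) m < total_visits (Suc (Suc k)) m"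
      by (auto simp: total_visits_def design_def Suc_le_eq)
    then have "?Na (Suc k) m < ?Na (Suc (Suc k)) m" unfolding total_visits_arith[OF d(1)] total_visits_arith[OF d(2)] by simp
    then show "C_factor s (?Na (Suc (Suc k)) m) \<le> C_factor s (?Na (Suc k) m)"
      using C_factor_strict_antimono(2)[OF s pos(1)[OF d(1)]] by (intro less_imp_le)
  qed
  have tot: "real n \<le> real (total_visits n m) \<and> real (total_visits n m) \<le> real n * real m_max" if "(n, m) \<in> ?B" for n m
    using Na[OF dn[OF that]] Na'[OF that] total_visits_arith[OF dn[OF that]] by simp
  have nn: "real n \<le> real n \<and> real n \<le> real n * real m_max" if "(n, m) \<in> ?B" for n m
    using Na[OF dn[OF that]] Na'[OF that] by linarith
  have na: "real n \<le> ?Na n m \<and> ?Na n m \<le> real n * real m_max" if "(n, m) \<in> ?B" for n m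
    using Na[OF dn[OF that]] Na'[OF that] by linarith
  have nh: "real n \<le> ?Nh n m \<and> ?Nh n m \<le> real n * real m_max" if "(n, m) \<in> ?B" for n m
    using Nh[OF dn[OF that]] Nh'[OF that that] by linarith
  \<comment> \<open>This constant compares the bound, including the rounding cost, with
    \<open>rate s n\<close>. The constant \<open>C0\<close> then passes to the rate in the harmonic
    mean, so \<open>c * C0\<close> depends neither on the design nor on the sample.\<close>
  define c where "c = 2 powr (1 / (2 * s + 1)) * ((2 * s + 1) / (2 * s) * (2 * s * Cs * C1 P powr (2 * s)) powr (1 / (2 * s + 1)))
        + C2 P * real m_max + C1 P"
  have c: "0 < c" unfolding c_def using s C1 C2_nonneg[of P] by (intro add_nonneg_pos add_nonneg_nonneg) auto
  obtain C0 where C0: "0 < C0" and le0: "\<And>n m. (n, m) \<in> ?B \<Longrightarrow> rate s (real n) \<le> C0 * rate s (?Nh n m)"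
  proof -
    have "lesssim_on ?B (\<lambda>(n, m). rate s (real n)) (\<lambda>(n, m). rate s (?Nh n m))"
      by (rule rate_comparison[OF s nn nh])
    then obtain C where "0 < C" "\<forall>z\<in>?B. (case z of (n, m) \<Rightarrow> rate s (real n)) \<le> C * (case z of (n, m) \<Rightarrow> rate s (?Nh n m))"
      unfolding lesssim_on_def by blast
    then show ?thesis by (intro that[of C]) auto
  qed
  have mm: "0 \<le> mean_normsq P" by (simp add: mean_normsq_def normsq_def)
  \<comment> \<open>Stated for abstract weights and \<open>N\<close>, this covers both schemes and
    all three versions of the level.\<close>
  have near: "risk P n m S w K' \<le> ereal (c * C0 * rate s (?Nh n m))"
    if b: "(n, m) \<in> ?B" and N: "real n \<le> N" and sq: "sq_weights n m w = 1 / N"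
      and cr: "max (cross_weights n m w) 0 \<le> real m_max / real (total_visits n m)"
      and risk: "\<And>K. 0 < K \<Longrightarrow> risk P n m S w K \<le> ereal (?u n m w K)"
      and K': "K' \<in> {?K N, of_int \<lceil>?K N\<rceil>, of_int (round (?K N))}"
    for n m N w K' and S :: "('w, 'u) fda_sample"
  proof -
    have N0: "0 < N" using N n[OF dn[OF b]] by linarith
    have K0: "0 < ?K N" by (rule K_star_pos[OF s Cs C1 N0])
    obtain L where L: "?K N \<le> L" "L \<le> ?K N + 1" "risk P n m S w K' = risk P n m S w L"
      using exists_near_level[OF K0 K'] by metis
    have "risk P n m S w K' \<le> ereal (?u n m w L)" unfolding L(3) using K0 L(1) by (intro risk) linarith
    also have "?u n m w L \<le> c * C0 * rate s (?Nh n m)"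
    proof -
      have "?u n m w L \<le> ?o n m N + C1 P / N"
        by (rule upper_bound_near_K_star_le[OF s Cs C1 N0 sq cr L(1,2)])
      also have "\<dots> \<le> c * rate s (real n)"
        unfolding c_def
        by (rule optimal_rhs_le_rate[OF s Cs C1 mm n[OF dn[OF b]] n_le_total_visits[OF dn[OF b]] N])
      also have "\<dots> \<le> c * (C0 * rate s (?Nh n m))" using c by (intro mult_left_mono le0[OF b]) simp
      finally show ?thesis by (simp add: mult.assoc)
    qed
    finally show ?thesis by simp
  qed
  have rates: "\<exists>C>0. \<forall>(n, m)\<in>?B. \<forall>S :: ('w, 'u) fda_sample. sample_ok P n m S \<longrightarrow>
        (let K1 = ?K (?Na n m); K2 = ?K (?Nh n m)
         in (\<forall>K\<in>{K1, of_int \<lceil>K1\<rceil>, of_int (round K1)}.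
               risk P n m S (w_obs n m) K \<le> ereal (C * rate s (?Nh n m))) \<and>
            (\<forall>K\<in>{K2, of_int \<lceil>K2\<rceil>, of_int (round K2)}.
               risk P n m S (w_subj n m) K \<le> ereal (C * rate s (?Nh n m))))"
  proof (intro exI[of _ "c * C0"] conjI)
    show "0 < c * C0" using c C0 by simp
    have main: "let K1 = ?K (?Na n m); K2 = ?K (?Nh n m)
         in (\<forall>K\<in>{K1, of_int \<lceil>K1\<rceil>, of_int (round K1)}.
               risk P n m S (w_obs n m) K \<le> ereal (c * C0 * rate s (?Nh n m))) \<and>
            (\<forall>K\<in>{K2, of_int \<lceil>K2\<rceil>, of_int (round K2)}.
               risk P n m S (w_subj n m) K \<le> ereal (c * C0 * rate s (?Nh n m)))"
      if b: "(n, m) \<in> ?B" and S: "sample_ok P n m S" for n m and S :: "('w, 'u) fda_sample"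
      using near[OF b Na[OF dn[OF b]] weights_obs(2)[OF dn[OF b]] cross_weights_obs_le[OF b] risk(1)[OF dn[OF b] S]]
        near[OF b Nh[OF dn[OF b]] weights_subj(2)[OF dn[OF b]] cross_weights_subj_le[OF b] risk(2)[OF dn[OF b] S]]
      unfolding Let_def by blast
    show "\<forall>(n, m)\<in>?B. \<forall>S :: ('w, 'u) fda_sample. sample_ok P n m S \<longrightarrow>
        (let K1 = ?K (?Na n m); K2 = ?K (?Nh n m)
         in (\<forall>K\<in>{K1, of_int \<lceil>K1\<rceil>, of_int (round K1)}.
               risk P n m S (w_obs n m) K \<le> ereal (c * C0 * rate s (?Nh n m))) \<and>
            (\<forall>K\<in>{K2, of_int \<lceil>K2\<rceil>, of_int (round K2)}.
               risk P n m S (w_subj n m) K \<le> ereal (c * C0 * rate s (?Nh n m))))"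
      by (clarify, rule main)
  qed
  have limits: "(\<lambda>n. C_factor s (?Na n (m n))) \<longlonglongrightarrow> 1 \<and> (\<lambda>n. C_factor s (?Nh n (m n))) \<longlonglongrightarrow> 1"
    if "\<forall>n\<ge>1. (n, m n) \<in> ?B" for m
    using that by (intro conjI C_factor_tendsto s Na Nh dn) auto
  have asymp:
    "asymp_equal_on ?B (\<lambda>(n, m). rate s (?Nh n m)) (\<lambda>(n, m). rate s (?Na n m))"
    "asymp_equal_on ?B (\<lambda>(n, m). rate s (?Na n m)) (\<lambda>(n, m). rate s (real n))"
    "asymp_equal_on ?B (\<lambda>(n, m). rate s (real n)) (\<lambda>(n, m). rate s (real (total_visits n m)))"
    unfolding asymp_equal_on_def
    by (intro conjI rate_comparison[OF s] nh na nn tot; assumption)+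
  show ?thesis
    using argmin bound risk_star C_factor_strict_antimono[OF s] limits dec rates asymp
    by (intro conjI) blast+
qed

end
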